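(* For $2\leq k\leq n$ let $\tau_{\mathrm{mix}}=\tau_{\mathrm{mix}}(n,k)$ be the mixing time of the bottom-to-top shuffle on $n$ cards in which the card moved to the top at each shuffle is chosen uniformly among the bottom $k$ cards. Let $k=k(n)$ and let $n\to\infty$. (i) If $k=o(n)$, then $$(1+o(1))\,\frac{n^3}{4\pi^2 k(k-1)}\log n \;<\; \tau_{\mathrm{mix}} \;<\; (1+o(1))\,\frac{n^3}{\pi^2 k(k-1)}\log n .$$ (ii) If $k=\Theta(n)$, then $\tau_{\mathrm{mix}} = \Theta(n\log n)$.
   Context: Bottom-to-top shuffle with parameter $k$: the state space is the set $S_n$ of orderings of a deck of $n$ cards, with positions $1$ (top) to $n$ (bottom). At each time step, independently of the past, a position is chosen uniformly at random from $\{n-k+1,\ldots,n\}$ and the card in that position is moved to the top of the deck without altering the relative order of the other cards. The stationary distribution is the uniform distribution on $S_n$. Mixing time: with $\|\mu-\nu\|=\frac12\sum_s|\mu(s)-\nu(s)|$ and $\nu_{\mathrm{st}}$ the stationary distribution, $\tau_{\mathrm{mix}} := \max_s\min\{t : \|P(X_t\in\cdot\mid X_0=s)-\nu_{\mathrm{st}}\|\leq 1/4\}$. Asymptotic notation refers to $n\to\infty$ for a sequence $k=k(n)$; $\log$ is the natural logarithm and $\pi=3.14159\ldots$ in the claim. *)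

theory Defs
  imports "HOL-Probability.Probability" "HOL-Combinatorics.Multiset_Permutations"
    "HOL-Library.Landau_Symbols"
begin

text \<open>
  A deck is the list of its cards from top to bottom. Positions are counted from 1, so the
  card in position \<open>j\<close> of \<open>xs\<close> is \<open>xs ! (j - 1)\<close>.
\<close>

definition orderings :: "nat \<Rightarrow> nat list set" where
  "orderings n = permutations_of_set {1..n}"

definition move_to_top :: "nat \<Rightarrow> 'a list \<Rightarrow> 'a list" where
  "move_to_top j xs = xs ! (j - 1) # take (j - 1) xs @ drop j xs"

definition shuffle_step :: "nat \<Rightarrow> nat \<Rightarrow> 'a list \<Rightarrow> 'a list pmf" where
  "shuffle_step n k xs = map_pmf (\<lambda>j. move_to_top j xs) (pmf_of_set {n - k + 1..n})"

text \<open>The conditional law of \<open>X\<^sub>t\<close> given \<open>X\<^sub>0 = s\<close>.\<close>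

primrec shuffle_law :: "nat \<Rightarrow> nat \<Rightarrow> 'a list \<Rightarrow> nat \<Rightarrow> 'a list pmf" where
  "shuffle_law n k s 0 = return_pmf s"
| "shuffle_law n k s (Suc t) = bind_pmf (shuffle_law n k s t) (shuffle_step n k)"

text \<open>Total variation distance of two distributions supported on the finite set \<open>S\<close>.\<close>

definition tv_dist :: "'a set \<Rightarrow> 'a pmf \<Rightarrow> 'a pmf \<Rightarrow> real" where
  "tv_dist S \<mu> \<nu> = 1 / 2 * (\<Sum>s\<in>S. \<bar>pmf \<mu> s - pmf \<nu> s\<bar>)"

text \<open>
  For \<open>2 \<le> k \<le> n\<close> the chain is irreducible and aperiodic, so the set of times over which the
  least element is taken is nonempty; its stationary distribution is uniform.
\<close>

definition mixing_time :: "nat \<Rightarrow> nat \<Rightarrow> nat" where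
  "mixing_time n k = Max ((\<lambda>s. LEAST t.
     tv_dist (orderings n) (shuffle_law n k s t) (pmf_of_set (orderings n)) \<le> 1 / 4) ` orderings n)"

end

theory Submission
  imports Defs "HOL-Real_Asymp.Real_Asymp"
begin

text \<open>
  Only the bottom \<open>k\<close> positions are random. A card that reaches the top sinks
  deterministically for \<open>n - k\<close> steps; from then on it is picked with probability \<open>1 / k\<close> per step,
  wherever it sits in the bottom zone. So the times at which a fixed card is on top form a renewal
  process whose gaps are \<open>n - k\<close> plus a geometric time: mean \<open>n\<close>, variance \<open>k (k - 1)\<close>. For one card
  the only relevant coordinate is therefore its \<^emph>\<open>depth\<close>: its position, with the whole bottom
  zone collapsed to the single value \<open>n - k\<close>.

  For the upper bound, couple the deck with a stationary one: whenever the picked card lies in both bottom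
  zones, pick it in both decks. It then reaches the two tops together, and its depths agree from
  that moment on; once this has happened to all cards the decks coincide. Until it is matched, the
  two copies of a card perform independent renewal processes whose phase difference is a random
  walk on an interval of length about \<open>n\<close>, killed when both copies are in the bottom zone. The
  principal eigenfunction of such a walk is a cosine of the phase difference. This suggests the
  weight \<open>r ^ (a + b) * cos (\<theta> * \<bar>a - b\<bar> - \<phi>)\<close> of two depths \<open>a\<close> and \<open>b\<close>. It decreases in mean by
  the factor \<open>r\<^sup>2\<close> (\<open>card_weight_drift\<close>) as soon as the modulus of \<open>z ^ (n - k) * (k * z - (k - 1))\<close>,
  \<open>z = rcis r \<theta>\<close>, is at least 1 and \<open>\<phi>\<close> is half its argument. Bernoulli's inequality gives an explicit
  admissible \<open>r\<close> (\<open>phase_modulus_ge_1\<close>). The cosine stays positive if \<open>\<theta> < pi / n\<close>, up to small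
  corrections, and \<open>1 - r\<^sup>2\<close> is then nearly \<open>pi\<^sup>2 * k * (k - 1) / n ^ 3\<close>. A union bound over the \<open>n\<close>
  cards turns this rate into \<open>n ^ 3 * ln n / (pi\<^sup>2 * k * (k - 1))\<close> for \<open>k = o(n)\<close>; for \<open>k\<close> of order \<open>n\<close>
  the crude choice \<open>\<theta> = 1 / n\<close> gives \<open>O(n * ln n)\<close>.

  For the lower bound with \<open>k = o(n)\<close>, observe that if \<open>w ^ (n - k) * (k * w - (k - 1)) = 1\<close> then \<open>w\<close> to the
  power of the depth is an eigenfunction of the motion of one card, with eigenvalue \<open>w\<close>. Its sum over the upper
  half of the initial deck starts at order \<open>n\<close>, shrinks by \<open>\<bar>w\<bar>\<close> per step in mean, and fluctuates by
  \<open>O(sqrt n)\<close> both along the chain and in stationarity (Wilson's method, \<open>tv_dist_ge_half\<close>). Hence the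
  chain is not mixed while \<open>n * \<bar>w\<bar> ^ t\<close> is large compared with \<open>sqrt n\<close>. Brouwer's fixed point
  theorem, applied to the logarithm of the equation, gives a root with
  \<open>- ln \<bar>w\<bar> \<sim> 2 * pi\<^sup>2 * k * (k - 1) / n ^ 3\<close> (\<open>eigenvalue_exists\<close>, \<open>eigenvalue_size\<close>).

  For the lower bound with \<open>k\<close> of order \<open>n\<close>, note that cards which were never picked lie at the bottom in their original
  order. By the coupon collector's argument at least two are left for about \<open>k * ln k\<close> steps, whereas
  the last two cards of a uniform deck are in increasing order only half of the time
  (\<open>tv_dist_gt_coupon\<close>).
\<close>

section \<open>Moving a card to the top\<close>

definition to_top :: "'a \<Rightarrow> 'a list \<Rightarrow> 'a list" where
  "to_top c xs = c # filter (\<lambda>d. d \<noteq> c) xs"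

text \<open>
  The random part of the dynamics does not distinguish the positions in the bottom zone, which is
  why positions from \<open>N = n - k\<close> on are identified. Depths are counted from 0.
\<close>

definition depth :: "nat \<Rightarrow> 'a list \<Rightarrow> 'a \<Rightarrow> nat" where
  "depth N xs c = min N (length (takeWhile (\<lambda>d. d \<noteq> c) xs))"

lemma takeWhile_neq_nth:
  assumes "distinct xs" "i < length xs"
  shows "takeWhile (\<lambda>d. d \<noteq> xs ! i) xs = take i xs"
  using assms
proof (induction xs arbitrary: i)
  case (Cons a xs)
  then show ?case by (cases i) auto
qed simp

lemma move_to_top_eq_to_top:
  assumes "distinct xs" "j \<in> {1..length xs}"
  shows "move_to_top j xs = to_top (xs ! (j - 1)) xs"
proof -
  let ?i = "j - 1"
  have i: "?i < length xs" "Suc ?i = j" using assms by auto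
  have split: "xs = take ?i xs @ xs ! ?i # drop j xs"
    using id_take_nth_drop[OF i(1)] i(2) by simp
  have "distinct (take ?i xs @ xs ! ?i # drop j xs)" using assms(1) split by metis
  then have "filter (\<lambda>d. d \<noteq> xs ! ?i) (take ?i xs @ xs ! ?i # drop j xs) = take ?i xs @ drop j xs"
    using filter_id_conv[of "\<lambda>d. d \<noteq> xs ! ?i" "take ?i xs"] filter_id_conv[of "\<lambda>d. d \<noteq> xs ! ?i" "drop j xs"]
    by fastforce
  then show ?thesis using split unfolding move_to_top_def to_top_def by metis
qed

lemma mem_drop_iff_takeWhile:
  assumes "distinct xs"
  shows "c \<in> set (drop N xs) \<longleftrightarrow> c \<in> set xs \<and> N \<le> length (takeWhile (\<lambda>d. d \<noteq> c) xs)"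
proof (cases "c \<in> set xs")
  case True
  then obtain i where i: "i < length xs" "xs ! i = c" by (auto simp: in_set_conv_nth)
  have len: "length (takeWhile (\<lambda>d. d \<noteq> c) xs) = i"
    using takeWhile_neq_nth[OF assms i(1)] i by simp
  have "c \<in> set (drop N xs) \<longleftrightarrow> N \<le> i"
  proof
    assume "c \<in> set (drop N xs)"
    then obtain m where m: "m < length (drop N xs)" "drop N xs ! m = c"
      by (metis in_set_conv_nth)
    then have "xs ! (N + m) = xs ! i" "N + m < length xs" using i by (auto simp: add.commute)
    with i assms show "N \<le> i" by (auto simp: nth_eq_iff_index_eq)
  next
    assume "N \<le> i"
    then have "drop N xs ! (i - N) = c" "i - N < length (drop N xs)" using i by auto
    then show "c \<in> set (drop N xs)" by (metis nth_mem)
  qed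
  with len True show ?thesis by simp
qed (auto dest: in_set_dropD)

lemma depth_eq_iff_mem_drop:
  assumes "distinct xs" "c \<in> set xs"
  shows "depth N xs c = N \<longleftrightarrow> c \<in> set (drop N xs)"
  using assms by (auto simp: mem_drop_iff_takeWhile depth_def)

lemma depth_le: "depth N xs c \<le> N"
  by (simp add: depth_def)

lemma takeWhile_filter_commute:
  "c \<noteq> d \<Longrightarrow> takeWhile (\<lambda>e. e \<noteq> d) (filter (\<lambda>e. e \<noteq> c) xs)
     = filter (\<lambda>e. e \<noteq> c) (takeWhile (\<lambda>e. e \<noteq> d) xs)"
  by (induction xs) auto

lemma depth_to_top_same [simp]: "depth N (to_top c xs) c = 0"
  by (simp add: depth_def to_top_def)

lemma length_filter_neq_distinct:
  "distinct xs \<Longrightarrow> length (filter (\<lambda>e. e \<noteq> c) xs) = length xs - (if c \<in> set xs then 1 else 0)"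
  by (induction xs) (auto simp: filter_id_conv split: if_splits intro: Suc_pred)

text \<open>
  Above the zone every card sinks by one step. Inside the zone a card may stay or sink, but the
  minimum with \<open>N\<close> hides the difference, so the new depth depends on the old one alone.
\<close>

lemma depth_to_top_other:
  assumes "distinct xs" "c \<in> set (drop N xs)" "d \<noteq> c"
  shows "depth N (to_top c xs) d = min N (depth N xs d + 1)"
proof -
  let ?p = "takeWhile (\<lambda>e. e \<noteq> d) xs"
  have "c \<in> set ?p \<longrightarrow> N < length ?p"
  proof
    assume "c \<in> set ?p"
    then obtain i where i: "i < length ?p" "?p ! i = c" by (metis in_set_conv_nth)
    have "i < length xs" using i(1) length_takeWhile_le[of _ xs] by (metis less_le_trans)
    moreover have "xs ! i = c" using i by (simp add: takeWhile_nth)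
    ultimately have "length (takeWhile (\<lambda>e. e \<noteq> c) xs) = i"
      using takeWhile_neq_nth[OF assms(1)] by fastforce
    then have "N \<le> i" using mem_drop_iff_takeWhile[OF assms(1)] assms(2) by auto
    then show "N < length ?p" using i by simp
  qed
  then show ?thesis using assms
    by (auto simp: depth_def to_top_def takeWhile_filter_commute length_filter_neq_distinct)
qed

lemma orderings_iff: "xs \<in> orderings n \<longleftrightarrow> distinct xs \<and> set xs = {1..n}"
  by (auto simp: orderings_def permutations_of_set_def)

lemma orderings_length: "xs \<in> orderings n \<Longrightarrow> length xs = n"
  using distinct_card[of xs] by (auto simp: orderings_iff)

lemma finite_orderings [simp]: "finite (orderings n)"
  by (simp add: orderings_def)

lemma orderings_ne [simp]: "orderings n \<noteq> {}"
  by (simp add: orderings_def)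

lemma to_top_in_orderings:
  "xs \<in> orderings n \<Longrightarrow> c \<in> {1..n} \<Longrightarrow> to_top c xs \<in> orderings n"
proof -
  assume xs: "xs \<in> orderings n" and c: "c \<in> {1..n}"
  have "set (to_top c xs) = insert c (set xs)" by (auto simp: to_top_def)
  moreover have "distinct xs \<Longrightarrow> distinct (to_top c xs)" by (simp add: to_top_def)
  ultimately show ?thesis using xs c by (simp add: orderings_iff insert_absorb)
qed

abbreviation zone :: "nat \<Rightarrow> nat \<Rightarrow> 'a list \<Rightarrow> 'a set" where
  "zone n k xs \<equiv> set (drop (n - k) xs)"

lemma card_zone: "xs \<in> orderings n \<Longrightarrow> k \<le> n \<Longrightarrow> card (zone n k xs) = k"
  using distinct_card[of "drop (n - k) xs"] orderings_length[of xs n]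
  by (auto simp: orderings_iff)

lemma zone_subset: "xs \<in> orderings n \<Longrightarrow> zone n k xs \<subseteq> {1..n}"
  by (auto simp: orderings_iff dest: in_set_dropD)

lemma zone_ne: "xs \<in> orderings n \<Longrightarrow> 1 \<le> k \<Longrightarrow> k \<le> n \<Longrightarrow> zone n k xs \<noteq> {}"
  using card_zone[of xs n k] by auto

lemma bij_betw_zone:
  assumes "xs \<in> orderings n" "1 \<le> k" "k \<le> n"
  shows "bij_betw (\<lambda>j. xs ! (j - 1)) {n - k + 1..n} (zone n k xs)"
  unfolding bij_betw_def
proof
  have d: "distinct xs" "length xs = n" using assms orderings_iff orderings_length by auto
  show "inj_on (\<lambda>j. xs ! (j - 1)) {n - k + 1..n}"
    using d by (auto simp: inj_on_def nth_eq_iff_index_eq)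
  then have "card ((\<lambda>j. xs ! (j - 1)) ` {n - k + 1..n}) = k"
    using assms by (simp add: card_image)
  moreover have "(\<lambda>j. xs ! (j - 1)) ` {n - k + 1..n} \<subseteq> zone n k xs"
  proof safe
    fix j assume j: "j \<in> {n - k + 1..n}"
    have "drop (n - k) xs ! (j - 1 - (n - k)) = xs ! (j - 1)" using j d by auto
    moreover have "j - 1 - (n - k) < length (drop (n - k) xs)" using j d by auto
    ultimately show "xs ! (j - 1) \<in> zone n k xs" by (metis nth_mem)
  qed
  ultimately show "(\<lambda>j. xs ! (j - 1)) ` {n - k + 1..n} = zone n k xs"
    using card_zone[OF assms(1,3)] by (intro card_subset_eq) auto
qed

text \<open>
  Describing a shuffle by the card that is picked instead of its position makes the picks in two
  different decks comparable.
\<close>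

lemma shuffle_step_eq:
  assumes "xs \<in> orderings n" "1 \<le> k" "k \<le> n"
  shows "shuffle_step n k xs = map_pmf (\<lambda>c. to_top c xs) (pmf_of_set (zone n k xs))"
proof -
  have ne: "{n - k + 1..n} \<noteq> {}" using assms by auto
  have "shuffle_step n k xs = map_pmf (\<lambda>j. to_top (xs ! (j - 1)) xs) (pmf_of_set {n - k + 1..n})"
    unfolding shuffle_step_def
    using assms ne
    by (intro map_pmf_cong refl move_to_top_eq_to_top)
       (auto simp: orderings_iff orderings_length)
  also have "\<dots> = map_pmf (\<lambda>c. to_top c xs)
      (map_pmf (\<lambda>j. xs ! (j - 1)) (pmf_of_set {n - k + 1..n}))"
    by (simp add: pmf.map_comp o_def)
  also have "map_pmf (\<lambda>j. xs ! (j - 1)) (pmf_of_set {n - k + 1..n}) = pmf_of_set (zone n k xs)"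
    using map_pmf_of_set_bij_betw[OF bij_betw_zone[OF assms] ne] by simp
  finally show ?thesis .
qed

lemma set_shuffle_step:
  assumes "xs \<in> orderings n" "1 \<le> k" "k \<le> n"
  shows "set_pmf (shuffle_step n k xs) \<subseteq> orderings n"
proof -
  have "to_top c xs \<in> orderings n" if "c \<in> zone n k xs" for c
    using to_top_in_orderings[OF assms(1)] zone_subset[OF assms(1)] that by blast
  then show ?thesis using zone_ne[OF assms] assms by (auto simp: shuffle_step_eq)
qed

lemma expectation_shuffle_step:
  fixes f :: "nat list \<Rightarrow> real"
  assumes "xs \<in> orderings n" "1 \<le> k" "k \<le> n"
  shows "measure_pmf.expectation (shuffle_step n k xs) f
    = (\<Sum>c\<in>zone n k xs. f (to_top c xs)) / k"
  using assms zone_ne[OF assms]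
  by (simp add: shuffle_step_eq integral_pmf_of_set card_zone)

section \<open>Iterating a Markov kernel\<close>

definition run :: "('a \<Rightarrow> 'a pmf) \<Rightarrow> 'a pmf \<Rightarrow> nat \<Rightarrow> 'a pmf" where
  "run K p t = ((\<lambda>q. bind_pmf q K) ^^ t) p"

lemma run_0 [simp]: "run K p 0 = p" and run_Suc: "run K p (Suc t) = bind_pmf (run K p t) K"
  by (simp_all add: run_def)

lemma shuffle_law_eq_run: "shuffle_law n k s t = run (shuffle_step n k) (return_pmf s) t"
  by (induction t) (simp_all add: run_Suc)

lemma set_run:
  assumes "set_pmf p \<subseteq> I" "\<And>s. s \<in> I \<Longrightarrow> set_pmf (K s) \<subseteq> I"
  shows "set_pmf (run K p t) \<subseteq> I"
proof (induction t)
  case (Suc t)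
  then show ?case using assms(2) by (auto simp: run_Suc)
qed (use assms in simp)

lemma map_run:
  assumes "set_pmf p \<subseteq> I" "\<And>s. s \<in> I \<Longrightarrow> set_pmf (K s) \<subseteq> I"
    and "\<And>s. s \<in> I \<Longrightarrow> map_pmf f (K s) = L (f s)"
  shows "map_pmf f (run K p t) = run L (map_pmf f p) t"
proof (induction t)
  case (Suc t)
  have "map_pmf f (run K p (Suc t)) = bind_pmf (run K p t) (\<lambda>s. L (f s))"
    unfolding run_Suc map_bind_pmf
    using set_run[of p I K t, OF assms(1,2)] assms(3) by (intro bind_pmf_cong) auto
  then show ?case by (simp add: run_Suc bind_map_pmf Suc[symmetric])
qed simp

lemma expectation_mono_finite:
  fixes f g :: "'a \<Rightarrow> real"
  assumes "finite (set_pmf p)" "\<And>s. s \<in> set_pmf p \<Longrightarrow> f s \<le> g s"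
  shows "measure_pmf.expectation p f \<le> measure_pmf.expectation p g"
  using assms by (intro integral_mono_AE) (auto intro: integrable_measure_pmf_finite simp: AE_measure_pmf_iff)

lemma expectation_bind_finite:
  fixes h :: "'b \<Rightarrow> real"
  assumes "finite (set_pmf p)" "\<And>s. s \<in> set_pmf p \<Longrightarrow> finite (set_pmf (K s))"
  shows "measure_pmf.expectation (bind_pmf p K) h
    = measure_pmf.expectation p (\<lambda>s. measure_pmf.expectation (K s) h)"
  using assms
  by (subst pmf_expectation_bind[where A = "set_pmf p"])
     (auto simp: integral_measure_pmf[where A = "set_pmf p"])

text \<open>
  The functions before and after the step may differ, since the second moment argument below moves
  the centre of its square in every step.
\<close>

lemma expectation_step_affine:
  fixes W W' :: "'a \<Rightarrow> real"
  assumes "finite I" "set_pmf p \<subseteq> I" "\<And>s. s \<in> I \<Longrightarrow> set_pmf (K s) \<subseteq> I"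
    and drift: "\<And>s. s \<in> I \<Longrightarrow> measure_pmf.expectation (K s) W' \<le> \<rho> * W s + b"
  shows "measure_pmf.expectation (bind_pmf p K) W' \<le> \<rho> * measure_pmf.expectation p W + b"
proof -
  have fin: "finite (set_pmf p)" using assms(1,2) finite_subset by blast
  have "finite (set_pmf (K s))" if "s \<in> set_pmf p" for s
    using assms(1) assms(3)[of s] that assms(2) by (meson finite_subset subsetD)
  then have "measure_pmf.expectation (bind_pmf p K) W'
      = measure_pmf.expectation p (\<lambda>s. measure_pmf.expectation (K s) W')"
    by (intro expectation_bind_finite fin) auto
  also have "\<dots> \<le> measure_pmf.expectation p (\<lambda>s. \<rho> * W s + b)"
    using assms(2) by (intro expectation_mono_finite fin drift) auto
  also have "\<dots> = \<rho> * measure_pmf.expectation p W + b"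
    using fin by (simp add: integrable_measure_pmf_finite)
  finally show ?thesis .
qed

lemma expectation_run_geometric:
  fixes W :: "'a \<Rightarrow> real"
  assumes "finite I" "set_pmf p \<subseteq> I" "\<And>s. s \<in> I \<Longrightarrow> set_pmf (K s) \<subseteq> I"
    and drift: "\<And>s. s \<in> I \<Longrightarrow> measure_pmf.expectation (K s) W \<le> \<rho> * W s"
    and "0 \<le> \<rho>"
  shows "measure_pmf.expectation (run K p t) W \<le> \<rho> ^ t * measure_pmf.expectation p W"
proof (induction t)
  case (Suc t)
  have "measure_pmf.expectation (run K p (Suc t)) W \<le> \<rho> * measure_pmf.expectation (run K p t) W + 0"
    unfolding run_Suc
    by (rule expectation_step_affine[OF assms(1) set_run[OF assms(2,3)] assms(3)])
       (use drift in auto)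
  also have "\<dots> \<le> \<rho> * (\<rho> ^ t * measure_pmf.expectation p W)"
    using mult_left_mono[OF Suc \<open>0 \<le> \<rho>\<close>] by simp
  finally show ?case by (simp add: mult_ac)
qed simp

lemma markov_finite:
  fixes W :: "'a \<Rightarrow> real"
  assumes "finite (set_pmf p)" "\<And>s. s \<in> set_pmf p \<Longrightarrow> 0 \<le> W s"
    and "\<And>s. s \<in> set_pmf p \<Longrightarrow> s \<in> A \<Longrightarrow> m \<le> W s"
  shows "m * measure_pmf.prob p A \<le> measure_pmf.expectation p W"
proof -
  have "m * measure_pmf.prob p A = measure_pmf.expectation p (\<lambda>s. m * indicator A s)"
    by simp
  also have "\<dots> \<le> measure_pmf.expectation p W"
    using assms by (intro expectation_mono_finite) (auto simp: indicator_def)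
  finally show ?thesis .
qed

section \<open>Total variation and mixing time\<close>

lemma tv_dist_le_coupling:
  assumes "finite S"
  shows "tv_dist S (map_pmf f \<kappa>) (map_pmf g \<kappa>) \<le> measure_pmf.prob \<kappa> {z. f z \<noteq> g z}"
proof -
  let ?P = "measure_pmf.prob \<kappa>"
  have 1: "\<bar>pmf (map_pmf f \<kappa>) s - pmf (map_pmf g \<kappa>) s\<bar>
     \<le> ?P {z. f z = s \<and> f z \<noteq> g z} + ?P {z. g z = s \<and> f z \<noteq> g z}" for s
  proof -
    have a: "pmf (map_pmf f \<kappa>) s = ?P {z. f z = s \<and> g z = s} + ?P {z. f z = s \<and> f z \<noteq> g z}"
      by (subst measure_pmf.finite_measure_Union[symmetric])
         (auto simp: pmf_map intro!: arg_cong[where f = ?P])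
    have b: "pmf (map_pmf g \<kappa>) s = ?P {z. f z = s \<and> g z = s} + ?P {z. g z = s \<and> f z \<noteq> g z}"
      by (subst measure_pmf.finite_measure_Union[symmetric])
         (auto simp: pmf_map intro!: arg_cong[where f = ?P])
    show ?thesis unfolding a b
      using measure_nonneg[of "measure_pmf \<kappa>" "{z. f z = s \<and> f z \<noteq> g z}"]
        measure_nonneg[of "measure_pmf \<kappa>" "{z. g z = s \<and> f z \<noteq> g z}"] by linarith
  qed
  have 2: "(\<Sum>s\<in>S. ?P {z. h z = s \<and> f z \<noteq> g z}) \<le> ?P {z. f z \<noteq> g z}" for h
  proof -
    have "(\<Sum>s\<in>S. ?P {z. h z = s \<and> f z \<noteq> g z}) = ?P (\<Union>s\<in>S. {z. h z = s \<and> f z \<noteq> g z})"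
      using assms
      by (intro measure_pmf.finite_measure_finite_Union[symmetric]) (auto simp: disjoint_family_on_def)
    also have "\<dots> \<le> ?P {z. f z \<noteq> g z}" by (intro measure_pmf.finite_measure_mono) auto
    finally show ?thesis .
  qed
  have "(\<Sum>s\<in>S. \<bar>pmf (map_pmf f \<kappa>) s - pmf (map_pmf g \<kappa>) s\<bar>)
     \<le> (\<Sum>s\<in>S. ?P {z. f z = s \<and> f z \<noteq> g z}) + (\<Sum>s\<in>S. ?P {z. g z = s \<and> f z \<noteq> g z})"
    unfolding sum.distrib[symmetric] by (intro sum_mono 1)
  with 2[of f] 2[of g] show ?thesis unfolding tv_dist_def by linarith
qed

lemma tv_dist_ge_event:
  assumes "finite S" "set_pmf \<mu> \<subseteq> S" "set_pmf \<nu> \<subseteq> S"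
  shows "measure_pmf.prob \<mu> A - measure_pmf.prob \<nu> A \<le> tv_dist S \<mu> \<nu>"
proof -
  have eq: "measure_pmf.prob p B = sum (pmf p) (S \<inter> B)" if "set_pmf p \<subseteq> S" for p B
  proof -
    have "measure_pmf.prob p B = measure_pmf.prob p (B \<inter> set_pmf p)"
      by (simp add: measure_Int_set_pmf)
    also have "\<dots> = measure_pmf.prob p ((S \<inter> B) \<inter> set_pmf p)"
      using that by (intro arg_cong[where f = "measure_pmf.prob p"]) auto
    also have "\<dots> = sum (pmf p) (S \<inter> B)"
      using assms(1) by (simp add: measure_Int_set_pmf measure_measure_pmf_finite)
    finally show ?thesis .
  qed
  have tot: "sum (pmf p) (S \<inter> A) + sum (pmf p) (S - A) = 1" if "set_pmf p \<subseteq> S" for p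
    using sum_pmf_eq_1[OF assms(1) that] sum.Int_Diff[OF assms(1), of "pmf p" A] by simp
  have "sum (pmf \<mu>) (S \<inter> A) - sum (pmf \<nu>) (S \<inter> A) \<le> (\<Sum>s\<in>S \<inter> A. \<bar>pmf \<mu> s - pmf \<nu> s\<bar>)"
    unfolding sum_subtractf[symmetric] by (intro sum_mono) auto
  moreover have "sum (pmf \<nu>) (S - A) - sum (pmf \<mu>) (S - A) \<le> (\<Sum>s\<in>S - A. \<bar>pmf \<mu> s - pmf \<nu> s\<bar>)"
    unfolding sum_subtractf[symmetric] by (intro sum_mono) auto
  moreover have "(\<Sum>s\<in>S. \<bar>pmf \<mu> s - pmf \<nu> s\<bar>)
     = (\<Sum>s\<in>S \<inter> A. \<bar>pmf \<mu> s - pmf \<nu> s\<bar>) + (\<Sum>s\<in>S - A. \<bar>pmf \<mu> s - pmf \<nu> s\<bar>)"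
    using assms(1) by (metis sum.Int_Diff)
  ultimately show ?thesis
    unfolding tv_dist_def using eq[OF assms(2), of A] eq[OF assms(3), of A] tot[OF assms(2)] tot[OF assms(3)]
    by linarith
qed

lemma mixing_time_le:
  assumes "\<And>s. s \<in> orderings n \<Longrightarrow>
    tv_dist (orderings n) (shuffle_law n k s t) (pmf_of_set (orderings n)) \<le> 1 / 4"
  shows "mixing_time n k \<le> t"
  unfolding mixing_time_def using assms by (subst Max_le_iff) (auto intro: Least_le)

text \<open>
  As \<open>LEAST\<close> selects the first time of small distance, the distance has to be large at all times up
  to \<open>x\<close>. The time \<open>T\<close> ensures that \<open>LEAST\<close> ranges over a nonempty set.
\<close>

lemma mixing_time_gt:
  assumes "s \<in> orderings n"
    and "tv_dist (orderings n) (shuffle_law n k s T) (pmf_of_set (orderings n)) \<le> 1 / 4"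
    and "\<And>t. real t \<le> x \<Longrightarrow>
      tv_dist (orderings n) (shuffle_law n k s t) (pmf_of_set (orderings n)) > 1 / 4"
  shows "x < real (mixing_time n k)"
proof -
  let ?L = "\<lambda>s. LEAST t. tv_dist (orderings n) (shuffle_law n k s t) (pmf_of_set (orderings n)) \<le> 1 / 4"
  have "tv_dist (orderings n) (shuffle_law n k s (?L s)) (pmf_of_set (orderings n)) \<le> 1 / 4"
    using assms(2) by (rule LeastI)
  then have "x < real (?L s)" using assms(3)[of "?L s"] by linarith
  also have "?L s \<le> mixing_time n k"
    unfolding mixing_time_def using assms(1) by (intro Max_ge) auto
  finally show ?thesis by simp
qed

section \<open>Stationarity\<close>

lemma inj_on_move_to_top:
  assumes "j \<in> {1..n}"
  shows "inj_on (move_to_top j) (orderings n)"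
proof (rule inj_onI)
  fix xs ys assume xy: "xs \<in> orderings n" "ys \<in> orderings n" "move_to_top j xs = move_to_top j ys"
  then have len: "length xs = n" "length ys = n" by (auto simp: orderings_length)
  have "xs ! (j - 1) = ys ! (j - 1)" "take (j - 1) xs = take (j - 1) ys" "drop j xs = drop j ys"
    using xy(3) len assms by (auto simp: move_to_top_def append_eq_append_conv)
  moreover have "Suc (j - 1) = j" "j - 1 < n" using assms by auto
  ultimately show "xs = ys" using len by (metis id_take_nth_drop)
qed

text \<open>
  Moving the card in a fixed position is a bijection of the orderings, so the shuffle is a mixture of
  maps that preserve the uniform distribution.
\<close>

lemma uniform_stationary:
  assumes "1 \<le> k" "k \<le> n"
  shows "bind_pmf (pmf_of_set (orderings n)) (shuffle_step n k) = pmf_of_set (orderings n)"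
proof -
  have step: "map_pmf (move_to_top j) (pmf_of_set (orderings n)) = pmf_of_set (orderings n)"
    if j: "j \<in> {n - k + 1..n}" for j
  proof (rule map_pmf_of_set_bij_betw)
    have j1: "j \<in> {1..n}" using j by auto
    have "move_to_top j xs \<in> orderings n" if xs: "xs \<in> orderings n" for xs
    proof -
      have l: "length xs = n" "distinct xs" "set xs = {1..n}"
        using xs orderings_length orderings_iff by auto
      then have "xs ! (j - 1) \<in> set xs" using j1 by (intro nth_mem) auto
      then show ?thesis
        using to_top_in_orderings[OF xs] move_to_top_eq_to_top[of xs j] l j1 by simp
    qed
    then show "bij_betw (move_to_top j) (orderings n) (orderings n)"
      using inj_on_move_to_top[OF j1] endo_inj_surj[of "orderings n" "move_to_top j"]
      by (auto simp: bij_betw_def)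
  qed auto
  have "bind_pmf (pmf_of_set (orderings n)) (shuffle_step n k)
     = bind_pmf (pmf_of_set {n - k + 1..n})
         (\<lambda>j. map_pmf (move_to_top j) (pmf_of_set (orderings n)))"
    unfolding shuffle_step_def map_pmf_def by (rule bind_commute_pmf)
  also have "\<dots> = bind_pmf (pmf_of_set {n - k + 1..n}) (\<lambda>j. pmf_of_set (orderings n))"
    using assms by (intro bind_pmf_cong refl step) auto
  finally show ?thesis by simp
qed

section \<open>The coupling of two decks\<close>

text \<open>
  A matching of the two bottom zones that fixes their common cards. It pairs picks so that both
  decks move according to the law of the shuffle.
\<close>

definition match_map :: "'a set \<Rightarrow> 'a set \<Rightarrow> 'a \<Rightarrow> 'a" where
  "match_map A B = (SOME \<sigma>. bij_betw \<sigma> A B \<and> (\<forall>c\<in>A \<inter> B. \<sigma> c = c))"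

lemma match_map:
  assumes "finite A" "finite B" "card A = card B"
  shows "bij_betw (match_map A B) A B" "c \<in> A \<Longrightarrow> c \<in> B \<Longrightarrow> match_map A B c = c"
proof -
  have "card (A - B) = card (B - A)"
    using assms by (simp add: card_Diff_subset_Int Int_commute)
  then obtain g where g: "bij_betw g (A - B) (B - A)"
    using assms finite_same_card_bij[of "A - B" "B - A"] by auto
  define h where "h c = (if c \<in> A \<inter> B then c else g c)" for c
  have "bij_betw h (A - B) (B - A)" using g by (subst bij_betw_cong[of _ h g]) (auto simp: h_def)
  moreover have "bij_betw h (A \<inter> B) (A \<inter> B)"
    by (subst bij_betw_cong[of _ h id]) (auto simp: h_def)
  ultimately have "bij_betw h ((A - B) \<union> (A \<inter> B)) ((B - A) \<union> (A \<inter> B))"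
    by (intro bij_betw_combine) auto
  moreover have "(A - B) \<union> (A \<inter> B) = A" "(B - A) \<union> (A \<inter> B) = B" by auto
  ultimately have "bij_betw h A B \<and> (\<forall>c\<in>A \<inter> B. h c = c)" by (simp add: h_def)
  then have "bij_betw (match_map A B) A B \<and> (\<forall>c\<in>A \<inter> B. match_map A B c = c)"
    unfolding match_map_def by (rule someI[where P = "\<lambda>\<sigma>. bij_betw \<sigma> A B \<and> (\<forall>c\<in>A \<inter> B. \<sigma> c = c)"])
  then show "bij_betw (match_map A B) A B" "c \<in> A \<Longrightarrow> c \<in> B \<Longrightarrow> match_map A B c = c" by auto
qed

text \<open>
  The third component collects the cards that have been picked simultaneously in both decks.
\<close>

type_synonym deck_pair = "nat list \<times> nat list \<times> nat set"

definition partner :: "nat \<Rightarrow> nat \<Rightarrow> deck_pair \<Rightarrow> nat \<Rightarrow> nat" where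
  "partner n k = (\<lambda>(xs, ys, M). match_map (zone n k xs) (zone n k ys))"

definition pick_pair :: "nat \<Rightarrow> nat \<Rightarrow> deck_pair \<Rightarrow> nat \<Rightarrow> deck_pair" where
  "pick_pair n k = (\<lambda>(xs, ys, M) c. let d = partner n k (xs, ys, M) c in
     (to_top c xs, to_top d ys, if d = c then insert c M else M))"

definition coupled_step :: "nat \<Rightarrow> nat \<Rightarrow> deck_pair \<Rightarrow> deck_pair pmf" where
  "coupled_step n k s = map_pmf (pick_pair n k s) (pmf_of_set (zone n k (fst s)))"

text \<open>
  The matched cards occur in the same order in both decks. When all cards are matched this makes the
  decks equal, which is how the coupling succeeds.
\<close>

definition coupled_states :: "nat \<Rightarrow> nat \<Rightarrow> deck_pair set" where
  "coupled_states n k = {(xs, ys, M). xs \<in> orderings n \<and> ys \<in> orderings n \<and> M \<subseteq> {1..n} \<and>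
     filter (\<lambda>c. c \<in> M) xs = filter (\<lambda>c. c \<in> M) ys \<and>
     (\<forall>c\<in>M. depth (n - k) xs c = depth (n - k) ys c)}"

lemma finite_coupled_states: "finite (coupled_states n k)"
  by (rule finite_subset[of _ "orderings n \<times> orderings n \<times> Pow {1..n}"])
     (auto simp: coupled_states_def)

context
  fixes n k :: nat and xs ys :: "nat list" and M :: "nat set"
  assumes k: "1 \<le> k" "k \<le> n" and s: "(xs, ys, M) \<in> coupled_states n k"
begin

lemma partner_facts:
  shows "bij_betw (partner n k (xs, ys, M)) (zone n k xs) (zone n k ys)"
    and "c \<in> zone n k xs \<Longrightarrow> c \<in> zone n k ys \<Longrightarrow> partner n k (xs, ys, M) c = c"
proof -
  have c: "card (zone n k xs) = card (zone n k ys)"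
    using s k by (simp add: coupled_states_def card_zone)
  show "bij_betw (partner n k (xs, ys, M)) (zone n k xs) (zone n k ys)"
    unfolding partner_def using match_map(1)[OF _ _ c] by simp
  show "c \<in> zone n k xs \<Longrightarrow> c \<in> zone n k ys \<Longrightarrow> partner n k (xs, ys, M) c = c"
    unfolding partner_def using match_map(2)[OF _ _ c] by simp
qed

lemma partner_mem: "c \<in> zone n k xs \<Longrightarrow> partner n k (xs, ys, M) c \<in> zone n k ys"
  using partner_facts(1) by (auto simp: bij_betw_def)

lemma matched_zone: "c \<in> M \<Longrightarrow> c \<in> zone n k xs \<longleftrightarrow> c \<in> zone n k ys"
proof -
  assume "c \<in> M"
  then have "depth (n - k) xs c = depth (n - k) ys c" "c \<in> {1..n}"
    using s by (auto simp: coupled_states_def)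
  moreover have "distinct xs" "distinct ys" "set xs = {1..n}" "set ys = {1..n}"
    using s by (auto simp: coupled_states_def orderings_iff)
  ultimately show ?thesis by (metis depth_eq_iff_mem_drop)
qed

lemma depth_pick:
  assumes "c \<in> zone n k xs"
  shows "depth (n - k) (to_top c xs) e
      = (if e = c then 0 else min (n - k) (depth (n - k) xs e + 1))"
    and "depth (n - k) (to_top (partner n k (xs, ys, M) c) ys) e
      = (if e = partner n k (xs, ys, M) c then 0 else min (n - k) (depth (n - k) ys e + 1))"
  using s partner_mem[OF assms] assms depth_to_top_other[of xs] depth_to_top_other[of ys]
  by (auto simp: coupled_states_def orderings_iff)

lemma pick_pair_in_states:
  assumes "c \<in> zone n k xs"
  shows "pick_pair n k (xs, ys, M) c \<in> coupled_states n k"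
proof -
  define d where "d = partner n k (xs, ys, M) c"
  have dz: "d \<in> zone n k ys" unfolding d_def by (rule partner_mem[OF assms])
  have xy: "xs \<in> orderings n" "ys \<in> orderings n" "M \<subseteq> {1..n}"
    and eq: "filter (\<lambda>c. c \<in> M) xs = filter (\<lambda>c. c \<in> M) ys"
    and dep: "\<And>e. e \<in> M \<Longrightarrow> depth (n - k) xs e = depth (n - k) ys e"
    using s by (auto simp: coupled_states_def)
  have cd: "c \<in> {1..n}" "d \<in> {1..n}" using zone_subset[OF xy(1)] zone_subset[OF xy(2)] assms dz by blast+
  have ord: "to_top c xs \<in> orderings n" "to_top d ys \<in> orderings n"
    using to_top_in_orderings xy cd by auto
  note dp = depth_pick[OF assms, folded d_def]
  show ?thesis
  proof (cases "d = c")
    case True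
    have red: "filter (\<lambda>e. e \<in> insert c M) (to_top c zs) = c # filter (\<lambda>e. e \<noteq> c) (filter (\<lambda>e. e \<in> M) zs)" for zs
      by (simp add: to_top_def conj_commute cong: conj_cong)
    \<comment> \<open>Picked in both decks, \<open>c\<close> heads both lists of matched cards.\<close>
    have "filter (\<lambda>e. e \<in> insert c M) (to_top c xs) = filter (\<lambda>e. e \<in> insert c M) (to_top c ys)"
      by (simp only: red eq)
    moreover have "depth (n - k) (to_top c xs) e = depth (n - k) (to_top d ys) e" if "e \<in> insert c M" for e
      using that dp[of e] dep[of e] True by auto
    ultimately show ?thesis
      using ord xy(3) cd True by (simp add: pick_pair_def coupled_states_def d_def[symmetric])
  next
    case False
    \<comment> \<open>Matched cards have equal depths, so they lie in both zones or in none, and the matching fixes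
       them: different picks are both unmatched.\<close>
    have "c \<notin> M" using False matched_zone[of c] assms partner_facts(2)[of c] by (auto simp: d_def)
    moreover have "d \<notin> M"
    proof
      assume "d \<in> M"
      then have dx: "d \<in> zone n k xs" using matched_zone dz by auto
      then have "partner n k (xs, ys, M) d = d" using partner_facts(2) dz by auto
      then have "d = c" using partner_facts(1) dx assms by (auto simp: bij_betw_def d_def dest: inj_onD)
      with False show False ..
    qed
    moreover have "filter (\<lambda>e. e \<in> M) (to_top f zs) = filter (\<lambda>e. e \<in> M) zs" if "f \<notin> M" for f zs
      using that by (auto simp: to_top_def intro!: filter_cong)
    moreover have "depth (n - k) (to_top c xs) e = depth (n - k) (to_top d ys) e" if "e \<in> M" for e
      using that dp[of e] dep[of e] \<open>c \<notin> M\<close> \<open>d \<notin> M\<close> by auto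
    ultimately show ?thesis
      using ord xy(3) False eq by (simp add: pick_pair_def coupled_states_def d_def[symmetric])
  qed
qed

lemma zone_fst_ne: "zone n k xs \<noteq> {}"
  using zone_ne[of xs n k] s k by (auto simp: coupled_states_def)

lemma set_coupled_step: "set_pmf (coupled_step n k (xs, ys, M)) \<subseteq> coupled_states n k"
  using zone_fst_ne pick_pair_in_states by (auto simp: coupled_step_def)

lemma coupled_step_fst: "map_pmf fst (coupled_step n k (xs, ys, M)) = shuffle_step n k xs"
  using s k
  by (simp add: coupled_step_def pmf.map_comp o_def pick_pair_def Let_def coupled_states_def shuffle_step_eq)

lemma coupled_step_snd: "map_pmf (\<lambda>z. fst (snd z)) (coupled_step n k (xs, ys, M)) = shuffle_step n k ys"
proof -
  have "map_pmf (\<lambda>z. fst (snd z)) (coupled_step n k (xs, ys, M))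
     = map_pmf (\<lambda>c. to_top c ys) (map_pmf (partner n k (xs, ys, M)) (pmf_of_set (zone n k xs)))"
    by (simp add: coupled_step_def pmf.map_comp o_def pick_pair_def Let_def)
  also have "map_pmf (partner n k (xs, ys, M)) (pmf_of_set (zone n k xs)) = pmf_of_set (zone n k ys)"
    using partner_facts(1) zone_fst_ne by (intro map_pmf_of_set_bij_betw) auto
  finally show ?thesis using s k by (simp add: coupled_states_def shuffle_step_eq)
qed

lemma expectation_coupled_step:
  fixes f :: "deck_pair \<Rightarrow> real"
  shows "measure_pmf.expectation (coupled_step n k (xs, ys, M)) f
    = (\<Sum>c\<in>zone n k xs. f (pick_pair n k (xs, ys, M) c)) / k"
  using zone_fst_ne card_zone[of xs n k] s k
  by (simp add: coupled_step_def integral_pmf_of_set coupled_states_def)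

end

section \<open>Survival of unmatched cards\<close>

text \<open>
  The parameter \<open>z = rcis r \<theta>\<close> would be an eigenvalue of the motion of one card if
  \<open>z ^ (n - k) * (k * z - (k - 1))\<close> were 1. Here only the modulus of this number is bounded below,
  and its argument \<open>2 * \<phi>\<close> is absorbed by shifting the cosine; this leaves \<open>\<theta>\<close> free.
\<close>

locale phase_weight =
  fixes n k :: nat and r \<theta> \<phi> \<rho> m :: real
  assumes k1: "1 \<le> k" and kn: "k \<le> n"
    and r_pos: "0 < r" and r_le: "r \<le> 1" and m_pos: "0 < m"
    and theta_nonneg: "0 \<le> \<theta>"
    and r_square: "1 - 1 / real k \<le> r\<^sup>2"
    and phase: "rcis r \<theta> ^ (n - k) * (of_nat k * rcis r \<theta> - of_nat (k - 1)) = rcis \<rho> (2 * \<phi>)"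
    and rho_ge: "1 \<le> \<rho>"
    and cos_ge: "\<And>u. 0 \<le> u \<Longrightarrow> u \<le> \<theta> * real (n - k) \<Longrightarrow> m \<le> cos (u - \<phi>)"
begin

definition weight :: "nat \<Rightarrow> nat \<Rightarrow> real" where
  "weight a b = r ^ (a + b) * cos (\<theta> * \<bar>real a - real b\<bar> - \<phi>)"

lemma weight_commute: "weight a b = weight b a"
  by (simp add: weight_def add.commute abs_minus_commute)

lemma weight_Suc: "weight (Suc a) (Suc b) = r\<^sup>2 * weight a b"
  by (simp add: weight_def power2_eq_square)

lemma cos_weight_ge:
  assumes "a \<le> n - k" "b \<le> n - k"
  shows "m \<le> cos (\<theta> * \<bar>real a - real b\<bar> - \<phi>)"
proof (rule cos_ge)
  have "\<bar>real a - real b\<bar> \<le> real (n - k)" using assms by linarith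
  then show "\<theta> * \<bar>real a - real b\<bar> \<le> \<theta> * real (n - k)"
    using theta_nonneg by (rule mult_left_mono)
qed (use theta_nonneg in simp)

lemma weight_ge:
  assumes "a \<le> n - k" "b \<le> n - k"
  shows "m * r ^ (2 * (n - k)) \<le> weight a b"
proof -
  have "r ^ (2 * (n - k)) \<le> r ^ (a + b)" using assms r_pos r_le by (intro power_decreasing) auto
  then have "r ^ (2 * (n - k)) * m \<le> r ^ (a + b) * cos (\<theta> * \<bar>real a - real b\<bar> - \<phi>)"
    using cos_weight_ge[OF assms] m_pos r_pos by (intro mult_mono) auto
  then show ?thesis by (simp add: weight_def mult.commute)
qed

lemma weight_nonneg: "a \<le> n - k \<Longrightarrow> b \<le> n - k \<Longrightarrow> 0 \<le> weight a b"
  using cos_weight_ge[of a b] m_pos r_pos by (simp add: weight_def)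

lemma weight_le_1: "weight a b \<le> 1"
proof -
  have "r ^ (a + b) * cos (\<theta> * \<bar>real a - real b\<bar> - \<phi>) \<le> r ^ (a + b) * 1"
    using r_pos by (intro mult_left_mono) auto
  also have "\<dots> \<le> 1" using r_pos r_le by (simp add: power_le_one)
  finally show ?thesis by (simp add: weight_def)
qed

text \<open>
  The only nontrivial step of the two depths: one copy waits in the zone while the other sinks from
  depth \<open>b\<close>. With \<open>u = \<theta> * (b + 1)\<close>, the left side minus the right side is a positive multiple of the
  real part of \<open>(1 - \<rho>) * cis (u - \<phi>)\<close>, which is not positive because \<open>1 \<le> \<rho>\<close> and the cosine is
  positive on the whole range of \<open>u\<close>.
\<close>

lemma weight_waiting:
  assumes "b < n - k"
  shows "weight 0 (Suc b) + real (k - 1) * weight (n - k) (Suc b) \<le> real k * r\<^sup>2 * weight (n - k) b"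
proof -
  define N where "N = n - k"
  define u where "u = \<theta> * real (Suc b)"
  have u: "0 \<le> u" "u \<le> \<theta> * real (n - k)"
    using assms theta_nonneg by (auto simp: u_def intro!: mult_left_mono)
  \<comment> \<open>Multiplying the phase equation by \<open>cis (- u - \<phi>)\<close> and taking real parts produces the three cosines
     of the claim.\<close>
  have e1: "rcis r \<theta> ^ N * rcis r \<theta> * cis (- u - \<phi>) = rcis (r ^ Suc N) (\<theta> * N + \<theta> - u - \<phi>)"
    and e2: "rcis r \<theta> ^ N * cis (- u - \<phi>) = rcis (r ^ N) (\<theta> * N - u - \<phi>)"
    and e3: "rcis \<rho> (2 * \<phi>) * cis (- u - \<phi>) = rcis \<rho> (\<phi> - u)"
    by (simp_all add: DeMoivre2 rcis_mult cis_rcis_eq algebra_simps)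
  have "of_nat k * (rcis r \<theta> ^ N * rcis r \<theta> * cis (- u - \<phi>)) - of_nat (k - 1) * (rcis r \<theta> ^ N * cis (- u - \<phi>))
      = rcis r \<theta> ^ N * (of_nat k * rcis r \<theta> - of_nat (k - 1)) * cis (- u - \<phi>)"
    by (simp only: algebra_simps)
  also have "\<dots> = rcis \<rho> (2 * \<phi>) * cis (- u - \<phi>)" using phase by (simp add: N_def)
  finally have "of_nat k * rcis (r ^ Suc N) (\<theta> * N + \<theta> - u - \<phi>) - of_nat (k - 1) * rcis (r ^ N) (\<theta> * N - u - \<phi>)
      = rcis \<rho> (\<phi> - u)"
    unfolding e1 e2 e3 .
  then have "Re (of_nat k * rcis (r ^ Suc N) (\<theta> * N + \<theta> - u - \<phi>) - of_nat (k - 1) * rcis (r ^ N) (\<theta> * N - u - \<phi>))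
      = Re (rcis \<rho> (\<phi> - u))"
    by simp
  then have eq: "real k * r ^ Suc N * cos (\<theta> * N + \<theta> - u - \<phi>) - real (k - 1) * r ^ N * cos (\<theta> * N - u - \<phi>)
      = \<rho> * cos (u - \<phi>)"
    using cos_minus[of "\<phi> - u"] by (simp add: mult.assoc)
  have "cos (u - \<phi>) \<le> \<rho> * cos (u - \<phi>)"
    using cos_ge[OF u] m_pos rho_ge by (simp add: mult_le_cancel_right1)
  with eq have "cos (u - \<phi>) + real (k - 1) * r ^ N * cos (\<theta> * N - u - \<phi>)
      \<le> real k * r ^ Suc N * cos (\<theta> * N + \<theta> - u - \<phi>)" by linarith
  then have "r ^ Suc b * (cos (u - \<phi>) + real (k - 1) * r ^ N * cos (\<theta> * N - u - \<phi>))
      \<le> r ^ Suc b * (real k * r ^ Suc N * cos (\<theta> * N + \<theta> - u - \<phi>))"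
    using r_pos by (intro mult_left_mono) auto
  moreover have "weight 0 (Suc b) = r ^ Suc b * cos (u - \<phi>)" by (simp add: weight_def u_def add.commute)
  moreover have "weight N (Suc b) = r ^ Suc b * (r ^ N * cos (\<theta> * N - u - \<phi>))"
  proof -
    have "\<theta> * \<bar>real N - real (Suc b)\<bar> - \<phi> = \<theta> * N - u - \<phi>"
      using assms by (simp add: u_def N_def algebra_simps)
    then show ?thesis by (simp only: weight_def power_add mult_ac)
  qed
  moreover have "r\<^sup>2 * weight N b = r ^ Suc b * (r ^ Suc N * cos (\<theta> * N + \<theta> - u - \<phi>))"
  proof -
    have "\<theta> * \<bar>real N - real b\<bar> - \<phi> = \<theta> * N + \<theta> - u - \<phi>"
      using assms by (simp add: u_def N_def algebra_simps)
    then show ?thesis by (simp only: weight_def power_add power_Suc power2_eq_square mult_ac)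
  qed
  ultimately have "weight 0 (Suc b) + real (k - 1) * weight N (Suc b) \<le> real k * (r\<^sup>2 * weight N b)"
    by (simp only: distrib_left mult_ac)
  then show ?thesis by (simp only: N_def mult.assoc)
qed

text \<open>
  Matched cards get weight 0, so the mean of this function bounds the probability that the card is
  still unmatched.
\<close>

definition card_weight :: "nat \<Rightarrow> deck_pair \<Rightarrow> real" where
  "card_weight e = (\<lambda>(xs, ys, M).
     if e \<in> M then 0 else weight (depth (n - k) xs e) (depth (n - k) ys e))"

text \<open>
  Outside both zones the weight is multiplied by exactly \<open>r\<^sup>2\<close>. If one copy is in its zone, the matching
  never picks the other copy, so the waiting inequality applies. If both are, the card gets matched
  with probability \<open>1 / k\<close>, and \<open>1 - 1 / k \<le> r\<^sup>2\<close> suffices.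
\<close>

lemma card_weight_drift:
  assumes s: "s \<in> coupled_states n k" and e: "e \<in> {1..n}"
  shows "measure_pmf.expectation (coupled_step n k s) (card_weight e) \<le> r\<^sup>2 * card_weight e s"
proof -
  obtain xs ys M where sdef: "s = (xs, ys, M)" by (cases s)
  note S = s[unfolded sdef]
  define N where "N = n - k"
  define Zx where "Zx = zone n k xs"
  define Zy where "Zy = zone n k ys"
  define \<sigma> where "\<sigma> = partner n k (xs, ys, M)"
  define a where "a = depth N xs e"
  define b where "b = depth N ys e"
  define g where "g c = card_weight e (pick_pair n k (xs, ys, M) c)" for c
  have fin: "finite Zx" by (simp add: Zx_def)
  have crd: "card Zx = k" using S card_zone[of xs n k] kn by (simp add: Zx_def coupled_states_def)
  have bij: "bij_betw \<sigma> Zx Zy" using partner_facts(1)[OF k1 kn S] by (simp add: \<sigma>_def Zx_def Zy_def)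
  have fixed: "\<sigma> c = c" if "c \<in> Zx" "c \<in> Zy" for c
    using partner_facts(2)[OF k1 kn S] that by (simp add: \<sigma>_def Zx_def Zy_def)
  have dist: "distinct xs" "distinct ys" "set xs = {1..n}" "set ys = {1..n}"
    using S by (auto simp: coupled_states_def orderings_iff)
  have aZ: "a = N \<longleftrightarrow> e \<in> Zx" and bZ: "b = N \<longleftrightarrow> e \<in> Zy"
    using depth_eq_iff_mem_drop[of xs e N] depth_eq_iff_mem_drop[of ys e N] dist e
    by (auto simp: a_def b_def Zx_def Zy_def N_def)
  have ab: "a \<le> N" "b \<le> N" by (simp_all add: a_def b_def depth_le)
  have g: "g c = (if e \<in> M \<or> (e = c \<and> \<sigma> c = c) then 0
      else weight (if e = c then 0 else min N (a + 1)) (if e = \<sigma> c then 0 else min N (b + 1)))"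
    if "c \<in> Zx" for c
    using depth_pick[OF k1 kn S, of c e] that
    by (auto simp: g_def card_weight_def pick_pair_def Let_def \<sigma>_def Zx_def N_def a_def b_def)
  have kk: "real (card (Zx - {c})) = real (k - 1)" if "c \<in> Zx" for c
    using that crd fin by simp
  have "sum g Zx \<le> real k * r\<^sup>2 * card_weight e s"
  proof (cases "e \<in> M")
    case True
    then show ?thesis using g by (simp add: card_weight_def sdef)
  next
    case False
    have cw: "card_weight e s = weight a b"
      using False by (simp add: card_weight_def sdef a_def b_def N_def)
    have split: "sum g Zx = g c + sum g (Zx - {c})" if "c \<in> Zx" for c
      using fin that by (rule sum.remove)
    consider "e \<notin> Zx" "e \<notin> Zy" | "e \<in> Zx" "e \<notin> Zy" | "e \<notin> Zx" "e \<in> Zy" | "e \<in> Zx" "e \<in> Zy"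
      by blast
    then show ?thesis
    proof cases
      case 1
      have "g c = r\<^sup>2 * weight a b" if c: "c \<in> Zx" for c
      proof -
        have "e \<noteq> c" "e \<noteq> \<sigma> c" using 1 c bij by (auto simp: bij_betw_def)
        moreover have "a < N" "b < N" using 1 aZ bZ ab by auto
        ultimately show ?thesis using g[OF c] False by (simp add: weight_Suc)
      qed
      then show ?thesis using crd cw by simp
    next
      case 2
      have ne: "e \<noteq> \<sigma> c" if "c \<in> Zx" for c using 2 that bij by (auto simp: bij_betw_def)
      have abN: "a = N" "b < N" using 2 aZ bZ ab by auto
      have "g e = weight 0 (Suc b)" using g[of e] 2 ne[of e] False abN by auto
      moreover have "g c = weight N (Suc b)" if "c \<in> Zx - {e}" for c
        using g[of c] that ne[of c] False abN by auto
      ultimately have "sum g Zx = weight 0 (Suc b) + real (k - 1) * weight N (Suc b)"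
        using split[OF 2(1)] kk[OF 2(1)] by simp
      then show ?thesis using weight_waiting[of b] abN cw by (simp add: N_def)
    next
      case 3
      then obtain c0 where c0: "c0 \<in> Zx" "\<sigma> c0 = e" using bij by (auto simp: bij_betw_def image_iff)
      have abN: "b = N" "a < N" using 3 aZ bZ ab by auto
      have "g c0 = weight (Suc a) 0" using g[of c0] c0 3 False abN by auto
      moreover have "g c = weight (Suc a) N" if c: "c \<in> Zx - {c0}" for c
      proof -
        have "\<sigma> c \<noteq> e" using c c0 bij by (auto simp: bij_betw_def inj_on_def)
        moreover have "c \<noteq> e" using c 3 by auto
        ultimately show ?thesis using g[of c] c False abN by auto
      qed
      ultimately have "sum g Zx = weight 0 (Suc a) + real (k - 1) * weight N (Suc a)"
        using split[OF c0(1)] kk[OF c0(1)] by (simp add: weight_commute)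
      then show ?thesis using weight_waiting[of a] abN cw by (simp add: N_def weight_commute)
    next
      case 4
      have abN: "a = N" "b = N" using 4 aZ bZ ab by auto
      have "g e = 0" using g[of e] 4 fixed[of e] by auto
      moreover have "g c = weight N N" if c: "c \<in> Zx - {e}" for c
      proof -
        have "\<sigma> c \<noteq> \<sigma> e" using c 4 bij by (auto simp: bij_betw_def inj_on_def)
        then show ?thesis using g[of c] c False abN fixed[of e] 4 by auto
      qed
      ultimately have "sum g Zx = real (k - 1) * weight N N"
        using split[OF 4(1)] kk[OF 4(1)] by simp
      also have "\<dots> \<le> real k * r\<^sup>2 * weight N N"
      proof (rule mult_right_mono)
        show "real (k - 1) \<le> real k * r\<^sup>2" using mult_left_mono[OF r_square, of "real k"] k1
          by (simp add: algebra_simps of_nat_diff)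
        show "0 \<le> weight N N" by (intro weight_nonneg) (simp_all add: N_def)
      qed
      finally show ?thesis using cw abN by simp
    qed
  qed
  then have "sum g Zx / real k \<le> r\<^sup>2 * card_weight e s"
    using k1 by (simp add: pos_divide_le_eq mult_ac)
  then show ?thesis
    using expectation_coupled_step[OF k1 kn S, of "card_weight e"] by (simp add: sdef g_def Zx_def)
qed

text \<open>
  A union bound: each card is unmatched at time \<open>t\<close> with probability at most the mean weight,
  \<open>r ^ (2 * t)\<close>, divided by the least weight of an unmatched card.
\<close>

lemma tv_dist_le:
  assumes x0: "x0 \<in> orderings n"
  shows "tv_dist (orderings n) (shuffle_law n k x0 t) (pmf_of_set (orderings n))
    \<le> real n * r ^ (2 * t) / (m * r ^ (2 * (n - k)))"
proof -
  define U where "U = pmf_of_set (orderings n)"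
  define p where "p = map_pmf (\<lambda>y. (x0, y, {} :: nat set)) U"
  define \<kappa> where "\<kappa> = run (coupled_step n k) p t"
  let ?I = "coupled_states n k"
  have pI: "set_pmf p \<subseteq> ?I" using x0 by (auto simp: p_def U_def coupled_states_def)
  have stay: "set_pmf (coupled_step n k s) \<subseteq> ?I" if "s \<in> ?I" for s
    using set_coupled_step[OF k1 kn] that by (cases s) blast
  have \<kappa>I: "set_pmf \<kappa> \<subseteq> ?I" unfolding \<kappa>_def by (rule set_run[OF pI stay])
  have fin: "finite (set_pmf \<kappa>)" using \<kappa>I finite_coupled_states finite_subset by blast
  have "map_pmf fst \<kappa> = run (shuffle_step n k) (map_pmf fst p) t"
    unfolding \<kappa>_def
  proof (rule map_run[OF pI stay])
    fix s :: deck_pair assume "s \<in> ?I"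
    then show "map_pmf fst (coupled_step n k s) = shuffle_step n k (fst s)"
      using coupled_step_fst[OF k1 kn] by (cases s) simp
  qed
  also have "map_pmf fst p = return_pmf x0" by (simp add: p_def pmf.map_comp o_def map_pmf_const)
  finally have fst: "map_pmf fst \<kappa> = shuffle_law n k x0 t" by (simp add: shuffle_law_eq_run)
  have "map_pmf (\<lambda>z. fst (snd z)) \<kappa> = run (shuffle_step n k) (map_pmf (\<lambda>z. fst (snd z)) p) t"
    unfolding \<kappa>_def
  proof (rule map_run[OF pI stay])
    fix s :: deck_pair assume "s \<in> ?I"
    then show "map_pmf (\<lambda>z. fst (snd z)) (coupled_step n k s) = shuffle_step n k (fst (snd s))"
      using coupled_step_snd[OF k1 kn] by (cases s) simp
  qed
  also have "map_pmf (\<lambda>z. fst (snd z)) p = U" by (simp add: p_def pmf.map_comp o_def)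
  also have "run (shuffle_step n k) U t = U"
    by (induction t) (simp_all add: run_Suc uniform_stationary[OF k1 kn] U_def)
  finally have snd: "map_pmf (\<lambda>z. fst (snd z)) \<kappa> = U" .
  define c where "c = m * r ^ (2 * (n - k))"
  have c: "0 < c" using m_pos r_pos by (simp add: c_def)
  have un: "measure_pmf.prob \<kappa> {z. e \<notin> snd (snd z)} \<le> r ^ (2 * t) / c" if e: "e \<in> {1..n}" for e
  proof -
    have "c * measure_pmf.prob \<kappa> {z. e \<notin> snd (snd z)} \<le> measure_pmf.expectation \<kappa> (card_weight e)"
      using \<kappa>I c by (intro markov_finite fin)
        (auto simp: card_weight_def c_def intro!: weight_nonneg weight_ge depth_le)
    also have "\<dots> \<le> (r\<^sup>2) ^ t * measure_pmf.expectation p (card_weight e)"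
      unfolding \<kappa>_def
      by (rule expectation_run_geometric[OF finite_coupled_states pI stay card_weight_drift])
         (use e in auto)
    also have "\<dots> \<le> (r\<^sup>2) ^ t * 1"
    proof (rule mult_left_mono)
      have "measure_pmf.expectation p (card_weight e) \<le> measure_pmf.expectation p (\<lambda>_. 1)"
        by (rule expectation_mono_finite) (auto simp: p_def U_def card_weight_def weight_le_1)
      then show "measure_pmf.expectation p (card_weight e) \<le> 1" by simp
    qed simp
    finally have "c * measure_pmf.prob \<kappa> {z. e \<notin> snd (snd z)} \<le> (r\<^sup>2) ^ t" by simp
    then show ?thesis using c by (simp add: pos_le_divide_eq mult.commute[of c] power_mult)
  qed
  have "tv_dist (orderings n) (shuffle_law n k x0 t) U \<le> measure_pmf.prob \<kappa> {z. fst z \<noteq> fst (snd z)}"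
    using tv_dist_le_coupling[of "orderings n" fst \<kappa> "\<lambda>z. fst (snd z)"] fst snd by simp
  also have "\<dots> \<le> measure_pmf.prob \<kappa> (\<Union>e\<in>{1..n}. {z. e \<notin> snd (snd z)})"
  proof (rule measure_pmf.finite_measure_mono_AE, unfold AE_measure_pmf_iff, safe)
    fix z assume z: "z \<in> set_pmf \<kappa>" "fst z \<noteq> fst (snd z)"
    obtain xs ys M where zdef: "z = (xs, ys, M)" by (cases z)
    have "(xs, ys, M) \<in> ?I" using z \<kappa>I zdef by auto
    then have "filter (\<lambda>c. c \<in> M) xs = filter (\<lambda>c. c \<in> M) ys" "set xs = {1..n}" "set ys = {1..n}"
      by (auto simp: coupled_states_def orderings_iff)
    moreover have "filter (\<lambda>c. c \<in> M) zs = zs" if "set zs \<subseteq> M" for zs :: "nat list"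
      using that by (intro filter_True) auto
    ultimately have "\<not> {1..n} \<subseteq> M" using z(2) zdef by (metis (mono_tags, lifting) fst_conv mem_Collect_eq snd_conv)
    then show "z \<in> (\<Union>e\<in>{1..n}. {z. e \<notin> snd (snd z)})" by (auto simp: zdef)
  qed simp
  also have "\<dots> \<le> (\<Sum>e\<in>{1..n}. measure_pmf.prob \<kappa> {z. e \<notin> snd (snd z)})"
    by (intro measure_pmf.finite_measure_subadditive_finite) auto
  also have "\<dots> \<le> (\<Sum>e\<in>{1..n}. r ^ (2 * t) / c)" by (intro sum_mono un)
  finally show ?thesis by (simp add: U_def c_def)
qed

end

section \<open>Explicit decay rates\<close>

text \<open>
  With \<open>r = 1 - \<eta>\<close>, the squared modulus of \<open>k * rcis r \<theta> - (k - 1)\<close> is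
  \<open>(1 - k * \<eta>)\<^sup>2 + q * (1 - \<eta>)\<close> for \<open>q = phase_drift k \<theta>\<close>: the spreading that \<open>r\<close> has to compensate.
\<close>

definition phase_drift :: "nat \<Rightarrow> real \<Rightarrow> real" where
  "phase_drift k \<theta> = 2 * real k * (real k - 1) * (1 - cos \<theta>)"

text \<open>
  The solution \<open>\<eta>\<close> of \<open>1 + q = 2 * n * \<eta> * (1 + q) + 1\<close>, which is what remains of the condition
  \<open>1 \<le> \<rho>\<close> after Bernoulli's inequality.
\<close>

definition phase_decay :: "nat \<Rightarrow> nat \<Rightarrow> real \<Rightarrow> real" where
  "phase_decay n k \<theta> = phase_drift k \<theta> / (2 * real n * (1 + phase_drift k \<theta>))"

lemma one_minus_cos_le: "1 - cos \<theta> \<le> \<theta>\<^sup>2 / 2" for \<theta> :: real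
proof -
  have "\<bar>sin (\<theta> / 2)\<bar> \<le> \<bar>\<theta> / 2\<bar>" by (rule abs_sin_x_le_abs_x)
  then have "(sin (\<theta> / 2))\<^sup>2 \<le> (\<theta> / 2)\<^sup>2" by (simp only: abs_le_square_iff)
  moreover have "cos \<theta> = 1 - 2 * (sin (\<theta> / 2))\<^sup>2" using cos_double_sin[of "\<theta> / 2"] by simp
  ultimately show ?thesis by (simp add: power_divide)
qed

lemma phase_drift_nonneg: "1 \<le> k \<Longrightarrow> 0 \<le> phase_drift k \<theta>"
  by (simp add: phase_drift_def)

lemma phase_decay_bounds:
  assumes "1 \<le> k" "1 \<le> n"
  shows "0 \<le> phase_decay n k \<theta>"
    and "2 * real n * phase_decay n k \<theta> = phase_drift k \<theta> / (1 + phase_drift k \<theta>)"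
    and "2 * real n * phase_decay n k \<theta> < 1"
proof -
  have q: "0 \<le> phase_drift k \<theta>" by (rule phase_drift_nonneg[OF assms(1)])
  then show "0 \<le> phase_decay n k \<theta>" by (simp add: phase_decay_def)
  show *: "2 * real n * phase_decay n k \<theta> = phase_drift k \<theta> / (1 + phase_drift k \<theta>)"
    using assms q by (simp add: phase_decay_def)
  show "2 * real n * phase_decay n k \<theta> < 1" unfolding * using q by (simp add: divide_simps)
qed

text \<open>
  Bernoulli's inequality linearises the power without losing the leading order of \<open>n * \<eta>\<close>.
\<close>

lemma phase_power_ge:
  assumes "1 \<le> k" "k \<le> n"
  shows "1 - 2 * real (n - k) * phase_decay n k \<theta> \<le> (1 - phase_decay n k \<theta>) ^ (2 * (n - k))"
    and "0 \<le> 1 - 2 * real (n - k) * phase_decay n k \<theta>"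
    and "1 / (1 + phase_drift k \<theta>) \<le> (1 - phase_decay n k \<theta>) ^ (2 * (n - k))"
proof -
  define \<eta> where "\<eta> = phase_decay n k \<theta>"
  define q where "q = phase_drift k \<theta>"
  note b = phase_decay_bounds[of k n \<theta>, folded \<eta>_def q_def]
  have b: "0 \<le> \<eta>" "2 * real n * \<eta> = q / (1 + q)" "2 * real n * \<eta> < 1" using b assms by auto
  have q: "0 \<le> q" using phase_drift_nonneg assms by (simp add: q_def)
  have "1 * \<eta> \<le> 2 * real n * \<eta>" using b(1) assms by (intro mult_right_mono) auto
  then have "\<eta> < 1" using b(3) by simp
  then show 1: "1 - 2 * real (n - k) * phase_decay n k \<theta> \<le> (1 - phase_decay n k \<theta>) ^ (2 * (n - k))"
    using Bernoulli_inequality[of "- \<eta>" "2 * (n - k)"] by (simp add: \<eta>_def)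
  have le: "2 * real (n - k) * \<eta> \<le> 2 * real n * \<eta>" using b(1) by (intro mult_right_mono) auto
  then show "0 \<le> 1 - 2 * real (n - k) * phase_decay n k \<theta>" using b(3) by (simp add: \<eta>_def)
  have "1 / (1 + q) = 1 - 2 * real n * \<eta>" unfolding b(2) using q by (simp add: field_simps)
  also have "\<dots> \<le> 1 - 2 * real (n - k) * \<eta>" using le by simp
  finally show "1 / (1 + phase_drift k \<theta>) \<le> (1 - phase_decay n k \<theta>) ^ (2 * (n - k))"
    using 1 by (simp add: \<eta>_def q_def)
qed

text \<open>
  Squaring and Bernoulli's inequality reduce the claim to
  \<open>1 \<le> (1 - 2 * N * \<eta>) * (1 - 2 * k * \<eta> + q * (1 - \<eta>))\<close> with \<open>N = n - k\<close>. The right side is at least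
  \<open>1 + q - 2 * n * \<eta> * (1 + q)\<close>, which equals 1 by the choice of \<open>\<eta>\<close>.
\<close>

lemma phase_modulus_ge_1:
  assumes "1 \<le> k" "k \<le> n" "r = 1 - phase_decay n k \<theta>"
  shows "1 \<le> r ^ (n - k) * cmod (of_nat k * rcis r \<theta> - of_nat (k - 1))"
proof -
  define \<eta> where "\<eta> = phase_decay n k \<theta>"
  define q where "q = phase_drift k \<theta>"
  define N where "N = n - k"
  define w where "w = of_nat k * rcis r \<theta> - of_nat (k - 1)"
  note b = phase_decay_bounds[of k n \<theta>, folded \<eta>_def q_def]
  have b: "0 \<le> \<eta>" "2 * real n * \<eta> = q / (1 + q)" "2 * real n * \<eta> < 1" using b assms by auto
  have q: "0 \<le> q" using phase_drift_nonneg assms by (simp add: q_def)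
  have r: "r = 1 - \<eta>" using assms by (simp add: \<eta>_def)
  have nN: "real n = real N + real k" using assms by (simp add: N_def)
  have "1 * \<eta> \<le> 2 * real n * \<eta>" using b(1) assms by (intro mult_right_mono) auto
  then have "0 < r" using b(3) r by simp
  have "(cmod w)\<^sup>2 = (real k * r * cos \<theta> - real (k - 1))\<^sup>2 + (real k * r * sin \<theta>)\<^sup>2"
    by (simp add: cmod_power2 w_def mult.assoc)
  also have "\<dots> = (real k * r)\<^sup>2 * ((sin \<theta>)\<^sup>2 + (cos \<theta>)\<^sup>2) + (real k - 1)\<^sup>2 - 2 * real k * (real k - 1) * r * cos \<theta>"
  proof -
    have k1: "real (k - 1) = real k - 1" using assms by (simp add: of_nat_diff)
    have "(x * C - y)\<^sup>2 + (x * S)\<^sup>2 = x\<^sup>2 * (S\<^sup>2 + C\<^sup>2) + y\<^sup>2 - 2 * y * x * C" for x y C S :: real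
      by (simp add: power2_eq_square algebra_simps)
    from this[of "real k * r" "cos \<theta>" "real k - 1" "sin \<theta>"]
    show ?thesis unfolding k1 by (simp only: mult_ac)
  qed
  also have "\<dots> = (1 - real k * \<eta>)\<^sup>2 + q * (1 - \<eta>)"
    by (simp add: r q_def phase_drift_def power2_eq_square algebra_simps)
  finally have w2: "(cmod w)\<^sup>2 = (1 - real k * \<eta>)\<^sup>2 + q * (1 - \<eta>)" .
  have p: "1 - 2 * real N * \<eta> \<le> r ^ (2 * N)" "0 \<le> 1 - 2 * real N * \<eta>"
    using phase_power_ge[of k n \<theta>] assms by (simp_all add: N_def \<eta>_def)
  have "1 = 1 + q - 2 * real n * \<eta> * (1 + q)" using b(2) q by simp
  also have "\<dots> = (1 - 2 * real N * \<eta>) * (1 - 2 * real k * \<eta> + q * (1 - \<eta>)) - 4 * real N * real k * \<eta>\<^sup>2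
      - 2 * q * real N * \<eta>\<^sup>2 - q * \<eta> * (2 * real k - 1)"
    unfolding nN by (simp add: power2_eq_square algebra_simps)
  also have "\<dots> \<le> (1 - 2 * real N * \<eta>) * (1 - 2 * real k * \<eta> + q * (1 - \<eta>))"
  proof -
    have "0 \<le> q * \<eta> * (2 * real k - 1)" using q b(1) assms by (intro mult_nonneg_nonneg) auto
    moreover have "0 \<le> 2 * q * real N * \<eta>\<^sup>2" "0 \<le> 4 * real N * real k * \<eta>\<^sup>2" using q by auto
    ultimately show ?thesis by linarith
  qed
  also have "\<dots> \<le> (1 - 2 * real N * \<eta>) * (cmod w)\<^sup>2"
  proof (rule mult_left_mono)
    have "1 - 2 * real k * \<eta> \<le> (1 - real k * \<eta>)\<^sup>2"
      using zero_le_square[of "real k * \<eta>"] by (simp add: power2_eq_square algebra_simps)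
    then show "1 - 2 * real k * \<eta> + q * (1 - \<eta>) \<le> (cmod w)\<^sup>2" unfolding w2 by simp
  qed (rule p(2))
  also have "\<dots> \<le> r ^ (2 * N) * (cmod w)\<^sup>2" using p(1) by (intro mult_right_mono) auto
  also have "\<dots> = (r ^ N * cmod w)\<^sup>2" by (simp add: power_mult_distrib mult.commute flip: power_mult)
  finally have "1\<^sup>2 \<le> (r ^ N * cmod w)\<^sup>2" by simp
  then have "1 \<le> r ^ N * cmod w" by (rule power2_le_imp_le) (use \<open>0 < r\<close> in simp)
  then show ?thesis by (simp add: N_def w_def)
qed

text \<open>
  The argument of \<open>k * rcis r \<theta> - (k - 1)\<close> lies between 0 and \<open>k * \<theta> / D\<close>, where \<open>D\<close> bounds its real part
  below. So the cosine is evaluated within distance \<open>\<Phi>\<close> of 0 if \<open>2 * \<Phi>\<close> exceeds the total phase.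
\<close>

lemma phase_weight_exists:
  assumes k: "1 \<le> k" "k \<le> n" and th: "0 < \<theta>" "\<theta> \<le> pi"
    and D: "0 < D" "D \<le> 1 - real k * phase_decay n k \<theta> - real k * \<theta>\<^sup>2 / 2"
    and P: "real (n - k) * \<theta> + real k * \<theta> / D \<le> 2 * \<Phi>" "\<Phi> < pi / 2"
  obtains \<phi> \<rho> where "phase_weight n k (1 - phase_decay n k \<theta>) \<theta> \<phi> \<rho> (cos \<Phi>)"
proof -
  define \<eta> where "\<eta> = phase_decay n k \<theta>"
  define r where "r = 1 - \<eta>"
  define N where "N = n - k"
  define w where "w = of_nat k * rcis r \<theta> - of_nat (k - 1)"
  define \<alpha> where "\<alpha> = Arg w"
  have b: "0 \<le> \<eta>" "2 * real n * \<eta> < 1" using phase_decay_bounds[of k n \<theta>] k by (simp_all add: \<eta>_def)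
  have "1 * \<eta> \<le> 2 * real n * \<eta>" using b(1) k by (intro mult_right_mono) auto
  then have r: "0 < r" "r \<le> 1" using b r_def by simp_all
  have "1 - r * cos \<theta> = 1 - cos \<theta> + \<eta> * cos \<theta>" by (simp add: r_def algebra_simps)
  also have "\<dots> \<le> \<theta>\<^sup>2 / 2 + \<eta> * 1" using b(1) by (intro add_mono one_minus_cos_le mult_left_mono) auto
  finally have "real k * (1 - r * cos \<theta>) \<le> real k * (\<theta>\<^sup>2 / 2 + \<eta>)" by (intro mult_left_mono) auto
  moreover have "Re w = 1 - real k * (1 - r * cos \<theta>)"
    using k by (simp add: w_def of_nat_diff algebra_simps)
  ultimately have Re: "D \<le> Re w" using D(2) by (simp add: algebra_simps \<eta>_def)
  have Imw: "Im w = real k * (r * sin \<theta>)" by (simp add: w_def)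
  have s0: "0 \<le> sin \<theta>" using th by (intro sin_ge_zero) auto
  have Im0: "0 \<le> Im w" unfolding Imw using s0 r by simp
  have "r * sin \<theta> \<le> 1 * \<theta>" using s0 r th sin_x_le_x[of \<theta>] by (intro mult_mono) auto
  then have Im1: "Im w \<le> real k * \<theta>" unfolding Imw by (intro mult_left_mono) auto
  have \<alpha>: "\<alpha> = arctan (Im w / Re w)" unfolding \<alpha>_def using Re D(1) by (intro arg_conv_arctan) auto
  have a0: "0 \<le> \<alpha>" unfolding \<alpha> using Im0 Re D(1) by simp
  have "\<alpha> \<le> Im w / Re w" unfolding \<alpha> using Im0 Re D(1) by (intro arctan_le_self) auto
  also have "\<dots> \<le> real k * \<theta> / D" using Im0 Im1 Re D(1) by (intro frac_le) auto
  finally have a1: "\<alpha> \<le> real k * \<theta> / D" .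
  define \<phi> where "\<phi> = (N * \<theta> + \<alpha>) / 2"
  define \<rho> where "\<rho> = r ^ N * cmod w"
  have "phase_weight n k r \<theta> \<phi> \<rho> (cos \<Phi>)"
  proof
    show "1 \<le> k" "k \<le> n" "0 < r" "r \<le> 1" "0 \<le> \<theta>" using k r th by auto
    have P0: "0 \<le> \<Phi>" using P(1) k th D by (smt (verit) divide_nonneg_pos mult_nonneg_nonneg of_nat_0_le_iff)
    then show "0 < cos \<Phi>" using P(2) by (intro cos_gt_zero_pi) auto
    have "real k * (2 * \<eta>) \<le> real n * (2 * \<eta>)" using b(1) k by (intro mult_right_mono) auto
    then have "2 * \<eta> \<le> 1 / real k" using b k by (simp add: field_simps)
    moreover have "1 - 2 * \<eta> \<le> r\<^sup>2" by (simp add: r_def power2_eq_square algebra_simps)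
    ultimately show "1 - 1 / real k \<le> r\<^sup>2" by linarith
    show "1 \<le> \<rho>" unfolding \<rho>_def w_def N_def using k by (intro phase_modulus_ge_1) (auto simp: r_def \<eta>_def)
    have "w = rcis (cmod w) \<alpha>" by (simp add: \<alpha>_def rcis_cmod_Arg)
    then have "rcis r \<theta> ^ N * w = rcis r \<theta> ^ N * rcis (cmod w) \<alpha>" by simp
    also have "\<dots> = rcis \<rho> (N * \<theta> + \<alpha>)" by (simp add: DeMoivre2 rcis_mult \<rho>_def)
    also have "N * \<theta> + \<alpha> = 2 * \<phi>" by (simp add: \<phi>_def)
    finally show "rcis r \<theta> ^ (n - k) * (of_nat k * rcis r \<theta> - of_nat (k - 1)) = rcis \<rho> (2 * \<phi>)"
      by (simp add: N_def w_def)
    fix u assume u: "0 \<le> u" "u \<le> \<theta> * real (n - k)"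
    have "N * \<theta> + \<alpha> \<le> 2 * \<Phi>" using P(1) a1 by (simp add: N_def)
    then have "\<bar>u - \<phi>\<bar> \<le> \<Phi>" using u a0 by (auto simp: \<phi>_def N_def abs_le_iff field_simps)
    then have "cos \<Phi> \<le> cos \<bar>u - \<phi>\<bar>" using P(2) by (intro cos_monotone_0_pi_le) auto
    then show "cos \<Phi> \<le> cos (u - \<phi>)" by simp
  qed
  then show thesis using that by (simp add: r_def \<eta>_def)
qed

lemma tv_dist_le_quarter:
  assumes k: "1 \<le> k" "k \<le> n" and th: "0 < \<theta>" "\<theta> \<le> pi"
    and D: "0 < D" "D \<le> 1 - real k * phase_decay n k \<theta> - real k * \<theta>\<^sup>2 / 2"
    and P: "real (n - k) * \<theta> + real k * \<theta> / D \<le> 2 * \<Phi>" "\<Phi> < pi / 2"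
    and t: "ln (4 * real n * (1 + phase_drift k \<theta>) / cos \<Phi>) \<le> 2 * real t * phase_decay n k \<theta>"
    and s: "s \<in> orderings n"
  shows "tv_dist (orderings n) (shuffle_law n k s t) (pmf_of_set (orderings n)) \<le> 1 / 4"
proof -
  define r where "r = 1 - phase_decay n k \<theta>"
  define q where "q = phase_drift k \<theta>"
  obtain \<phi> \<rho> where "phase_weight n k (1 - phase_decay n k \<theta>) \<theta> \<phi> \<rho> (cos \<Phi>)"
    using phase_weight_exists[OF k th D P] .
  then interpret phase_weight n k r \<theta> \<phi> \<rho> "cos \<Phi>" by (simp add: r_def)
  have q: "0 \<le> q" using phase_drift_nonneg k by (simp add: q_def)
  define c where "c = cos \<Phi>"
  have c: "0 < c" using m_pos by (simp add: c_def)
  have n: "0 < real n" using k by simp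
  have "r \<le> exp (- phase_decay n k \<theta>)" using exp_ge_add_one_self[of "- phase_decay n k \<theta>"] by (simp add: r_def)
  then have "r ^ (2 * t) \<le> exp (- phase_decay n k \<theta>) ^ (2 * t)" using r_pos by (intro power_mono) auto
  also have "\<dots> = exp (- (2 * real t * phase_decay n k \<theta>))" by (simp flip: exp_of_nat_mult)
  also have "\<dots> \<le> exp (- ln (4 * real n * (1 + q) / c))" using t by (simp add: q_def c_def)
  also have "\<dots> = c / (4 * real n * (1 + q))" using n q c by (simp add: exp_minus)
  finally have 1: "r ^ (2 * t) \<le> c / (4 * real n * (1 + q))" .
  have 2: "1 / (1 + q) \<le> r ^ (2 * (n - k))" using phase_power_ge(3)[OF k] by (simp add: r_def q_def)
  have "tv_dist (orderings n) (shuffle_law n k s t) (pmf_of_set (orderings n))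
     \<le> real n * r ^ (2 * t) / (c * r ^ (2 * (n - k)))"
    using tv_dist_le[OF s] by (simp add: c_def)
  also have "\<dots> \<le> real n * (c / (4 * real n * (1 + q))) / (c * (1 / (1 + q)))"
    using 1 2 c q n r_pos by (intro frac_le mult_left_mono mult_pos_pos) auto
  also have "\<dots> = 1 / 4"
  proof -
    have "1 + q \<noteq> 0" using q by simp
    then show ?thesis using c n by simp
  qed
  finally show ?thesis .
qed

text \<open>
  The choice \<open>\<theta> = 1 / n\<close> works for all \<open>2 \<le> k \<le> n\<close>, with a rate that is optimal up to a constant. It
  serves the case of \<open>k\<close> proportional to \<open>n\<close> and shows that the distance drops to 1/4 for all such
  \<open>n\<close> and \<open>k\<close>.
\<close>

lemma tv_dist_unit_phase:
  assumes k: "2 \<le> k" "k \<le> n"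
    and t: "ln (8 * real n / cos 1) \<le> 2 * real t * phase_decay n k (1 / real n)"
    and s: "s \<in> orderings n"
  shows "tv_dist (orderings n) (shuffle_law n k s t) (pmf_of_set (orderings n)) \<le> 1 / 4"
proof (rule tv_dist_le_quarter[where D = "1 / 2" and \<Phi> = 1, OF _ k(2) _ _ _ _ _ _ _ s])
  let ?q = "phase_drift k (1 / real n)" and ?\<eta> = "phase_decay n k (1 / real n)"
  have n: "2 \<le> real n" and k1: "1 \<le> k" using k by auto
  have q: "0 \<le> ?q" "?q \<le> 1"
  proof -
    show "0 \<le> ?q" using phase_drift_nonneg[OF k1] .
    have "?q \<le> 2 * real k * (real k - 1) * ((1 / real n)\<^sup>2 / 2)"
      unfolding phase_drift_def using k1 by (intro mult_left_mono one_minus_cos_le) auto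
    also have "\<dots> \<le> 2 * real n * real n * ((1 / real n)\<^sup>2 / 2)"
      using k by (intro mult_right_mono mult_mono) auto
    also have "\<dots> = 1" using n by (simp add: power2_eq_square)
    finally show "?q \<le> 1" .
  qed
  show "1 \<le> k" "0 < 1 / real n" "0 < (1 / 2 :: real)" using k1 n by auto
  have "1 / real n \<le> 1" using n by simp
  then show "1 / real n \<le> pi" using pi_gt3 by linarith
  show "1 < pi / 2" using pi_gt3 by simp
  have "2 * real n * ?\<eta> = ?q / (1 + ?q)" using phase_decay_bounds(2)[OF k1, of n] k by simp
  also have "\<dots> \<le> 1 / 2" using q by (simp add: divide_le_eq)
  finally have "real n * ?\<eta> \<le> 1 / 4" by simp
  moreover have "real k * ?\<eta> \<le> real n * ?\<eta>"
    using k phase_decay_bounds(1)[OF k1, of n] by (intro mult_right_mono) auto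
  moreover have "real k * (1 / real n)\<^sup>2 / 2 \<le> real n * (1 / real n)\<^sup>2 / 2"
    using k by (intro divide_right_mono mult_right_mono) auto
  moreover have "real n * (1 / real n)\<^sup>2 / 2 \<le> 1 / 4" using n by (simp add: power2_eq_square field_simps)
  ultimately show "1 / 2 \<le> 1 - real k * ?\<eta> - real k * (1 / real n)\<^sup>2 / 2" by linarith
  show "real (n - k) * (1 / real n) + real k * (1 / real n) / (1 / 2) \<le> 2 * 1"
    using k n by (simp add: of_nat_diff field_simps)
  have c: "0 < cos (1 :: real)" by (intro cos_gt_zero) (use pi_gt3 in auto)
  have "ln (4 * real n * (1 + ?q) / cos 1) \<le> ln (8 * real n / cos 1)"
    using q c n by (intro ln_mono divide_right_mono mult_pos_pos divide_pos_pos) auto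
  with t show "ln (4 * real n * (1 + ?q) / cos 1) \<le> 2 * real t * ?\<eta>" by simp
qed

lemma phase_decay_unit_pos:
  assumes "2 \<le> k" "k \<le> n"
  shows "0 < phase_decay n k (1 / real n)"
proof -
  have "cos (2 * (1 / (2 * real n))) < 1"
    using assms by (intro cos_double_less_one) (auto simp: divide_less_eq)
  then have "cos (1 / real n) < 1" by simp
  then have "0 < phase_drift k (1 / real n)" using assms by (auto simp: phase_drift_def)
  then show ?thesis using assms by (auto simp: phase_decay_def)
qed

lemma nat_ceiling_div:
  fixes a b :: real
  assumes "0 < b" "0 \<le> a"
  shows "a \<le> real (nat \<lceil>a / b\<rceil>) * b" "real (nat \<lceil>a / b\<rceil>) \<le> a / b + 1"
proof -
  have "a / b \<le> real (nat \<lceil>a / b\<rceil>)" by linarith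
  then show "a \<le> real (nat \<lceil>a / b\<rceil>) * b" using assms(1) by (simp only: pos_divide_le_eq)
  have "0 \<le> a / b" using assms by simp
  then show "real (nat \<lceil>a / b\<rceil>) \<le> a / b + 1" by linarith
qed

lemma mixing_time_gt_if_far:
  assumes "2 \<le> k" "k \<le> n" "s \<in> orderings n"
    and "\<And>t. real t \<le> x \<Longrightarrow>
      tv_dist (orderings n) (shuffle_law n k s t) (pmf_of_set (orderings n)) > 1 / 4"
  shows "x < real (mixing_time n k)"
proof -
  let ?\<eta> = "phase_decay n k (1 / real n)"
  obtain T :: nat where T: "ln (8 * real n / cos 1) / (2 * ?\<eta>) \<le> real T" using real_arch_simple by blast
  have "ln (8 * real n / cos 1) \<le> 2 * real T * ?\<eta>"
    using T phase_decay_unit_pos[OF assms(1,2)] by (simp add: divide_le_eq mult_ac)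
  then show ?thesis using mixing_time_gt[OF assms(3) tv_dist_unit_phase[OF assms(1,2) _ assms(3)] assms(4)] by blast
qed

section \<open>Wilson's second moment bound\<close>

lemma sum_cmod_square_shift:
  fixes d :: "'a \<Rightarrow> complex"
  assumes "sum d A = 0"
  shows "(\<Sum>c\<in>A. (cmod (d c + b))\<^sup>2) = (\<Sum>c\<in>A. (cmod (d c))\<^sup>2) + real (card A) * (cmod b)\<^sup>2"
proof -
  have "(\<Sum>c\<in>A. (cmod (d c + b))\<^sup>2)
     = (\<Sum>c\<in>A. (cmod (d c))\<^sup>2 + (cmod b)\<^sup>2 + 2 * (Re (d c) * Re b + Im (d c) * Im b))"
    unfolding cmod_power2 by (intro sum.cong refl) (simp add: power2_eq_square algebra_simps)
  also have "\<dots> = (\<Sum>c\<in>A. (cmod (d c))\<^sup>2) + real (card A) * (cmod b)\<^sup>2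
      + 2 * (Re (sum d A) * Re b + Im (sum d A) * Im b)"
    by (simp add: sum.distrib Re_sum Im_sum sum_distrib_left sum_distrib_right)
  finally show ?thesis using assms by simp
qed

text \<open>
  The equation says that \<open>w\<close> to the power of the depth is multiplied by \<open>w\<close> in mean: this is automatic
  above the zone, and inside the zone it reads \<open>1 / k + (1 - 1 / k) * w ^ (n - k) = w * w ^ (n - k)\<close>.
\<close>

locale phase_eigenvalue =
  fixes n k :: nat and w :: complex
  assumes k1: "1 \<le> k" and kn: "k \<le> n"
    and w_lt_1: "cmod w < 1"
    and eigen: "w ^ (n - k) * (of_nat k * w - of_nat (k - 1)) = 1"
begin

definition phase_sum :: "nat set \<Rightarrow> nat list \<Rightarrow> complex" where
  "phase_sum S xs = (\<Sum>e\<in>S. w ^ depth (n - k) xs e)"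

definition noise_bound :: real where
  "noise_bound = (2 * real k * cmod (1 - w))\<^sup>2"

text \<open>
  The fixed point of the recursion \<open>v \<mapsto> \<bar>w\<bar>\<^sup>2 * v + noise_bound\<close> of the variances.
\<close>

definition variance_bound :: real where
  "variance_bound = noise_bound / (1 - (cmod w)\<^sup>2)"

lemma w_power_le_1: "cmod w ^ m \<le> 1"
  using w_lt_1 by (intro power_le_one) auto

text \<open>
  A card leaving the zone makes a jump that equals, up to sign, \<open>k - 1\<close> times the small change of
  each card that stays. Hence the noise of one shuffle is of order \<open>k * \<bar>1 - w\<bar>\<close>, however large the set
  of observed cards is.
\<close>

lemma return_gap: "1 - w ^ Suc (n - k) = of_nat (k - 1) * (w ^ (n - k) * (w - 1))"
proof -
  have k: "(of_nat k :: complex) = of_nat (k - 1) + 1" using k1 by (simp flip: of_nat_Suc)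
  have "1 = w ^ (n - k) * (of_nat k * w - of_nat (k - 1))" using eigen by simp
  also have "\<dots> = of_nat (k - 1) * (w ^ (n - k) * (w - 1)) + w ^ Suc (n - k)"
    unfolding k by (simp add: algebra_simps)
  finally show ?thesis by (simp add: algebra_simps)
qed

lemma phase_sum_increment:
  assumes xs: "xs \<in> orderings n" and S: "S \<subseteq> {1..n}" and c: "c \<in> zone n k xs"
  shows "phase_sum S (to_top c xs) - w * phase_sum S xs
    = (\<Sum>e\<in>S \<inter> zone n k xs. if e = c then 1 - w ^ Suc (n - k) else w ^ (n - k) - w ^ Suc (n - k))"
proof -
  have d: "distinct xs" "set xs = {1..n}" using xs by (auto simp: orderings_iff)
  have fS: "finite S" using S finite_subset by blast
  have "phase_sum S (to_top c xs) - w * phase_sum S xs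
    = (\<Sum>e\<in>S. w ^ depth (n - k) (to_top c xs) e - w ^ Suc (depth (n - k) xs e))"
    by (simp add: phase_sum_def sum_distrib_left sum_subtractf)
  also have "\<dots> = (\<Sum>e\<in>S. if e \<in> zone n k xs then
      (if e = c then 1 - w ^ Suc (n - k) else w ^ (n - k) - w ^ Suc (n - k)) else 0)"
  proof (rule sum.cong[OF refl])
    fix e assume "e \<in> S"
    then have e: "e \<in> set xs" using S d by auto
    have "depth (n - k) xs e = n - k \<longleftrightarrow> e \<in> zone n k xs"
      using depth_eq_iff_mem_drop[OF d(1) e] .
    moreover have "depth (n - k) xs e \<le> n - k" by (rule depth_le)
    moreover have "depth (n - k) (to_top c xs) e = (if e = c then 0 else min (n - k) (depth (n - k) xs e + 1))"
      using depth_to_top_other[OF d(1) c] by simp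
    ultimately have dep: "depth (n - k) xs e = n - k \<longleftrightarrow> e \<in> zone n k xs" "depth (n - k) xs e \<le> n - k"
      "depth (n - k) (to_top c xs) e = (if e = c then 0 else min (n - k) (depth (n - k) xs e + 1))" by auto
    show "w ^ depth (n - k) (to_top c xs) e - w ^ Suc (depth (n - k) xs e)
      = (if e \<in> zone n k xs then
          (if e = c then 1 - w ^ Suc (n - k) else w ^ (n - k) - w ^ Suc (n - k)) else 0)"
    proof (cases "e \<in> zone n k xs")
      case False
      then have "depth (n - k) xs e < n - k" "e \<noteq> c" using dep c by auto
      then show ?thesis using dep False by simp
    qed (use dep in auto)
  qed
  also have "\<dots> = (\<Sum>e\<in>S \<inter> zone n k xs.
      if e = c then 1 - w ^ Suc (n - k) else w ^ (n - k) - w ^ Suc (n - k))"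
    using fS by (simp add: sum.inter_restrict)
  finally show ?thesis .
qed

lemma phase_sum_increment_mean:
  assumes xs: "xs \<in> orderings n" and S: "S \<subseteq> {1..n}"
  shows "(\<Sum>c\<in>zone n k xs. phase_sum S (to_top c xs) - w * phase_sum S xs) = 0"
proof -
  let ?Z = "zone n k xs"
  let ?u = "1 - w ^ Suc (n - k)" and ?v = "w ^ (n - k) - w ^ Suc (n - k)"
  have z: "?u + of_nat (k - 1) * ?v = 0" unfolding return_gap by (simp add: algebra_simps)
  have "(\<Sum>c\<in>?Z. phase_sum S (to_top c xs) - w * phase_sum S xs)
     = (\<Sum>c\<in>?Z. \<Sum>e\<in>S \<inter> ?Z. if e = c then ?u else ?v)"
    using phase_sum_increment[OF xs S] by (intro sum.cong refl) auto
  also have "\<dots> = (\<Sum>e\<in>S \<inter> ?Z. \<Sum>c\<in>?Z. if e = c then ?u else ?v)" by (rule sum.swap)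
  also have "\<dots> = (\<Sum>e\<in>S \<inter> ?Z. 0)"
  proof (rule sum.cong[OF refl])
    fix e assume e: "e \<in> S \<inter> ?Z"
    have "(\<Sum>c\<in>?Z. if e = c then ?u else ?v) = ?u + (\<Sum>c\<in>?Z - {e}. if e = c then ?u else ?v)"
      using e by (subst sum.remove[of _ e]) auto
    also have "(\<Sum>c\<in>?Z - {e}. if e = c then ?u else ?v) = (\<Sum>c\<in>?Z - {e}. ?v)"
      by (intro sum.cong) auto
    also have "\<dots> = of_nat (k - 1) * ?v" using card_zone[OF xs kn] e by simp
    finally show "(\<Sum>c\<in>?Z. if e = c then ?u else ?v) = 0" using z by simp
  qed
  finally show ?thesis by simp
qed

lemma phase_sum_increment_bound:
  assumes xs: "xs \<in> orderings n" and S: "S \<subseteq> {1..n}" and c: "c \<in> zone n k xs"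
  shows "(cmod (phase_sum S (to_top c xs) - w * phase_sum S xs))\<^sup>2 \<le> noise_bound"
proof -
  let ?Z = "zone n k xs"
  let ?f = "\<lambda>e. if e = c then 1 - w ^ Suc (n - k) else w ^ (n - k) - w ^ Suc (n - k)"
  let ?h = "cmod (1 - w)"
  have g: "cmod (w ^ (n - k) * (w - 1)) \<le> ?h"
    using mult_right_mono[OF w_power_le_1[of "n - k"], of ?h]
    by (simp add: norm_mult norm_power norm_minus_commute)
  have 1: "cmod (1 - w ^ Suc (n - k)) \<le> real k * ?h"
  proof -
    have "cmod (1 - w ^ Suc (n - k)) = real (k - 1) * cmod (w ^ (n - k) * (w - 1))"
      unfolding return_gap norm_mult[of "of_nat (k - 1)"] by simp
    also have "\<dots> \<le> real k * ?h" using g by (intro mult_mono) auto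
    finally show ?thesis .
  qed
  have 2: "cmod (w ^ (n - k) - w ^ Suc (n - k)) \<le> ?h"
    using g by (simp add: algebra_simps norm_minus_commute)
  have "cmod (phase_sum S (to_top c xs) - w * phase_sum S xs) = cmod (\<Sum>e\<in>S \<inter> ?Z. ?f e)"
    using phase_sum_increment[OF xs S c] by simp
  also have "\<dots> \<le> (\<Sum>e\<in>S \<inter> ?Z. cmod (?f e))" by (rule norm_sum)
  also have "\<dots> \<le> (\<Sum>e\<in>?Z. cmod (?f e))" by (intro sum_mono2) auto
  also have "\<dots> = cmod (?f c) + (\<Sum>e\<in>?Z - {c}. cmod (?f e))" using c by (intro sum.remove) auto
  also have "\<dots> \<le> real k * ?h + (\<Sum>e\<in>?Z - {c}. ?h)" using 1 2 by (intro add_mono sum_mono) auto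
  also have "(\<Sum>e\<in>?Z - {c}. ?h) \<le> real k * ?h"
    using card_zone[OF xs kn] c by (auto intro!: mult_right_mono)
  finally have "cmod (phase_sum S (to_top c xs) - w * phase_sum S xs) \<le> 2 * real k * ?h" by simp
  then show ?thesis unfolding noise_bound_def by (intro power_mono) auto
qed

text \<open>
  The increments \<open>phase_sum S (to_top c xs) - w * phase_sum S xs\<close> have mean 0, so the mixed term of the
  square vanishes. A general centre \<open>a\<close> covers both the chain and its stationary version.
\<close>

lemma second_moment_step:
  assumes xs: "xs \<in> orderings n" and S: "S \<subseteq> {1..n}"
  shows "measure_pmf.expectation (shuffle_step n k xs) (\<lambda>x. (cmod (phase_sum S x - w * a))\<^sup>2)
    \<le> (cmod w)\<^sup>2 * (cmod (phase_sum S xs - a))\<^sup>2 + noise_bound"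
proof -
  let ?Z = "zone n k xs"
  define d where "d c = phase_sum S (to_top c xs) - w * phase_sum S xs" for c
  define b where "b = w * (phase_sum S xs - a)"
  have "measure_pmf.expectation (shuffle_step n k xs) (\<lambda>x. (cmod (phase_sum S x - w * a))\<^sup>2)
     = (\<Sum>c\<in>?Z. (cmod (d c + b))\<^sup>2) / k"
    unfolding expectation_shuffle_step[OF xs k1 kn] by (simp add: d_def b_def algebra_simps)
  also have "(\<Sum>c\<in>?Z. (cmod (d c + b))\<^sup>2) = (\<Sum>c\<in>?Z. (cmod (d c))\<^sup>2) + k * (cmod b)\<^sup>2"
    using sum_cmod_square_shift[of d ?Z b] phase_sum_increment_mean[OF xs S] card_zone[OF xs kn]
    by (simp add: d_def)
  also have "(\<Sum>c\<in>?Z. (cmod (d c))\<^sup>2) \<le> (\<Sum>c\<in>?Z. noise_bound)"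
    unfolding d_def by (intro sum_mono phase_sum_increment_bound[OF xs S])
  also have "(\<Sum>c\<in>?Z. noise_bound) = k * noise_bound" using card_zone[OF xs kn] by simp
  finally have "measure_pmf.expectation (shuffle_step n k xs) (\<lambda>x. (cmod (phase_sum S x - w * a))\<^sup>2)
      \<le> (k * noise_bound + k * (cmod b)\<^sup>2) / k"
    using k1 by (simp add: divide_right_mono)
  also have "\<dots> = (cmod b)\<^sup>2 + noise_bound" using k1 by (simp add: field_simps)
  finally show ?thesis by (simp only: b_def norm_mult power_mult_distrib)
qed

lemma variance_bound_eq: "(cmod w)\<^sup>2 * variance_bound + noise_bound = variance_bound"
  and variance_bound_nonneg: "0 \<le> variance_bound"
proof -
  have "(cmod w)\<^sup>2 < 1" using w_lt_1 by (simp add: abs_square_less_1)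
  then show "(cmod w)\<^sup>2 * variance_bound + noise_bound = variance_bound" "0 \<le> variance_bound"
    by (auto simp: variance_bound_def field_simps noise_bound_def)
qed

lemma second_moment_shuffle_law:
  assumes x0: "x0 \<in> orderings n" and S: "S \<subseteq> {1..n}"
  shows "measure_pmf.expectation (shuffle_law n k x0 t)
    (\<lambda>x. (cmod (phase_sum S x - w ^ t * phase_sum S x0))\<^sup>2) \<le> variance_bound"
proof (induction t)
  case 0
  then show ?case using variance_bound_nonneg by simp
next
  case (Suc t)
  let ?a = "w ^ t * phase_sum S x0"
  have sub: "set_pmf (shuffle_law n k x0 t) \<subseteq> orderings n"
    unfolding shuffle_law_eq_run using x0 by (intro set_run set_shuffle_step k1 kn) auto
  have "measure_pmf.expectation (shuffle_law n k x0 (Suc t)) (\<lambda>x. (cmod (phase_sum S x - w * ?a))\<^sup>2)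
     \<le> (cmod w)\<^sup>2 * measure_pmf.expectation (shuffle_law n k x0 t) (\<lambda>x. (cmod (phase_sum S x - ?a))\<^sup>2)
       + noise_bound"
    unfolding shuffle_law.simps
    by (rule expectation_step_affine[OF finite_orderings sub set_shuffle_step second_moment_step])
       (use k1 kn S in auto)
  also have "\<dots> \<le> (cmod w)\<^sup>2 * variance_bound + noise_bound"
    using Suc by (intro add_mono mult_left_mono) auto
  finally show ?case using variance_bound_eq by (simp add: mult.assoc)
qed

text \<open>
  Stationarity turns the recursion of the second moment into an inequality for the moment itself.
\<close>

lemma second_moment_uniform:
  assumes S: "S \<subseteq> {1..n}"
  shows "measure_pmf.expectation (pmf_of_set (orderings n)) (\<lambda>x. (cmod (phase_sum S x))\<^sup>2) \<le> variance_bound"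
proof -
  let ?u = "measure_pmf.expectation (pmf_of_set (orderings n)) (\<lambda>x. (cmod (phase_sum S x))\<^sup>2)"
  have "measure_pmf.expectation (bind_pmf (pmf_of_set (orderings n)) (shuffle_step n k))
      (\<lambda>x. (cmod (phase_sum S x))\<^sup>2) \<le> (cmod w)\<^sup>2 * ?u + noise_bound"
    by (rule expectation_step_affine[OF finite_orderings _ set_shuffle_step])
       (use k1 kn second_moment_step[OF _ S, where a = 0] in auto)
  then have "?u \<le> (cmod w)\<^sup>2 * ?u + noise_bound" by (simp add: uniform_stationary[OF k1 kn])
  moreover have "0 < 1 - (cmod w)\<^sup>2" using w_lt_1 by (simp add: abs_square_less_1)
  ultimately show ?thesis unfolding variance_bound_def by (simp add: field_simps)
qed

text \<open>
  By Chebyshev's inequality the statistic is within half of \<open>\<bar>w ^ t * phase_sum S x0\<bar>\<close> of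
  \<open>w ^ t * phase_sum S x0\<close> for the chain, and of 0 in stationarity, each with probability at least 3/4.
\<close>

lemma tv_dist_ge_half:
  assumes x0: "x0 \<in> orderings n" and S: "S \<subseteq> {1..n}"
    and L: "0 < cmod (w ^ t * phase_sum S x0)"
    and V: "16 * variance_bound \<le> (cmod (w ^ t * phase_sum S x0))\<^sup>2"
  shows "1 / 2 \<le> tv_dist (orderings n) (shuffle_law n k x0 t) (pmf_of_set (orderings n))"
proof -
  define a where "a = w ^ t * phase_sum S x0"
  define A where "A = {x. cmod (phase_sum S x) \<le> cmod a / 2}"
  define U where "U = pmf_of_set (orderings n)"
  have sub: "set_pmf (shuffle_law n k x0 t) \<subseteq> orderings n"
    unfolding shuffle_law_eq_run using x0 by (intro set_run set_shuffle_step k1 kn) auto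
  have sU: "set_pmf U \<subseteq> orderings n" by (simp add: U_def)
  have fin: "finite (set_pmf (shuffle_law n k x0 t))" "finite (set_pmf U)"
    using sub sU finite_orderings finite_subset by blast+
  have a: "0 < cmod a" using L by (simp add: a_def)
  have "(cmod a / 2)\<^sup>2 * measure_pmf.prob (shuffle_law n k x0 t) A
     \<le> measure_pmf.expectation (shuffle_law n k x0 t) (\<lambda>x. (cmod (phase_sum S x - a))\<^sup>2)"
  proof (rule markov_finite[OF fin(1)])
    fix x assume "x \<in> A"
    then have "cmod a / 2 \<le> cmod (phase_sum S x - a)"
      using norm_triangle_ineq2[of a "phase_sum S x"] by (simp add: A_def norm_minus_commute)
    then show "(cmod a / 2)\<^sup>2 \<le> (cmod (phase_sum S x - a))\<^sup>2" by (intro power_mono) auto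
  qed auto
  also have "\<dots> \<le> variance_bound" unfolding a_def by (rule second_moment_shuffle_law[OF x0 S])
  also have "\<dots> \<le> (cmod a / 2)\<^sup>2 * (1 / 4)" using V by (simp add: a_def power_divide)
  finally have 1: "measure_pmf.prob (shuffle_law n k x0 t) A \<le> 1 / 4"
    using a by (simp only: mult_le_cancel_left_pos zero_less_power half_gt_zero)
  have "(cmod a / 2)\<^sup>2 * measure_pmf.prob U (- A) \<le> measure_pmf.expectation U (\<lambda>x. (cmod (phase_sum S x))\<^sup>2)"
  proof (rule markov_finite[OF fin(2)])
    fix x assume "x \<in> - A"
    then show "(cmod a / 2)\<^sup>2 \<le> (cmod (phase_sum S x))\<^sup>2" by (intro power_mono) (auto simp: A_def)
  qed auto
  also have "\<dots> \<le> variance_bound" unfolding U_def by (rule second_moment_uniform[OF S])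
  also have "\<dots> \<le> (cmod a / 2)\<^sup>2 * (1 / 4)" using V by (simp add: a_def power_divide)
  finally have U_far: "measure_pmf.prob U (- A) \<le> 1 / 4"
    using a by (simp only: mult_le_cancel_left_pos zero_less_power half_gt_zero)
  have "measure_pmf.prob (shuffle_law n k x0 t) (- A) - measure_pmf.prob U (- A)
     \<le> tv_dist (orderings n) (shuffle_law n k x0 t) U"
    by (intro tv_dist_ge_event sub sU) simp
  moreover have "measure_pmf.prob (shuffle_law n k x0 t) (- A) = 1 - measure_pmf.prob (shuffle_law n k x0 t) A"
    using measure_pmf.prob_compl[of A "shuffle_law n k x0 t"] by (simp add: Compl_eq_Diff_UNIV)
  ultimately show ?thesis using 1 U_far by (simp add: U_def)
qed

end

section \<open>The eigenvalue near exp (2 * pi * i / n)\<close>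

lemma exp_approx_quadratic:
  fixes z :: complex
  assumes "cmod z \<le> 1 / 2"
  shows "cmod (exp z - (1 + z + z\<^sup>2 / 2)) \<le> cmod z ^ 3"
proof -
  have "(\<Sum>i\<le>2. z ^ i / fact i) = 1 + z + z\<^sup>2 / 2"
    by (simp add: eval_nat_numeral)
  then have "cmod (exp z - (1 + z + z\<^sup>2 / 2)) \<le> exp (cmod z) * cmod z ^ 3 / 2"
    using Taylor_exp_field[of z 2] by (simp add: eval_nat_numeral)
  also have "\<dots> \<le> 2 * cmod z ^ 3 / 2"
  proof (intro divide_right_mono mult_right_mono)
    have "exp (cmod z) \<le> exp (1 / 2)" using assms by simp
    then show "exp (cmod z) \<le> 2" using exp_half_le2 by linarith
  qed auto
  finally show ?thesis by simp
qed

lemma exp_minus_1_bound: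
  fixes z :: complex
  assumes "cmod z \<le> 1 / 2"
  shows "cmod (exp z - 1 - z) \<le> (cmod z)\<^sup>2" "cmod (exp z - 1) \<le> 2 * cmod z"
proof -
  have x: "cmod z ^ 3 \<le> (cmod z)\<^sup>2 / 2" "(cmod z)\<^sup>2 \<le> cmod z / 2"
    using mult_left_mono[OF assms, of "(cmod z)\<^sup>2"] mult_left_mono[OF assms, of "cmod z"]
    by (simp_all add: power2_eq_square power3_eq_cube)
  have "exp z - 1 - z = (exp z - (1 + z + z\<^sup>2 / 2)) + z\<^sup>2 / 2" by simp
  then have "cmod (exp z - 1 - z) \<le> cmod (exp z - (1 + z + z\<^sup>2 / 2)) + cmod (z\<^sup>2 / 2)"
    by (metis norm_triangle_ineq)
  also have "\<dots> \<le> cmod z ^ 3 + (cmod z)\<^sup>2 / 2"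
    using exp_approx_quadratic[OF assms] by (simp add: norm_divide norm_power)
  also have "\<dots> \<le> (cmod z)\<^sup>2" using x by simp
  finally show 1: "cmod (exp z - 1 - z) \<le> (cmod z)\<^sup>2" .
  have "cmod (exp z - 1) \<le> cmod (exp z - 1 - z) + cmod z"
    using norm_triangle_ineq[of "exp z - 1 - z" z] by simp
  also have "\<dots> \<le> 2 * cmod z" using 1 x norm_ge_zero[of z] by linarith
  finally show "cmod (exp z - 1) \<le> 2 * cmod z" .
qed

text \<open>
  Inverting the quadratic approximation of the exponential at \<open>l = Ln (1 + u)\<close>.
\<close>

lemma Ln_approx_quadratic:
  fixes u :: complex
  assumes "cmod u \<le> 1 / 4"
  shows "cmod (Ln (1 + u) - (u - u\<^sup>2 / 2)) \<le> 11 * cmod u ^ 3"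
proof -
  define l where "l = Ln (1 + u)"
  have u1: "cmod u < 1 / 2" using assms by simp
  have "1 + u \<noteq> 0"
  proof
    assume "1 + u = 0"
    then have "u = - 1" by (metis add_eq_0_iff)
    then show False using u1 by simp
  qed
  then have el: "exp l = 1 + u" by (simp add: l_def)
  have l2: "cmod l \<le> 2 * cmod u" unfolding l_def by (rule norm_Ln_le[OF u1])
  then have lh: "cmod l \<le> 1 / 2" using assms by simp
  have lu: "cmod (l - u) \<le> 2 * (cmod u)\<^sup>2"
  proof -
    have "cmod (l - u) \<le> (cmod u)\<^sup>2 / (1 - cmod u)" unfolding l_def using u1 by (intro Ln_approx_linear) simp
    also have "\<dots> \<le> (cmod u)\<^sup>2 / (1 / 2)" using u1 by (intro divide_left_mono) auto
    finally show ?thesis by simp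
  qed
  have "l\<^sup>2 - u\<^sup>2 = (l - u) * (l + u)" by (simp add: power2_eq_square algebra_simps)
  then have "cmod (l\<^sup>2 - u\<^sup>2) = cmod (l - u) * cmod (l + u)" by (simp add: norm_mult)
  also have "\<dots> \<le> 2 * (cmod u)\<^sup>2 * (3 * cmod u)"
  proof (rule mult_mono[OF lu])
    show "cmod (l + u) \<le> 3 * cmod u" using norm_triangle_ineq[of l u] l2 by simp
  qed auto
  finally have sq: "cmod ((l\<^sup>2 - u\<^sup>2) / 2) \<le> 3 * cmod u ^ 3"
    by (simp add: norm_divide power2_eq_square power3_eq_cube)
  have "cmod (exp l - (1 + l + l\<^sup>2 / 2)) \<le> cmod l ^ 3" by (rule exp_approx_quadratic[OF lh])
  also have "\<dots> \<le> (2 * cmod u) ^ 3" using l2 by (intro power_mono) auto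
  finally have ex: "cmod (exp l - (1 + l + l\<^sup>2 / 2)) \<le> 8 * cmod u ^ 3" by (simp add: power_mult_distrib)
  have "l - (u - u\<^sup>2 / 2) = - (exp l - (1 + l + l\<^sup>2 / 2)) - (l\<^sup>2 - u\<^sup>2) / 2"
    unfolding el by (simp add: field_simps)
  then have "cmod (l - (u - u\<^sup>2 / 2)) \<le> cmod (exp l - (1 + l + l\<^sup>2 / 2)) + cmod ((l\<^sup>2 - u\<^sup>2) / 2)"
    using norm_triangle_ineq4[of "- (exp l - (1 + l + l\<^sup>2 / 2))" "(l\<^sup>2 - u\<^sup>2) / 2"] by (metis norm_minus_cancel)
  then show ?thesis using ex sq by (simp add: l_def)
qed

text \<open>
  For \<open>w = exp z\<close> the eigenvalue equation follows from \<open>n * z = 2 * pi * \<i> + log_defect k z\<close>. The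
  defect is quadratic in \<open>z\<close>, because \<open>k * z\<close> is the linear part of the logarithm.
\<close>

definition log_defect :: "nat \<Rightarrow> complex \<Rightarrow> complex" where
  "log_defect k z = of_nat k * z - Ln (1 + of_nat k * (exp z - 1))"

text \<open>
  With \<open>u = k * (exp z - 1)\<close>, the defect is \<open>k * z - u + u\<^sup>2 / 2\<close> up to third order; here \<open>k * z - u\<close>
  contributes \<open>- k * z\<^sup>2 / 2\<close> and \<open>u\<^sup>2 / 2\<close> contributes \<open>k\<^sup>2 * z\<^sup>2 / 2\<close>. The factor \<open>k * (k - 1)\<close> of the mixing
  time comes from this sum.
\<close>

lemma log_defect_approx:
  assumes k: "1 \<le> k" and z: "8 * (real k * cmod z) \<le> 1"
  shows "cmod (log_defect k z - of_nat k * (of_nat k - 1) * z\<^sup>2 / 2) \<le> 91 * (real k * cmod z) ^ 3"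
    and "cmod (of_nat k * (exp z - 1)) \<le> 1 / 4"
proof -
  define x where "x = cmod z"
  define K where "K = real k"
  define u where "u = of_nat k * (exp z - 1)"
  have K: "1 \<le> K" and x0: "0 \<le> x" using k by (auto simp: K_def x_def)
  have "1 * x \<le> K * x" using K x0 by (intro mult_right_mono) auto
  then have zh: "cmod z \<le> 1 / 2" using z by (simp add: x_def K_def)
  have u2: "cmod u \<le> 2 * (K * x)"
    using mult_left_mono[OF exp_minus_1_bound(2)[OF zh], of K] K by (simp add: u_def norm_mult K_def x_def mult_ac)
  then show u4: "cmod (of_nat k * (exp z - 1)) \<le> 1 / 4" using z by (simp add: K_def x_def u_def)
  have e1: "cmod (Ln (1 + u) - (u - u\<^sup>2 / 2)) \<le> 88 * (K * x) ^ 3"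
  proof -
    have "cmod (Ln (1 + u) - (u - u\<^sup>2 / 2)) \<le> 11 * cmod u ^ 3" using u4 by (intro Ln_approx_quadratic) (simp add: u_def)
    also have "\<dots> \<le> 11 * (2 * (K * x)) ^ 3" using u2 by (intro mult_left_mono power_mono) auto
    finally show ?thesis by (simp add: power_mult_distrib)
  qed
  have K3: "K \<le> K ^ 3" "K\<^sup>2 \<le> K ^ 3" using K power_increasing[of 1 3 K] power_increasing[of 2 3 K] by auto
  have e2: "cmod (of_nat k * (exp z - (1 + z + z\<^sup>2 / 2))) \<le> (K * x) ^ 3"
  proof -
    have "cmod (of_nat k * (exp z - (1 + z + z\<^sup>2 / 2))) \<le> K * x ^ 3"
      using mult_left_mono[OF exp_approx_quadratic[OF zh], of K] K by (simp add: norm_mult K_def x_def)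
    also have "\<dots> \<le> K ^ 3 * x ^ 3" using K3 x0 by (intro mult_right_mono) auto
    finally show ?thesis by (simp add: power_mult_distrib)
  qed
  have e3: "cmod ((u\<^sup>2 - (of_nat k * z)\<^sup>2) / 2) \<le> 2 * (K * x) ^ 3"
  proof -
    have a: "cmod (u - of_nat k * z) \<le> K * x\<^sup>2"
    proof -
      have "u - of_nat k * z = of_nat k * (exp z - 1 - z)" by (simp add: u_def algebra_simps)
      then have "cmod (u - of_nat k * z) = K * cmod (exp z - 1 - z)" by (simp add: norm_mult K_def)
      then show ?thesis using mult_left_mono[OF exp_minus_1_bound(1)[OF zh], of K] K by (simp add: x_def)
    qed
    have b: "cmod (u + of_nat k * z) \<le> 3 * (K * x)"
      using norm_triangle_ineq[of u "of_nat k * z"] u2 by (simp add: norm_mult K_def x_def)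
    have "u\<^sup>2 - (of_nat k * z)\<^sup>2 = (u - of_nat k * z) * (u + of_nat k * z)"
      by (simp add: power2_eq_square algebra_simps)
    then have "cmod (u\<^sup>2 - (of_nat k * z)\<^sup>2) \<le> (K * x\<^sup>2) * (3 * (K * x))"
      using mult_mono[OF a b] K by (simp add: norm_mult)
    also have "\<dots> = 3 * (K\<^sup>2 * x ^ 3)" by (simp add: power2_eq_square power3_eq_cube)
    also have "\<dots> \<le> 3 * (K ^ 3 * x ^ 3)" using K3 x0 by (intro mult_left_mono mult_right_mono) auto
    finally have "cmod (u\<^sup>2 - (of_nat k * z)\<^sup>2) \<le> 3 * (K * x) ^ 3" by (simp only: power_mult_distrib)
    moreover have "0 \<le> (K * x) ^ 3" using x0 K by simp
    moreover have "cmod ((u\<^sup>2 - (of_nat k * z)\<^sup>2) / 2) = cmod (u\<^sup>2 - (of_nat k * z)\<^sup>2) / 2"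
      by (simp add: norm_divide)
    ultimately show ?thesis by linarith
  qed
  have "log_defect k z - of_nat k * (of_nat k - 1) * z\<^sup>2 / 2
     = - (Ln (1 + u) - (u - u\<^sup>2 / 2)) - of_nat k * (exp z - (1 + z + z\<^sup>2 / 2)) + (u\<^sup>2 - (of_nat k * z)\<^sup>2) / 2"
    unfolding log_defect_def u_def[symmetric]
    by (simp add: field_simps power2_eq_square) (simp add: u_def algebra_simps)
  also have "cmod \<dots> \<le> cmod (Ln (1 + u) - (u - u\<^sup>2 / 2)) + cmod (of_nat k * (exp z - (1 + z + z\<^sup>2 / 2)))
      + cmod ((u\<^sup>2 - (of_nat k * z)\<^sup>2) / 2)"
  proof -
    have "cmod (- a - b + c) \<le> cmod a + cmod b + cmod c" for a b c :: complex
      using norm_triangle_ineq[of "- a - b" c] norm_triangle_ineq4[of "- a" b] by simp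
    then show ?thesis .
  qed
  also have "\<dots> \<le> 91 * (K * x) ^ 3" using e1 e2 e3 by simp
  finally show "cmod (log_defect k z - of_nat k * (of_nat k - 1) * z\<^sup>2 / 2) \<le> 91 * (real k * cmod z) ^ 3"
    by (simp add: K_def x_def)
qed

lemma log_defect_bound:
  assumes k: "1 \<le> k" and z: "8 * (real k * cmod z) \<le> 1"
  shows "cmod (log_defect k z) \<le> 12 * (real k * cmod z)\<^sup>2"
proof -
  define y where "y = real k * cmod z"
  have y: "0 \<le> y" "8 * y \<le> 1" using z by (auto simp: y_def)
  have "cmod (log_defect k z) \<le> cmod (log_defect k z - of_nat k * (of_nat k - 1) * z\<^sup>2 / 2)
      + cmod (of_nat k * (of_nat k - 1) * z\<^sup>2 / 2)"
    by (metis diff_add_cancel norm_triangle_ineq)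
  also have "\<dots> \<le> 91 * y ^ 3 + y\<^sup>2 / 2"
  proof (rule add_mono)
    have "of_nat k * (of_nat k - 1) * z\<^sup>2 / 2 = of_real (real k * (real k - 1) / 2) * z\<^sup>2" by simp
    then have "cmod (of_nat k * (of_nat k - 1) * z\<^sup>2 / 2) = \<bar>real k * (real k - 1) / 2\<bar> * (cmod z)\<^sup>2"
      by (simp only: norm_mult norm_of_real norm_power)
    also have "\<dots> = real k * (real k - 1) * (cmod z)\<^sup>2 / 2" using k by simp
    also have "\<dots> \<le> real k * real k * (cmod z)\<^sup>2 / 2"
      using k by (intro divide_right_mono mult_right_mono mult_left_mono) auto
    finally show "cmod (of_nat k * (of_nat k - 1) * z\<^sup>2 / 2) \<le> y\<^sup>2 / 2"
      by (simp add: y_def power2_eq_square mult_ac)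
  qed (use log_defect_approx(1)[OF k z] in \<open>simp add: y_def\<close>)
  also have "\<dots> \<le> 12 * y\<^sup>2"
  proof -
    have "y ^ 3 \<le> y\<^sup>2 / 8"
      using mult_left_mono[OF y(2), of "y\<^sup>2"] by (simp add: power2_eq_square power3_eq_cube mult_ac)
    moreover have "0 \<le> y\<^sup>2" by simp
    ultimately show ?thesis by linarith
  qed
  finally show ?thesis by (simp add: y_def)
qed

text \<open>
  On the ball of radius \<open>8 / n\<close> the defect is at most 1 in modulus, and \<open>2 * pi + 1 \<le> 8\<close>, so the
  fixed point equation maps the ball into itself.
\<close>

lemma eigenvalue_exists:
  assumes k: "1 \<le> k" and kn: "64 * k \<le> n"
  obtains z where "cmod z \<le> 8 / real n" and "of_nat n * z = 2 * of_real pi * \<i> + log_defect k z"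
    and "exp z ^ (n - k) * (of_nat k * exp z - of_nat (k - 1)) = 1"
proof -
  have n: "0 < real n" using assms by simp
  define S where "S = cball (0 :: complex) (8 / real n)"
  define T where "T z = (2 * of_real pi * \<i> + log_defect k z) / of_nat n" for z
  have small: "8 * (real k * cmod z) \<le> 1" if "z \<in> S" for z
  proof -
    have "cmod z \<le> 8 / real n" using that by (simp add: S_def)
    then have "real k * cmod z \<le> real k * (8 / real n)" by (intro mult_left_mono) auto
    also have "\<dots> \<le> 1 / 8" using kn n by (simp add: field_simps)
    finally show ?thesis by simp
  qed
  have nz: "1 + of_nat k * (exp z - 1) \<notin> \<real>\<^sub>\<le>\<^sub>0" if "z \<in> S" for z
  proof -
    have "cmod (of_nat k * (exp z - 1)) \<le> 1 / 4" using log_defect_approx(2)[OF k small[OF that]] .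
    then have "\<bar>Re (of_nat k * (exp z - 1))\<bar> \<le> 1 / 4" using abs_Re_le_cmod order_trans by blast
    then show ?thesis by (auto simp: complex_nonpos_Reals_iff)
  qed
  obtain z where z: "z \<in> S" "T z = z"
  proof (rule brouwer[of S T])
    show "compact S" "convex S" "S \<noteq> {}" by (simp_all add: S_def)
    show "continuous_on S T" unfolding T_def log_defect_def using nz n by (intro continuous_intros) auto
    show "T \<in> S \<rightarrow> S"
    proof
      fix z assume z: "z \<in> S"
      have "cmod (log_defect k z) \<le> 12 * (real k * cmod z)\<^sup>2" by (rule log_defect_bound[OF k small[OF z]])
      also have "\<dots> \<le> 12 * (1 / 8)\<^sup>2" using small[OF z] by (intro mult_left_mono power_mono) auto
      finally have "cmod (log_defect k z) \<le> 1" by (simp add: power2_eq_square)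
      then have "cmod (2 * of_real pi * \<i> + log_defect k z) \<le> 2 * pi + 1"
        using norm_triangle_ineq[of "2 * of_real pi * \<i>" "log_defect k z"] by (simp add: norm_mult)
      also have "\<dots> \<le> 8" using pi_less_4 pi_approx by simp
      finally show "T z \<in> S" using n by (simp add: S_def T_def norm_divide divide_right_mono)
    qed
  qed
  have eq: "of_nat n * z = 2 * of_real pi * \<i> + log_defect k z"
    using z(2) n by (simp add: T_def field_simps)
  define u where "u = 1 + of_nat k * (exp z - 1)"
  have u0: "u \<noteq> 0" using nz[OF z(1)] by (auto simp: u_def)
  have "exp (of_nat n * z) = exp (of_nat k * z) / u"
    unfolding eq log_defect_def u_def[symmetric] using u0 by (simp add: exp_add exp_diff mult.commute)
  moreover have "exp (of_nat n * z) = exp (of_nat k * z) * exp z ^ (n - k)"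
    using kn by (simp flip: exp_of_nat_mult exp_add add: of_nat_diff algebra_simps)
  ultimately have "exp z ^ (n - k) * u = 1" using u0 by (simp add: field_simps)
  moreover have "u = of_nat k * exp z - of_nat (k - 1)" using k by (simp add: u_def of_nat_diff algebra_simps)
  ultimately show thesis using that[of z] eq z(1) by (simp add: S_def)
qed

text \<open>
  To leading order \<open>n * z = 2 * pi * \<i>\<close>; inserting this into the quadratic term of the defect gives the
  real part of \<open>n * z\<close> as \<open>- 2 * pi\<^sup>2 * k * (k - 1) / n\<^sup>2\<close>, with relative error \<open>O(k / n)\<close>.
\<close>

lemma eigenvalue_size:
  assumes k: "2 \<le> k" and kn: "64 * k \<le> n"
    and z: "cmod z \<le> 8 / real n" and eq: "of_nat n * z = 2 * of_real pi * \<i> + log_defect k z"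
  defines "\<kappa> \<equiv> real k / real n"
  shows "\<bar>real n ^ 3 * (- Re z) - 2 * pi\<^sup>2 * (real k * (real k - 1))\<bar> \<le> 94000 * \<kappa> * (real k * (real k - 1))"
    and "\<bar>real n * Im z - 2 * pi\<bar> \<le> 1"
proof -
  define h where "h = log_defect k z"
  define P where "P = real k * (real k - 1)"
  have n: "0 < real n" using assms by simp
  have k1: "1 \<le> k" using k by simp
  have \<kappa>: "0 \<le> \<kappa>" "64 * \<kappa> \<le> 1" using kn n by (auto simp: \<kappa>_def field_simps)
  have y: "real k * cmod z \<le> 8 * \<kappa>" using mult_left_mono[OF z, of "real k"] by (simp add: \<kappa>_def mult.commute)
  then have y8: "8 * (real k * cmod z) \<le> 1" using \<kappa> by simp
  have "cmod h \<le> 12 * (real k * cmod z)\<^sup>2" unfolding h_def by (rule log_defect_bound[OF k1 y8])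
  also have "\<dots> \<le> 12 * (8 * \<kappa>)\<^sup>2" using y by (intro mult_left_mono power_mono) auto
  finally have h: "cmod h \<le> 768 * \<kappa>\<^sup>2" by (simp add: power_mult_distrib)
  have \<kappa>2: "\<kappa>\<^sup>2 \<le> \<kappa> / 64" using mult_left_mono[OF \<kappa>(2) \<kappa>(1)] by (simp add: power2_eq_square)
  have h1: "cmod h \<le> 1" using h \<kappa>2 \<kappa>(2) by linarith
  have "real n * Im z = 2 * pi + Im h" using arg_cong[OF eq, of Im] by (simp add: h_def)
  then show "\<bar>real n * Im z - 2 * pi\<bar> \<le> 1" using abs_Im_le_cmod[of h] h1 by simp
  have Re: "real n * Re z = Re h" using arg_cong[OF eq, of Re] by (simp add: h_def)
  have "cmod (h - of_nat k * (of_nat k - 1) * z\<^sup>2 / 2) \<le> 91 * (real k * cmod z) ^ 3"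
    unfolding h_def by (rule log_defect_approx(1)[OF k1 y8])
  also have "\<dots> \<le> 91 * (8 * \<kappa>) ^ 3" using y by (intro mult_left_mono power_mono) auto
  finally have e: "cmod (h - of_nat k * (of_nat k - 1) * z\<^sup>2 / 2) \<le> 46592 * \<kappa> ^ 3" by (simp add: power_mult_distrib)
  have PZ: "of_nat k * (of_nat k - 1) * z\<^sup>2 / 2 = of_real (P / 2) * z\<^sup>2" by (simp add: P_def)
  have "Re (h - of_nat k * (of_nat k - 1) * z\<^sup>2 / 2) = real n * Re z - P / 2 * Re (z\<^sup>2)"
    unfolding PZ using Re by simp
  then have e1: "\<bar>real n * Re z - P / 2 * Re (z\<^sup>2)\<bar> \<le> 46592 * \<kappa> ^ 3"
    using e abs_Re_le_cmod order_trans by metis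
  have "of_real ((real n)\<^sup>2) * z\<^sup>2 = (of_nat n * z)\<^sup>2" by (simp add: power_mult_distrib)
  also have "\<dots> = of_real (- 4 * pi\<^sup>2) + (4 * of_real pi * \<i> * h + h\<^sup>2)"
    unfolding eq h_def[symmetric] by (simp add: power2_eq_square algebra_simps)
  finally have "Re (of_real ((real n)\<^sup>2) * z\<^sup>2) = Re (of_real (- 4 * pi\<^sup>2) + (4 * of_real pi * \<i> * h + h\<^sup>2))" by simp
  then have R2: "(real n)\<^sup>2 * Re (z\<^sup>2) = - 4 * pi\<^sup>2 + Re (4 * of_real pi * \<i> * h + h\<^sup>2)"
    by (simp only: Re_complex_of_real plus_complex.sel Re_divide_of_real scaleR_complex.sel
        flip: scaleR_conv_of_real)
  have "\<bar>Re (4 * of_real pi * \<i> * h + h\<^sup>2)\<bar> \<le> cmod (4 * of_real pi * \<i> * h + h\<^sup>2)" by (rule abs_Re_le_cmod)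
  also have "\<dots> \<le> cmod (4 * of_real pi * \<i> * h) + cmod (h\<^sup>2)" by (rule norm_triangle_ineq)
  also have "\<dots> = 4 * pi * cmod h + cmod h * cmod h" by (simp add: norm_mult norm_power power2_eq_square)
  also have "\<dots> \<le> 16 * cmod h + 1 * cmod h"
    using pi_less_4 h1 by (intro add_mono mult_right_mono) auto
  also have "\<dots> \<le> 13056 * \<kappa>\<^sup>2" using h by simp
  finally have d: "\<bar>(real n)\<^sup>2 * Re (z\<^sup>2) + 4 * pi\<^sup>2\<bar> \<le> 13056 * \<kappa>\<^sup>2" using R2 by simp
  have P: "0 \<le> P" "(real k)\<^sup>2 \<le> 2 * P" using k by (auto simp: P_def power2_eq_square algebra_simps)
  have kn2: "\<kappa> ^ 3 * (real n)\<^sup>2 = \<kappa> * (real k)\<^sup>2" using n by (simp add: \<kappa>_def power2_eq_square power3_eq_cube)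
  define X where "X = real n * Re z - P / 2 * Re (z\<^sup>2)"
  define Y where "Y = (real n)\<^sup>2 * Re (z\<^sup>2) + 4 * pi\<^sup>2"
  have "real n ^ 3 * (- Re z) - 2 * pi\<^sup>2 * P = - ((real n)\<^sup>2 * X) - P / 2 * Y"
    by (simp add: X_def Y_def power2_eq_square power3_eq_cube algebra_simps)
  then have "\<bar>real n ^ 3 * (- Re z) - 2 * pi\<^sup>2 * P\<bar> \<le> \<bar>(real n)\<^sup>2 * X\<bar> + \<bar>P / 2 * Y\<bar>" by linarith
  also have "\<bar>(real n)\<^sup>2 * X\<bar> = (real n)\<^sup>2 * \<bar>X\<bar>" by (simp add: abs_mult)
  also have "\<dots> \<le> (real n)\<^sup>2 * (46592 * \<kappa> ^ 3)" using e1 by (intro mult_left_mono) (auto simp: X_def)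
  also have "\<dots> = 46592 * (\<kappa> * (real k)\<^sup>2)" using kn2 by (simp add: mult_ac)
  also have "\<dots> \<le> 46592 * (\<kappa> * (2 * P))" using P(2) \<kappa> by (intro mult_left_mono) auto
  also have "\<bar>P / 2 * Y\<bar> = P / 2 * \<bar>Y\<bar>" using P by (simp add: abs_mult)
  also have "\<dots> \<le> P / 2 * (13056 * (\<kappa> / 64))" using d \<kappa>2 P by (intro mult_left_mono) (auto simp: Y_def)
  finally have "\<bar>real n ^ 3 * (- Re z) - 2 * pi\<^sup>2 * P\<bar> \<le> 46592 * (\<kappa> * (2 * P)) + P / 2 * (13056 * (\<kappa> / 64))" by simp
  also have "\<dots> = 93286 * (\<kappa> * P)" by (simp add: algebra_simps)
  also have "\<dots> \<le> 94000 * (\<kappa> * P)" using P \<kappa> by (intro mult_right_mono) auto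
  finally show "\<bar>real n ^ 3 * (- Re z) - 2 * pi\<^sup>2 * (real k * (real k - 1))\<bar> \<le> 94000 * \<kappa> * (real k * (real k - 1))"
    by (simp add: P_def)
qed

lemma depth_identity:
  assumes "c \<in> {1..n}"
  shows "depth N [1..<Suc n] c = min N (c - 1)"
proof -
  have "[1..<Suc n] ! (c - 1) = c" using assms by (subst nth_upt) auto
  then have "takeWhile (\<lambda>d. d \<noteq> c) [1..<Suc n] = take (c - 1) [1..<Suc n]"
    using takeWhile_neq_nth[of "[1..<Suc n]" "c - 1"] assms by (simp del: upt_Suc add: less_eq_Suc_le)
  then show ?thesis using assms by (simp add: depth_def del: upt_Suc)
qed

text \<open>
  The observed cards are the upper half of the initial deck. Their powers of \<open>w\<close> run through about
  half of the unit circle, so they add up to order \<open>n\<close>. The variance bound is of order \<open>n\<close> as well,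
  and the constant 22 in the exponent absorbs the ratio of the two constants.
\<close>

lemma tv_dist_ge_half_identity:
  assumes k: "2 \<le> k" and large: "94000 * k \<le> n"
    and t: "real t * ((4 * pi\<^sup>2 + 188000 * (real k / real n)) * (real k * (real k - 1)))
      \<le> real n ^ 3 * (ln (real n) - 22)"
  shows "1 / 2 \<le> tv_dist (orderings n) (shuffle_law n k [1..<Suc n] t) (pmf_of_set (orderings n))"
proof -
  define \<kappa> where "\<kappa> = real k / real n"
  define P where "P = real k * (real k - 1)"
  have n: "0 < real n" using assms by simp
  have k1: "1 \<le> k" "k \<le> n" and kn64: "64 * k \<le> n" using k large by simp_all
  have \<kappa>: "0 < \<kappa>" "94000 * \<kappa> \<le> 1" using k large n by (auto simp: \<kappa>_def field_simps)
  have P: "0 < P" "(real k)\<^sup>2 \<le> 2 * P" "P \<le> (real k)\<^sup>2" using k by (auto simp: P_def power2_eq_square algebra_simps)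
  obtain z where z: "cmod z \<le> 8 / real n" "of_nat n * z = 2 * of_real pi * \<i> + log_defect k z"
    "exp z ^ (n - k) * (of_nat k * exp z - of_nat (k - 1)) = 1"
    using eigenvalue_exists[OF k1(1) kn64] .
  define \<beta> where "\<beta> = - Re z"
  define w where "w = exp z"
  have size: "\<bar>real n ^ 3 * \<beta> - 2 * pi\<^sup>2 * P\<bar> \<le> 94000 * \<kappa> * P" "\<bar>real n * Im z - 2 * pi\<bar> \<le> 1"
    using eigenvalue_size[OF k kn64 z(1,2)] by (simp_all add: \<beta>_def \<kappa>_def P_def)
  have \<kappa>P: "94000 * \<kappa> * P \<le> P" using mult_right_mono[OF \<kappa>(2), of P] P by simp
  have pi9: "9 \<le> pi\<^sup>2" "pi\<^sup>2 \<le> 16"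
    using pi_gt3 pi_less_4 power_mono[of 3 pi 2] power_mono[of pi 4 2] by auto
  have "9 * P \<le> pi\<^sup>2 * P" "pi\<^sup>2 * P \<le> 16 * P" using pi9 P by (auto intro: mult_right_mono)
  then have n\<beta>: "17 * P \<le> real n ^ 3 * \<beta>" "real n ^ 3 * \<beta> \<le> 33 * P" using size(1) \<kappa>P by linarith+
  have \<beta>0: "0 < \<beta>"
  proof -
    have "0 < real n ^ 3 * \<beta>" using n\<beta>(1) P by linarith
    then show ?thesis using n by (simp add: zero_less_mult_iff)
  qed
  have cw: "cmod w = exp (- \<beta>)" by (simp add: w_def \<beta>_def)
  interpret phase_eigenvalue n k w
    by unfold_locales (use k1 z(3) \<beta>0 cw in \<open>auto simp: w_def\<close>)
  have "16 \<le> n" using large k by linarith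
  then have "8 / real n \<le> 8 / 16" using n by (intro divide_left_mono) auto
  then have zh: "cmod z \<le> 1 / 2" using z(1) by simp
  have gap: "cmod (1 - w) \<le> 16 / real n"
    using exp_minus_1_bound(2)[OF zh] z(1) by (simp add: w_def norm_minus_commute)
  have \<beta>1: "2 * \<beta> \<le> 1"
  proof -
    have "real n ^ 3 * (2 * \<beta>) \<le> 66 * (real k)\<^sup>2"
      using n\<beta>(2) P(3) by (simp only: mult.left_commute[of _ 2])
    also have "\<dots> \<le> 66 * (real n)\<^sup>2" using kn by (intro mult_left_mono power_mono) auto
    also have "\<dots> \<le> real n * (real n)\<^sup>2" using large k by (intro mult_right_mono) auto
    finally have "real n ^ 3 * (2 * \<beta>) \<le> real n ^ 3 * 1" by (simp add: power2_eq_square power3_eq_cube)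
    then show ?thesis using n by (simp only: mult_le_cancel_left_pos zero_less_power)
  qed
  have V: "variance_bound \<le> 1024 * real n"
  proof -
    have "noise_bound \<le> (2 * real k * (16 / real n))\<^sup>2"
      unfolding noise_bound_def using gap by (intro power_mono mult_left_mono) auto
    also have "\<dots> = 1024 * \<kappa>\<^sup>2" by (simp add: \<kappa>_def power_mult_distrib power_divide)
    finally have nb: "noise_bound \<le> 1024 * \<kappa>\<^sup>2" .
    have "(cmod w)\<^sup>2 = exp (- (2 * \<beta>))" by (simp add: cw power2_eq_square flip: exp_add)
    also have "\<dots> \<le> 1 / (1 + 2 * \<beta>)"
      using exp_ge_add_one_self[of "2 * \<beta>"] \<beta>0 by (simp add: exp_minus divide_simps)
    also have "\<dots> \<le> 1 - \<beta>"
    proof -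
      have "\<beta> * (2 * \<beta>) \<le> \<beta> * 1" using \<beta>1 \<beta>0 by (intro mult_left_mono) auto
      then have "1 \<le> (1 - \<beta>) * (1 + 2 * \<beta>)" by (simp add: algebra_simps)
      then show ?thesis using \<beta>0 by (simp add: divide_le_eq)
    qed
    finally have "\<beta> \<le> 1 - (cmod w)\<^sup>2" by simp
    moreover have "\<kappa>\<^sup>2 / real n \<le> \<beta>"
    proof -
      have "real n ^ 3 * (\<kappa>\<^sup>2 / real n) = (real k)\<^sup>2" using n by (simp add: \<kappa>_def power2_eq_square power3_eq_cube)
      also have "\<dots> \<le> real n ^ 3 * \<beta>" using n\<beta>(1) P by linarith
      finally show ?thesis using n by (simp only: mult_le_cancel_left_pos zero_less_power)
    qed
    ultimately have den: "\<kappa>\<^sup>2 / real n \<le> 1 - (cmod w)\<^sup>2" by simp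
    have "variance_bound \<le> (1024 * \<kappa>\<^sup>2) / (\<kappa>\<^sup>2 / real n)"
      unfolding variance_bound_def using nb den \<kappa> n by (intro frac_le) auto
    also have "\<dots> = 1024 * real n" using \<kappa> n by simp
    finally show ?thesis .
  qed
  define m where "m = n div 2"
  have m: "m \<le> n - k" "real m \<le> real n / 2" "(real n - 1) / 2 \<le> real m" using large k by (auto simp: m_def)
  have phi0: "phase_sum {1..m} [1..<Suc n] = (\<Sum>i<m. w ^ i)"
  proof -
    have "phase_sum {1..m} [1..<Suc n] = (\<Sum>c\<in>{1..m}. w ^ (c - 1))"
      unfolding phase_sum_def
    proof (rule sum.cong[OF refl])
      fix c assume "c \<in> {1..m}"
      then show "w ^ depth (n - k) [1..<Suc n] c = w ^ (c - 1)"
        using m(1) by (subst depth_identity) auto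
    qed
    also have "\<dots> = (\<Sum>i<m. w ^ i)" by (simp add: sum.atLeast1_atMost_eq)
    finally show ?thesis .
  qed
  \<comment> \<open>The argument of \<open>w ^ m\<close> is close to \<open>pi\<close>, hence its real part is not positive.\<close>
  have far: "1 \<le> cmod (1 - w ^ m)"
  proof -
    define a where "a = real m * Im z"
    have "w ^ m = exp (of_nat m * z)" by (simp add: w_def exp_of_nat_mult)
    then have "Re (w ^ m) = exp (real m * Re z) * cos a" by (simp add: Re_exp a_def)
    have nI: "5 \<le> real n * Im z" "real n * Im z \<le> 2 * pi + 1" using size(2) pi_gt3 by linarith+
    then have I0: "0 \<le> Im z" using n by (smt (verit) mult_pos_neg)
    have "a \<le> (real n / 2) * Im z" unfolding a_def using m I0 by (intro mult_right_mono) auto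
    then have a1: "a \<le> pi + 1 / 2" using nI by simp
    have "Im z \<le> 1 / 2" using zh abs_Im_le_cmod[of z] by linarith
    have "(real n - 1) / 2 * Im z \<le> a" unfolding a_def using m I0 by (intro mult_right_mono) auto
    then have "2 \<le> a" using nI(1) \<open>Im z \<le> 1 / 2\<close> by (simp add: algebra_simps)
  then have "- (pi / 2) \<le> a - pi" "a - pi \<le> pi / 2" using a1 pi_less_4 pi_gt3 by linarith+
    then have "0 \<le> cos (a - pi)" by (rule cos_ge_zero)
    then have "cos a \<le> 0" by (simp add: cos_diff)
    then have "Re (w ^ m) \<le> 0" using \<open>Re (w ^ m) = _\<close> by (simp add: mult_nonneg_nonpos)
    then have "1 \<le> Re (1 - w ^ m)" by simp
    then show ?thesis using complex_Re_le_cmod order_trans by blast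
  qed
  have L0: "real n / 16 \<le> cmod (phase_sum {1..m} [1..<Suc n])"
  proof -
    have "1 \<le> cmod ((1 - w) * (\<Sum>i<m. w ^ i))" using far by (simp add: one_diff_power_eq)
    also have "\<dots> \<le> 16 / real n * cmod (\<Sum>i<m. w ^ i)"
      unfolding norm_mult using gap by (intro mult_right_mono) auto
    finally show ?thesis unfolding phi0 using n by (simp add: field_simps)
  qed
  have decay: "exp 22 / real n \<le> (cmod w ^ t)\<^sup>2"
  proof -
    have "real n ^ 3 * (2 * \<beta>) \<le> 4 * pi\<^sup>2 * P + 188000 * \<kappa> * P" using size(1) by linarith
    also have "\<dots> = (4 * pi\<^sup>2 + 188000 * (real k / real n)) * (real k * (real k - 1))"
      by (simp add: P_def \<kappa>_def algebra_simps)
    finally have "real t * (real n ^ 3 * (2 * \<beta>))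
        \<le> real t * ((4 * pi\<^sup>2 + 188000 * (real k / real n)) * (real k * (real k - 1)))"
      by (intro mult_left_mono) auto
    also note t
    finally have "real n ^ 3 * (real t * (2 * \<beta>)) \<le> real n ^ 3 * (ln (real n) - 22)" by (simp add: mult_ac)
    then have "real t * (2 * \<beta>) \<le> ln (real n) - 22" using n by (simp only: mult_le_cancel_left_pos zero_less_power)
    then have "exp (22 - ln (real n)) \<le> exp (- (real t * (2 * \<beta>)))" by simp
    also have "\<dots> = (cmod w ^ t)\<^sup>2"
      unfolding cw by (simp add: algebra_simps flip: exp_of_nat_mult power_mult)
    finally show ?thesis using n by (simp add: exp_diff)
  qed
  have "16384 * real n \<le> exp 22 / 256 * real n"
  proof (rule mult_right_mono)
    have "(2 :: real) ^ 22 \<le> exp 1 ^ 22" using exp_ge_add_one_self[of 1] by (intro power_mono) auto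
    then show "16384 \<le> (exp 22 :: real) / 256" by (simp flip: exp_of_nat_mult)
  qed simp
  also have "\<dots> = exp 22 / real n * (real n / 16)\<^sup>2" using n by (simp add: power2_eq_square field_simps)
  also have "\<dots> \<le> (cmod w ^ t)\<^sup>2 * (cmod (phase_sum {1..m} [1..<Suc n]))\<^sup>2"
    using decay L0 by (intro mult_mono power_mono) auto
  also have "\<dots> = (cmod (w ^ t * phase_sum {1..m} [1..<Suc n]))\<^sup>2" by (simp add: norm_mult norm_power power_mult_distrib)
  finally have big: "16384 * real n \<le> (cmod (w ^ t * phase_sum {1..m} [1..<Suc n]))\<^sup>2" .
  show ?thesis
  proof (rule tv_dist_ge_half)
    show "[1..<Suc n] \<in> orderings n" by (auto simp: orderings_iff)
    show "{1..m} \<subseteq> {1..n}" by (auto simp: m_def)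
    show "16 * variance_bound \<le> (cmod (w ^ t * phase_sum {1..m} [1..<Suc n]))\<^sup>2" using V big by simp
    have "phase_sum {1..m} [1..<Suc n] \<noteq> 0" using L0 n by auto
    then show "0 < cmod (w ^ t * phase_sum {1..m} [1..<Suc n])" by (simp add: w_def)
  qed
qed

lemma mixing_time_lower_phase:
  assumes "2 \<le> k" "94000 * k \<le> n"
  shows "real n ^ 3 * (ln (real n) - 22) / ((4 * pi\<^sup>2 + 188000 * (real k / real n)) * (real k * (real k - 1)))
    < real (mixing_time n k)"
proof (rule mixing_time_gt_if_far[OF assms(1)])
  show "k \<le> n" using assms by simp
  show "[1..<Suc n] \<in> orderings n" by (auto simp: orderings_iff)
  fix t :: nat
  let ?B = "(4 * pi\<^sup>2 + 188000 * (real k / real n)) * (real k * (real k - 1))"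
  assume t: "real t \<le> real n ^ 3 * (ln (real n) - 22) / ?B"
  have "0 < ?B" using assms by (intro mult_pos_pos add_pos_nonneg) auto
  then have "real t * ?B \<le> real n ^ 3 * (ln (real n) - 22)" using t by (simp add: pos_le_divide_eq)
  from tv_dist_ge_half_identity[OF assms this]
  show "1 / 4 < tv_dist (orderings n) (shuffle_law n k [1..<Suc n] t) (pmf_of_set (orderings n))" by simp
qed

section \<open>Cards never moved\<close>

text \<open>
  From the sorted initial deck the cards that were never picked form a sorted end of the deck. The
  longest such end is a function of the current deck alone, so the past need not be recorded. Ends
  longer than \<open>k\<close> are cut off to keep them inside the bottom zone.
\<close>

definition sorted_end :: "nat \<Rightarrow> nat list \<Rightarrow> nat" where
  "sorted_end k xs = Max {u. u \<le> k \<and> u \<le> length xs \<and> sorted (drop (length xs - u) xs)}"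

lemma sorted_end_props:
  fixes xs :: "nat list"
  shows "sorted_end k xs \<le> k" "sorted_end k xs \<le> length xs"
    "sorted (drop (length xs - sorted_end k xs) xs)"
    and sorted_end_ge: "u \<le> k \<Longrightarrow> u \<le> length xs \<Longrightarrow> sorted (drop (length xs - u) xs) \<Longrightarrow> u \<le> sorted_end k xs"
proof -
  let ?A = "{u. u \<le> k \<and> u \<le> length xs \<and> sorted (drop (length xs - u) xs)}"
  have fin: "finite ?A" by (rule finite_subset[of _ "{..k}"]) auto
  moreover have "0 \<in> ?A" by simp
  ultimately have "Max ?A \<in> ?A" by (intro Max_in) auto
  then show "sorted_end k xs \<le> k" "sorted_end k xs \<le> length xs"
    "sorted (drop (length xs - sorted_end k xs) xs)"
    by (auto simp: sorted_end_def)
  show "u \<le> sorted_end k xs" if "u \<le> k" "u \<le> length xs" "sorted (drop (length xs - u) xs)"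
    unfolding sorted_end_def using that fin by (intro Max_ge) auto
qed

lemma sorted_end_ge_1: "1 \<le> k \<Longrightarrow> xs \<noteq> [] \<Longrightarrow> 1 \<le> sorted_end k xs"
proof (rule sorted_end_ge)
  assume "xs \<noteq> []"
  then have "length (drop (length xs - 1) xs) = Suc 0" by (cases xs) auto
  then obtain a where "drop (length xs - 1) xs = [a]" by (metis length_0_conv length_Suc_conv)
  then show "sorted (drop (length xs - 1) xs)" by simp
  show "1 \<le> length xs" using \<open>xs \<noteq> []\<close> by (cases xs) auto
qed

lemma sorted_end_to_top:
  assumes xs: "xs \<in> orderings n" and c: "c \<in> {1..n}"
  shows "sorted_end k xs - (if c \<in> set (drop (n - sorted_end k xs) xs) then 1 else 0)
    \<le> sorted_end k (to_top c xs)"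
proof -
  let ?u = "sorted_end k xs"
  let ?ys = "take (n - ?u) xs" and ?zs = "drop (n - ?u) xs"
  let ?fz = "filter (\<lambda>d. d \<noteq> c) ?zs"
  have len: "length xs = n" using orderings_length[OF xs] .
  have u: "?u \<le> k" "?u \<le> n" "sorted ?zs" using sorted_end_props[where k = k and xs = xs] len by auto
  have dist: "distinct ?zs" using xs by (simp add: orderings_iff)
  have lz: "length ?zs = ?u" using len u by simp
  have lfz: "length ?fz = ?u - (if c \<in> set ?zs then 1 else 0)"
    using length_filter_neq_distinct[OF dist] lz by simp
  have lt: "length (to_top c xs) = n" using orderings_length to_top_in_orderings[OF xs c] by blast
  have eq: "to_top c xs = (c # filter (\<lambda>d. d \<noteq> c) ?ys) @ ?fz"
    unfolding to_top_def by (metis append_Cons append_take_drop_id filter_append)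
  have "n - length ?fz = length (c # filter (\<lambda>d. d \<noteq> c) ?ys)"
    using lt arg_cong[OF eq, of length] by (simp only: length_append)
  then have "drop (n - length ?fz) (to_top c xs) = ?fz" using eq by (metis append_eq_conv_conj)
  moreover have "sorted ?fz" using u(3) by (rule sorted_wrt_filter)
  ultimately have "length ?fz \<le> sorted_end k (to_top c xs)"
    using u lt lfz by (intro sorted_end_ge) auto
  then show ?thesis using lfz by simp
qed

text \<open>
  For an end of length \<open>u\<close> the function \<open>1 / (u + 1)\<close> grows to at most \<open>1 / u\<close> with probability \<open>u / k\<close>,
  so its mean grows by at most the factor \<open>1 + 1 / k\<close>, whatever \<open>u\<close> is. This replaces the first and
  second moments of the usual coupon collector argument.
\<close>

lemma sorted_end_drift:
  assumes xs: "xs \<in> orderings n" and k: "1 \<le> k" "k \<le> n"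
  shows "measure_pmf.expectation (shuffle_step n k xs) (\<lambda>x. 1 / (real (sorted_end k x) + 1))
    \<le> (1 + 1 / real k) * (1 / (real (sorted_end k xs) + 1))"
proof -
  let ?u = "sorted_end k xs"
  let ?Z = "zone n k xs" and ?B = "set (drop (n - ?u) xs)"
  have len: "length xs = n" using orderings_length[OF xs] .
  have "xs \<noteq> []" using len k by auto
  then have u: "?u \<le> k" "?u \<le> n" "1 \<le> ?u"
    using sorted_end_props(1,2)[where k = k and xs = xs] len sorted_end_ge_1[OF k(1), of xs] k by auto
  have B: "?B \<subseteq> ?Z" using u(1) by (intro set_drop_subset_set_drop) auto
  have cB: "card ?B = ?u" using distinct_card[of "drop (n - ?u) xs"] xs len u by (simp add: orderings_iff)
  have bound: "1 / (real (sorted_end k (to_top c xs)) + 1) \<le> (if c \<in> ?B then 1 / real ?u else 1 / (real ?u + 1))"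
    if c: "c \<in> ?Z" for c
  proof -
    have "c \<in> {1..n}" using zone_subset[OF xs] c by blast
    from sorted_end_to_top[OF xs this, of k] u show ?thesis
      by (auto intro!: divide_left_mono split: if_splits)
  qed
  have "(\<Sum>c\<in>?Z. 1 / (real (sorted_end k (to_top c xs)) + 1))
     \<le> (\<Sum>c\<in>?Z. if c \<in> ?B then 1 / real ?u else 1 / (real ?u + 1))"
    by (intro sum_mono bound)
  also have "\<dots> = (\<Sum>c\<in>?B. 1 / real ?u) + (\<Sum>c\<in>?Z - ?B. 1 / (real ?u + 1))"
    using B by (subst sum.If_cases) (auto simp: Int_absorb1 Diff_eq)
  also have "\<dots> = 1 + (real k - real ?u) / (real ?u + 1)"
    using cB card_zone[OF xs k(2)] B u card_Diff_subset[of ?B ?Z] by (simp add: of_nat_diff)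
  also have "\<dots> = (real k + 1) * (1 / (real ?u + 1))" by (simp add: field_simps)
  finally have "(\<Sum>c\<in>?Z. 1 / (real (sorted_end k (to_top c xs)) + 1)) / real k
      \<le> (real k + 1) * (1 / (real ?u + 1)) / real k"
    by (rule divide_right_mono) simp
  also have "\<dots> = (1 + 1 / real k) * (1 / (real ?u + 1))" using k by (simp add: divide_simps)
  finally show ?thesis unfolding expectation_shuffle_step[OF xs k] .
qed

text \<open>
  Exchanging the last two cards maps the event injectively into its complement.
\<close>

lemma uniform_last_two_sorted:
  assumes "2 \<le> n"
  shows "measure_pmf.prob (pmf_of_set (orderings n)) {xs. sorted (drop (n - 2) xs)} \<le> 1 / 2"
proof -
  define A where "A = orderings n \<inter> {xs. sorted (drop (n - 2) xs)}"
  define f where "f xs = take (n - 2) xs @ rev (drop (n - 2) xs)" for xs :: "nat list"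
  have ff: "f (f xs) = xs" if "xs \<in> orderings n" for xs
    using orderings_length[OF that] by (simp add: f_def)
  have fo: "f xs \<in> orderings n" if "xs \<in> orderings n" for xs
  proof -
    have "set (f xs) = set xs" by (metis append_take_drop_id f_def set_append set_rev)
    moreover have "distinct (f xs) = distinct xs"
      by (metis append_take_drop_id distinct_append distinct_rev f_def set_rev)
    ultimately show ?thesis using that by (simp add: orderings_iff)
  qed
  have "inj_on f A" using ff by (intro inj_on_inverseI[where g = f]) (auto simp: A_def)
  moreover have "f ` A \<subseteq> orderings n - A"
  proof safe
    fix xs assume "xs \<in> A"
    then have xs: "xs \<in> orderings n" "sorted (drop (n - 2) xs)" by (auto simp: A_def)
    show "f xs \<in> orderings n" using fo xs by simp
    assume "f xs \<in> A"
    then have so: "sorted (rev (drop (n - 2) xs))"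
      using orderings_length[OF xs(1)] by (simp add: A_def f_def)
    have "length (drop (n - 2) xs) = 2" using orderings_length[OF xs(1)] assms by simp
    then obtain a b where ab: "drop (n - 2) xs = [a, b]"
      by (metis (no_types, opaque_lifting) One_nat_def Suc_1 length_0_conv length_Suc_conv)
    have "distinct [a, b]" using xs(1) unfolding ab[symmetric] by (simp add: orderings_iff)
    then show False using xs(2) so by (simp add: ab)
  qed
  ultimately have "card A \<le> card (orderings n - A)"
    by (metis card_image card_mono finite_Diff finite_orderings)
  also have "\<dots> = card (orderings n) - card A" by (intro card_Diff_subset) (auto simp: A_def)
  finally have "2 * card A \<le> card (orderings n)" using card_mono[of "orderings n" A] by (auto simp: A_def)
  then have "2 * real (card A) \<le> real (card (orderings n))" by linarith
  then show ?thesis by (simp add: measure_pmf_of_set A_def divide_simps card_gt_0_iff)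
qed

lemma tv_dist_gt_coupon:
  assumes k: "2 \<le> k" "k \<le> n" and t: "real t \<le> real k * (ln (real k) - 3)"
  shows "tv_dist (orderings n) (shuffle_law n k [1..<Suc n] t) (pmf_of_set (orderings n)) > 1 / 4"
proof -
  let ?s = "[1..<Suc n]"
  define p where "p = shuffle_law n k ?s t"
  define A where "A = {xs :: nat list. sorted (drop (n - 2) xs)}"
  define g where "g x = 1 / (real (sorted_end k x) + 1)" for x :: "nat list"
  have s: "?s \<in> orderings n" by (auto simp: orderings_iff)
  have k1: "1 \<le> k" using k by simp
  have "set_pmf (run (shuffle_step n k) (return_pmf ?s) t) \<subseteq> orderings n"
    by (rule set_run) (use s set_shuffle_step k1 k in auto)
  then have sub: "set_pmf p \<subseteq> orderings n" by (simp add: p_def shuffle_law_eq_run)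
  have fin: "finite (set_pmf p)" using sub finite_orderings finite_subset by blast
  have "(1 / 2) * measure_pmf.prob p (- A) \<le> measure_pmf.expectation p g"
  proof (rule markov_finite[OF fin])
    fix x assume x: "x \<in> set_pmf p" "x \<in> - A"
    have len: "length x = n" using x sub orderings_length by blast
    have "sorted_end k x \<le> 1"
    proof (rule ccontr)
      assume "\<not> sorted_end k x \<le> 1"
      then have "2 \<le> sorted_end k x" by simp
      then have "n - 2 = (n - 2 - (n - sorted_end k x)) + (n - sorted_end k x)"
        using sorted_end_props(2)[of k x] len by simp
      then have "drop (n - 2) x = drop (n - 2 - (n - sorted_end k x)) (drop (n - sorted_end k x) x)"
        by (metis drop_drop)
      moreover have "sorted (drop (n - sorted_end k x) x)" using sorted_end_props(3)[of x k] len by simp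
      ultimately have "sorted (drop (n - 2) x)" by (metis sorted_wrt_drop)
      with x show False by (simp add: A_def)
    qed
    then show "1 / 2 \<le> g x" by (simp add: g_def divide_simps)
  qed (simp add: g_def)
  also have "\<dots> \<le> (1 + 1 / real k) ^ t * measure_pmf.expectation (return_pmf ?s) g"
    unfolding p_def shuffle_law_eq_run g_def
    by (rule expectation_run_geometric[OF finite_orderings _ set_shuffle_step sorted_end_drift])
       (use s k k1 in auto)
  finally have markov: "(1 / 2) * measure_pmf.prob p (- A)
    \<le> (1 + 1 / real k) ^ t * measure_pmf.expectation (return_pmf ?s) g" .
  have init: "measure_pmf.expectation (return_pmf ?s) g \<le> 1 / real k"
  proof -
    have "k \<le> sorted_end k ?s" using k by (intro sorted_end_ge sorted_wrt_drop sorted_upt) auto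
    then have "real k \<le> real (sorted_end k ?s) + 1" by simp
    then show ?thesis using k1 by (simp add: g_def divide_left_mono)
  qed
  have "(1 + 1 / real k) ^ t \<le> exp (real t / real k)"
  proof -
    have "(1 + 1 / real k) ^ t \<le> exp (1 / real k) ^ t"
      using exp_ge_add_one_self[of "1 / real k"] by (intro power_mono) auto
    then show ?thesis by (simp flip: exp_of_nat_mult)
  qed
  also have "\<dots> \<le> exp (ln (real k) - 3)" using t k1 by (simp add: field_simps)
  also have "\<dots> = real k * exp (- 3)" using k1 by (simp add: exp_diff exp_minus field_simps)
  finally have growth: "(1 + 1 / real k) ^ t \<le> real k * exp (- 3)" .
  have "(1 / 2) * measure_pmf.prob p (- A) \<le> real k * exp (- 3) * (1 / real k)"
    by (rule order_trans[OF markov mult_mono[OF growth init]]) (simp_all add: g_def)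
  also have "\<dots> = exp (- 3)" using k1 by simp
  also have "\<dots> < 1 / 8"
  proof -
    have "8 < exp (3 :: real)" using exp_lower_Taylor_quadratic[of 3] by simp
    then show ?thesis by (simp add: exp_minus field_simps)
  qed
  finally have 1: "measure_pmf.prob p (- A) < 1 / 4" by simp
  have "measure_pmf.prob p A - measure_pmf.prob (pmf_of_set (orderings n)) A
      \<le> tv_dist (orderings n) p (pmf_of_set (orderings n))"
    by (intro tv_dist_ge_event sub) auto
  moreover have "measure_pmf.prob p (- A) = 1 - measure_pmf.prob p A"
    using measure_pmf.prob_compl[of A p] by (simp add: Compl_eq_Diff_UNIV)
  moreover have "measure_pmf.prob (pmf_of_set (orderings n)) A \<le> 1 / 2"
    unfolding A_def using k by (intro uniform_last_two_sorted) simp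
  ultimately show ?thesis using 1 by (simp add: p_def)
qed

lemma mixing_time_lower_coupon:
  assumes "2 \<le> k" "k \<le> n"
  shows "real k * (ln (real k) - 3) < real (mixing_time n k)"
proof (rule mixing_time_gt_if_far[OF assms])
  show "[1..<Suc n] \<in> orderings n" by (auto simp: orderings_iff)
qed (rule tv_dist_gt_coupon[OF assms])

section \<open>Asymptotics\<close>

text \<open>
  Taking \<open>\<theta> = s * pi / n\<close> with \<open>s < 1\<close> fixed keeps the cosine away from 0, at the price of a factor
  \<open>s\<^sup>2\<close> in the rate.
\<close>

lemma eventually_mixing_time_upper:
  fixes k :: "nat \<Rightarrow> nat" and e :: real
  assumes k: "\<forall>\<^sub>F n in sequentially. 2 \<le> k n \<and> k n \<le> n"
    and o: "(\<lambda>n. real (k n)) \<in> o(\<lambda>n. real n)" and e: "0 < e"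
  shows "\<forall>\<^sub>F n in sequentially. real (mixing_time n (k n))
    \<le> (1 + e) * (real n ^ 3 / (pi\<^sup>2 * real (k n) * (real (k n) - 1)) * ln (real n))"
proof -
  \<comment> \<open>Five factors \<open>1 / s\<close> are lost below. By Bernoulli's inequality \<open>s ^ 5 \<ge> 1 - 5 * \<epsilon>\<close>, which equals
     \<open>1 / (1 + e / 2)\<close>.\<close>
  define \<epsilon> where "\<epsilon> = e / (5 * (2 + e))"
  define s where "s = 1 - \<epsilon>"
  define \<Phi> where "\<Phi> = pi * (1 - \<epsilon> / 2) / 2"
  define c where "c = cos \<Phi>"
  have \<epsilon>: "0 < \<epsilon>" "\<epsilon> < 1 / 5" using e by (auto simp: \<epsilon>_def divide_simps)
  have s: "0 < s" "s < 1" using \<epsilon> by (auto simp: s_def)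
  have \<Phi>: "0 < \<Phi>" "\<Phi> < pi / 2" using \<epsilon> by (auto simp: \<Phi>_def mult_less_cancel_left1 pi_gt_zero field_simps)
  have c: "0 < c" "c \<le> 1" unfolding c_def using \<Phi> by (auto intro!: cos_gt_zero)
  have s5: "1 / s ^ 5 \<le> 1 + e / 2"
  proof -
    have "2 / (2 + e) = 1 + real 5 * (- \<epsilon>)" using e by (simp add: \<epsilon>_def field_simps)
    also have "\<dots> \<le> (1 + (- \<epsilon>)) ^ 5" using \<epsilon> by (intro Bernoulli_inequality) auto
    finally have "2 / (2 + e) \<le> s ^ 5" by (simp add: s_def)
    then show ?thesis using s e by (simp add: field_simps)
  qed
  have "((\<lambda>n. real (k n) / real n) \<longlongrightarrow> 0) sequentially" using smalloD_tendsto[OF o] .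
  moreover have "0 < \<epsilon> / 16" using \<epsilon> by simp
  ultimately have E2: "\<forall>\<^sub>F n in sequentially. real (k n) / real n < \<epsilon> / 16" by (rule order_tendstoD)
  have E3: "\<forall>\<^sub>F n in sequentially. s ^ 3 * pi\<^sup>2 / (2 * (real n)\<^sup>2) \<le> 1 - cos (s * pi / real n)"
  proof -
    have "(\<lambda>n::nat. (1 - cos (s * pi / real n)) * (real n)\<^sup>2) \<longlonglongrightarrow> s * pi * (s * pi) / 2"
      using s by real_asymp
    moreover have "s ^ 3 * pi\<^sup>2 / 2 < s * pi * (s * pi) / 2"
      using s by (simp add: power2_eq_square power3_eq_cube)
    ultimately have "\<forall>\<^sub>F n in sequentially. s ^ 3 * pi\<^sup>2 / 2 < (1 - cos (s * pi / real n)) * (real n)\<^sup>2"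
      by (rule order_tendstoD)
    then show ?thesis using eventually_gt_at_top[of 0]
      by eventually_elim (simp add: divide_simps mult_ac)
  qed
  have E4: "\<forall>\<^sub>F n in sequentially. ln (8 * real n / c) \<le> ln (real n) / s"
  proof -
    have "filterlim (\<lambda>n::nat. ln (real n) * (1 / s - 1)) at_top sequentially"
      using s by (intro filterlim_tendsto_pos_mult_at_top[OF tendsto_const] filterlim_at_top_mult_tendsto_pos[OF tendsto_const])
        (auto simp: field_simps intro!: filterlim_compose[OF ln_at_top filterlim_real_sequentially])
    then have "\<forall>\<^sub>F n in sequentially. ln (8 / c) \<le> ln (real n) * (1 / s - 1)"
      by (simp add: filterlim_at_top)
    then show ?thesis using eventually_gt_at_top[of 0]
    proof eventually_elim
      case (elim n)
      have "ln (8 * real n / c) = ln (8 / c) + ln (real n)"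
        using elim c ln_mult_pos[of "8 / c" "real n"] by simp
      then show ?case using elim by (simp add: algebra_simps)
    qed
  qed
  have E5: "\<forall>\<^sub>F n in sequentially. 1 \<le> e / 2 * (real n / 16 * ln (real n))"
    using e by real_asymp
  show ?thesis using k E2 E3 E4 E5 eventually_gt_at_top[of 2]
  proof eventually_elim
    case (elim n)
    define K where "K = real (k n)"
    define \<kappa> where "\<kappa> = K / real n"
    define \<theta> where "\<theta> = s * pi / real n"
    define \<eta> where "\<eta> = phase_decay n (k n) \<theta>"
    define q where "q = phase_drift (k n) \<theta>"
    define M where "M = real n ^ 3 / (pi\<^sup>2 * K * (K - 1))"
    define A where "A = ln (4 * real n * (1 + q) / c)"
    have n: "2 < real n" and kn: "2 \<le> k n" "1 \<le> k n" "k n \<le> n" and K: "2 \<le> K" "K \<le> real n"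
      using elim by (auto simp: K_def)
    have lnn: "0 < ln (real n)" using n by simp
    have \<kappa>: "0 \<le> \<kappa>" "\<kappa> \<le> \<epsilon> / 16" using elim K n by (auto simp: \<kappa>_def K_def)
    have pi16: "pi\<^sup>2 \<le> 16" using pi_less_4 power_mono[of pi 4 2] by auto
    have \<theta>: "0 < \<theta>" "\<theta> \<le> pi"
      using s n mult_mono[of s "real n" pi pi] by (auto simp: \<theta>_def divide_le_eq mult.commute)
    have \<theta>2: "\<theta>\<^sup>2 \<le> 16 / (real n)\<^sup>2"
    proof -
      have "\<theta> \<le> 4 / real n" unfolding \<theta>_def using s pi_less_4 mult_mono[of s 1 pi 4] n
        by (intro divide_right_mono) auto
      then have "\<theta>\<^sup>2 \<le> (4 / real n)\<^sup>2" using \<theta> by (intro power_mono) auto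
      then show ?thesis by (simp add: power_divide)
    qed
    have q0: "0 \<le> q" unfolding q_def by (rule phase_drift_nonneg[OF kn(2)])
    have "q \<le> 2 * K * (K - 1) * (\<theta>\<^sup>2 / 2)"
      unfolding q_def phase_drift_def K_def using kn by (intro mult_left_mono one_minus_cos_le) auto
    also have "\<dots> \<le> 2 * K * K * (16 / (real n)\<^sup>2 / 2)" using K \<theta>2 by (intro mult_mono) auto
    also have "\<dots> = 16 * \<kappa> * \<kappa>" using n by (simp add: \<kappa>_def power2_eq_square)
    also have "\<dots> \<le> \<epsilon> * 1" using \<kappa> \<epsilon> by (intro mult_mono) auto
    finally have q\<epsilon>: "q \<le> \<epsilon>" by simp
    have "1 - \<epsilon>\<^sup>2 \<le> 1" by simp
    then have "(1 + \<epsilon>) * s \<le> 1" by (simp add: s_def power2_eq_square algebra_simps)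
    moreover have "(1 + q) * s \<le> (1 + \<epsilon>) * s" using q\<epsilon> s by (intro mult_right_mono) auto
    ultimately have "(1 + q) * s \<le> 1" by linarith
    then have qs: "1 + q \<le> 1 / s" using s by (simp only: pos_le_divide_eq)
    have \<eta>: "0 \<le> \<eta>" "2 * real n * \<eta> = q / (1 + q)" "2 * real n * \<eta> < 1"
      using phase_decay_bounds[OF kn(2), of n \<theta>] kn by (auto simp: \<eta>_def q_def)
    have D: "1 / 2 \<le> 1 - K * \<eta> - K * \<theta>\<^sup>2 / 2"
    proof -
      have "2 * (K * \<eta>) = \<kappa> * (2 * real n * \<eta>)" using n by (simp add: \<kappa>_def)
      also have "\<dots> \<le> \<kappa> * 1" using \<eta> \<kappa> by (intro mult_left_mono) auto
      finally have 1: "K * \<eta> \<le> \<kappa> / 2" by simp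
      have "K * \<theta>\<^sup>2 / 2 \<le> K * (16 / (real n)\<^sup>2) / 2" using \<theta>2 K by (intro divide_right_mono mult_left_mono) auto
      also have "\<dots> = \<kappa> * (8 / real n)" using n by (simp add: \<kappa>_def power2_eq_square)
      also have "\<dots> \<le> \<kappa> * 8" using \<kappa> n by (intro mult_left_mono) (auto simp: divide_le_eq)
      finally show ?thesis using 1 \<kappa> \<epsilon> by linarith
    qed
    have P: "real (n - k n) * \<theta> + K * \<theta> / (1 / 2) \<le> 2 * \<Phi>"
    proof -
      have "real (n - k n) * \<theta> + K * \<theta> / (1 / 2) = (real n + K) * \<theta>"
        using kn by (simp add: K_def of_nat_diff algebra_simps)
      also have "\<dots> = pi * (s * (1 + \<kappa>))" using n by (simp add: \<theta>_def \<kappa>_def field_simps)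
      also have "\<dots> \<le> pi * (1 - \<epsilon> / 2)"
      proof (rule mult_left_mono)
        have "s * (1 + \<kappa>) \<le> s * (1 + \<epsilon> / 2)" using s \<kappa> \<epsilon> by (intro mult_left_mono) auto
        also have "\<dots> = 1 - \<epsilon> / 2 - \<epsilon> * \<epsilon> / 2" by (simp add: s_def field_simps)
        also have "\<dots> \<le> 1 - \<epsilon> / 2" using \<epsilon> by simp
        finally show "s * (1 + \<kappa>) \<le> 1 - \<epsilon> / 2" .
      qed simp
      finally show ?thesis by (simp add: \<Phi>_def)
    qed
    have q1: "1 + q \<le> 2" using q\<epsilon> \<epsilon> by simp
    have "A \<le> ln (8 * real n / c)"
      unfolding A_def using q0 q1 c n by (intro ln_mono divide_right_mono divide_pos_pos mult_pos_pos) auto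
    then have A1: "A \<le> ln (real n) / s" using elim by simp
    have A0: "0 \<le> A"
    proof -
      have "c \<le> 4 * real n * 1" using c n by simp
      also have "\<dots> \<le> 4 * real n * (1 + q)" using q0 n by (intro mult_left_mono) auto
      finally have "1 \<le> 4 * real n * (1 + q) / c" using c by (simp add: le_divide_eq)
      then show ?thesis by (simp add: A_def)
    qed
    define Q where "Q = K * (K - 1) * (s ^ 3 * pi\<^sup>2 / (real n)\<^sup>2)"
    have Q0: "0 < Q" using K s n by (auto simp: Q_def)
    have "2 * K * (K - 1) * (s ^ 3 * pi\<^sup>2 / (2 * (real n)\<^sup>2)) \<le> 2 * K * (K - 1) * (1 - cos \<theta>)"
      using elim K by (intro mult_left_mono) (auto simp: \<theta>_def)
    then have Qq: "Q \<le> q" by (simp add: Q_def q_def phase_drift_def K_def)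
    have \<eta>pos: "0 < 2 * \<eta>"
    proof -
      have "0 < 2 * real n * \<eta>" unfolding \<eta>(2) using Qq Q0 by simp
      then show ?thesis using n by (simp add: zero_less_mult_iff)
    qed
    have inv: "1 / (2 * \<eta>) \<le> M / s ^ 4"
    proof -
      have "1 / (2 * \<eta>) = real n / (2 * real n * \<eta>)" using n \<eta>pos by simp
      also have "\<dots> = real n * (1 + q) / q" unfolding \<eta>(2) using Qq Q0 by simp
      also have "\<dots> \<le> real n * (1 / s) / Q" using qs Qq Q0 q0 n s by (intro frac_le mult_left_mono) auto
      also have "\<dots> = M / s ^ 4" using n s K by (simp add: Q_def M_def power2_eq_square eval_nat_numeral field_simps)
      finally show ?thesis .
    qed
    have M0: "real n / 16 \<le> M"
    proof -
      have "pi\<^sup>2 * K * (K - 1) \<le> 16 * real n * real n" using pi16 K by (intro mult_mono) auto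
      then have "real n ^ 3 / (16 * real n * real n) \<le> M"
        unfolding M_def using K n by (intro divide_left_mono) auto
      then show ?thesis using n by (simp add: power3_eq_cube)
    qed
    define t where "t = nat \<lceil>A / (2 * \<eta>)\<rceil>"
    have t: "A \<le> 2 * real t * \<eta>" "real t \<le> A / (2 * \<eta>) + 1"
      using nat_ceiling_div[OF \<eta>pos A0] by (simp_all add: t_def mult_ac)
    have "mixing_time n (k n) \<le> t"
    proof (rule mixing_time_le)
      fix x assume "x \<in> orderings n"
      then show "tv_dist (orderings n) (shuffle_law n (k n) x t) (pmf_of_set (orderings n)) \<le> 1 / 4"
        using tv_dist_le_quarter[OF kn(2,3) \<theta> _ D[unfolded K_def \<eta>_def] P[unfolded K_def] \<Phi>(2)]
          t(1) by (simp add: A_def q_def c_def \<eta>_def)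
    qed
    then have "real (mixing_time n (k n)) \<le> A * (1 / (2 * \<eta>)) + 1" using t(2) by simp
    moreover have "A * (1 / (2 * \<eta>)) \<le> M * ln (real n) + e / 2 * (M * ln (real n))"
    proof -
      have "A * (1 / (2 * \<eta>)) \<le> (ln (real n) / s) * (M / s ^ 4)"
        using A1 inv A0 \<eta>pos lnn s by (intro mult_mono) auto
      also have "\<dots> = (M * ln (real n)) * (1 / s ^ 5)" by (simp add: eval_nat_numeral mult_ac)
      also have "\<dots> \<le> (M * ln (real n)) * (1 + e / 2)"
        using s5 M0 lnn n by (intro mult_left_mono) auto
      finally show ?thesis by (simp add: algebra_simps)
    qed
    moreover have "1 \<le> e / 2 * (M * ln (real n))"
    proof -
      have "e / 2 * (real n / 16 * ln (real n)) \<le> e / 2 * (M * ln (real n))"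
        using M0 lnn e by (intro mult_left_mono mult_right_mono) auto
      then show ?thesis using elim by linarith
    qed
    moreover have "(1 + e) * (M * ln (real n)) = M * ln (real n) + 2 * (e / 2 * (M * ln (real n)))"
      by (simp add: algebra_simps)
    ultimately have "real (mixing_time n (k n)) \<le> (1 + e) * (M * ln (real n))" by linarith
    then show ?case by (simp only: M_def K_def)
  qed
qed

lemma eventually_mixing_time_lower:
  fixes k :: "nat \<Rightarrow> nat" and e :: real
  assumes k: "\<forall>\<^sub>F n in sequentially. 2 \<le> k n \<and> k n \<le> n"
    and o: "(\<lambda>n. real (k n)) \<in> o(\<lambda>n. real n)" and e: "0 < e" "e < 1"
  shows "\<forall>\<^sub>F n in sequentially.
    (1 - e) * (real n ^ 3 / (4 * pi\<^sup>2 * real (k n) * (real (k n) - 1)) * ln (real n)) \<le> real (mixing_time n (k n))"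
proof -
  have lim: "((\<lambda>n. real (k n) / real n) \<longlongrightarrow> 0) sequentially" using smalloD_tendsto[OF o] .
  have E1: "\<forall>\<^sub>F n in sequentially. real (k n) / real n < e / 188000"
    by (rule order_tendstoD(2)[OF lim]) (use e in simp)
  have E2: "\<forall>\<^sub>F n in sequentially. real (k n) / real n < 1 / 94000"
    by (rule order_tendstoD(2)[OF lim]) simp
  have E3: "\<forall>\<^sub>F n in sequentially. 22 \<le> e / 2 * ln (real n)"
    using e by real_asymp
  show ?thesis using k E1 E2 E3 eventually_gt_at_top[of 2]
  proof eventually_elim
    case (elim n)
    define P where "P = real (k n) * (real (k n) - 1)"
    define B where "B = 4 * pi\<^sup>2 + 188000 * (real (k n) / real n)"
    have n: "2 < real n" and P: "0 < P" using elim by (auto simp: P_def)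
    have large: "94000 * k n \<le> n"
    proof -
      have "94000 * real (k n) \<le> real n" using elim n by (simp add: field_simps)
      then show ?thesis by linarith
    qed
    have B: "0 < B" "(1 - e / 2) * B \<le> 4 * pi\<^sup>2"
    proof -
      have "0 < pi\<^sup>2" by simp
      moreover have "0 \<le> real (k n) / real n" by simp
      ultimately show "0 < B" unfolding B_def by linarith
      have "9 \<le> pi\<^sup>2" using pi_gt3 power_mono[of 3 pi 2] by auto
      then have "e / 2 * 36 \<le> e / 2 * (4 * pi\<^sup>2)" using e by (intro mult_left_mono) auto
      moreover have "B \<le> 4 * pi\<^sup>2 + e" using elim unfolding B_def by linarith
      then have "(1 - e / 2) * B \<le> (1 - e / 2) * (4 * pi\<^sup>2 + e)" using e by (intro mult_left_mono) auto
      moreover have "(1 - e / 2) * (4 * pi\<^sup>2 + e) = 4 * pi\<^sup>2 - e / 2 * (4 * pi\<^sup>2) + e - e / 2 * e"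
        by (simp add: algebra_simps)
      moreover have "0 \<le> e / 2 * e" using e by simp
      ultimately show "(1 - e / 2) * B \<le> 4 * pi\<^sup>2" using e by linarith
    qed
    have lnn: "0 < ln (real n)" using n by simp
    have "(1 - e) * (real n ^ 3 / (4 * pi\<^sup>2 * real (k n) * (real (k n) - 1)) * ln (real n))
       = (1 - e) * (real n ^ 3 / P * ln (real n)) / (4 * pi\<^sup>2)" by (simp add: P_def mult_ac)
    also have "\<dots> \<le> (1 - e / 2)\<^sup>2 * (real n ^ 3 / P * ln (real n)) / (4 * pi\<^sup>2)"
      using P n lnn by (intro divide_right_mono mult_right_mono) (auto simp: power2_eq_square algebra_simps)
    also have "\<dots> = ((1 - e / 2) / (4 * pi\<^sup>2)) * (real n ^ 3 / P * ((1 - e / 2) * ln (real n)))"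
      by (simp add: power2_eq_square mult_ac)
    also have "\<dots> \<le> (1 / B) * (real n ^ 3 / P * (ln (real n) - 22))"
    proof (rule mult_mono)
      show "(1 - e / 2) / (4 * pi\<^sup>2) \<le> 1 / B" using B by (simp add: divide_simps)
      show "real n ^ 3 / P * ((1 - e / 2) * ln (real n)) \<le> real n ^ 3 / P * (ln (real n) - 22)"
        using elim P by (intro mult_left_mono) (auto simp: algebra_simps)
    qed (use B e P lnn in auto)
    also have "\<dots> = real n ^ 3 * (ln (real n) - 22) / (B * P)" by simp
    also have "\<dots> < real (mixing_time n (k n))"
      unfolding B_def P_def using elim by (intro mixing_time_lower_phase large) auto
    finally show ?case by simp
  qed
qed

text \<open>
  The sequence \<open>\<delta>\<close> is the excess of \<open>f / g\<close> over 1, with \<open>1 / (n + 1)\<close> added to make the inequality strict.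
\<close>

lemma little_o_upper_factor:
  fixes f g :: "nat \<Rightarrow> real"
  assumes g: "\<forall>\<^sub>F n in sequentially. 0 < g n"
    and le: "\<And>e. 0 < e \<Longrightarrow> \<forall>\<^sub>F n in sequentially. f n \<le> (1 + e) * g n"
  shows "\<exists>\<delta>. \<delta> \<longlonglongrightarrow> 0 \<and> (\<forall>\<^sub>F n in sequentially. f n < (1 + \<delta> n) * g n)"
proof (intro exI conjI)
  define \<delta> where "\<delta> n = max 0 (f n / g n - 1) + inverse (real (Suc n))" for n
  have "(\<lambda>n. max 0 (f n / g n - 1)) \<longlonglongrightarrow> 0"
  proof (rule tendstoI)
    fix e :: real assume e: "0 < e"
    show "\<forall>\<^sub>F n in sequentially. dist (max 0 (f n / g n - 1)) 0 < e"
      using g le[OF half_gt_zero[OF e]]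
    proof eventually_elim
      case (elim n)
      have "f n / g n \<le> 1 + e / 2" using elim by (simp add: divide_le_eq)
      then show ?case using e by (simp add: dist_real_def)
    qed
  qed
  from tendsto_add[OF this LIMSEQ_inverse_real_of_nat] show "\<delta> \<longlonglongrightarrow> 0" unfolding \<delta>_def by simp
  show "\<forall>\<^sub>F n in sequentially. f n < (1 + \<delta> n) * g n" using g
  proof eventually_elim
    case (elim n)
    have "f n / g n < 1 + \<delta> n" unfolding \<delta>_def using inverse_positive_iff_positive[of "real (Suc n)"] by linarith
    then show ?case using elim by (simp add: divide_less_eq)
  qed
qed

lemma little_o_lower_factor:
  fixes f g :: "nat \<Rightarrow> real"
  assumes g: "\<forall>\<^sub>F n in sequentially. 0 < g n"
    and ge: "\<And>e. 0 < e \<Longrightarrow> e < 1 \<Longrightarrow> \<forall>\<^sub>F n in sequentially. (1 - e) * g n \<le> f n"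
  shows "\<exists>\<epsilon>. \<epsilon> \<longlonglongrightarrow> 0 \<and> (\<forall>\<^sub>F n in sequentially. (1 + \<epsilon> n) * g n < f n)"
proof (intro exI conjI)
  define \<epsilon> where "\<epsilon> n = min 0 (f n / g n - 1) - inverse (real (Suc n))" for n
  have "(\<lambda>n. min 0 (f n / g n - 1)) \<longlonglongrightarrow> 0"
  proof (rule tendstoI)
    fix e :: real assume e: "0 < e"
    define e' where "e' = min e 1 / 2"
    have e': "0 < e'" "e' < 1" "e' < e" using e by (auto simp: e'_def)
    show "\<forall>\<^sub>F n in sequentially. dist (min 0 (f n / g n - 1)) 0 < e"
      using g ge[OF e'(1,2)]
    proof eventually_elim
      case (elim n)
      have "1 - e' \<le> f n / g n" using elim by (simp add: le_divide_eq)
      then show ?case using e' by (simp add: dist_real_def)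
    qed
  qed
  from tendsto_diff[OF this LIMSEQ_inverse_real_of_nat] show "\<epsilon> \<longlonglongrightarrow> 0" unfolding \<epsilon>_def by simp
  show "\<forall>\<^sub>F n in sequentially. (1 + \<epsilon> n) * g n < f n" using g
  proof eventually_elim
    case (elim n)
    have "1 + \<epsilon> n < f n / g n" unfolding \<epsilon>_def using inverse_positive_iff_positive[of "real (Suc n)"] by linarith
    then show ?case using elim by (simp add: less_divide_eq)
  qed
qed

lemma mixing_time_bigo:
  fixes k :: "nat \<Rightarrow> nat"
  assumes k: "\<forall>\<^sub>F n in sequentially. 2 \<le> k n \<and> k n \<le> n"
    and O: "(\<lambda>n. real (k n)) \<in> \<Omega>(\<lambda>n. real n)"
  shows "(\<lambda>n. real (mixing_time n (k n))) \<in> O(\<lambda>n. real n * ln (real n))"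
proof -
  obtain c where c: "0 < c" "\<forall>\<^sub>F n in sequentially. c * norm (real n) \<le> norm (real (k n))"
    using O by (auto elim: landau_omega.bigE)
  have E3: "\<forall>\<^sub>F n in sequentially. 1 / (4 * (real n)\<^sup>2) \<le> 1 - cos (1 / real n)" by real_asymp
  have E4: "\<forall>\<^sub>F n in sequentially. ln (8 * real n / cos 1) \<le> 2 * ln (real n)"
  proof -
    have "0 < cos (1 :: real)" by (intro cos_gt_zero) (use pi_gt3 in auto)
    then show ?thesis by real_asymp
  qed
  have E5: "\<forall>\<^sub>F n::nat in sequentially. 1 \<le> real n * ln (real n)" by real_asymp
  show ?thesis
  proof (rule bigoI[where c = "16 / c\<^sup>2 + 1"])
    show "\<forall>\<^sub>F n in sequentially. norm (real (mixing_time n (k n)))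
        \<le> (16 / c\<^sup>2 + 1) * norm (real n * ln (real n))"
      using k c(2) E3 E4 E5 eventually_gt_at_top[of 2]
    proof eventually_elim
      case (elim n)
      define K where "K = real (k n)"
      define \<eta> where "\<eta> = phase_decay n (k n) (1 / real n)"
      define q where "q = phase_drift (k n) (1 / real n)"
      define A where "A = ln (8 * real n / cos 1)"
      have n: "2 < real n" and kn: "2 \<le> k n" "1 \<le> k n" "k n \<le> n" and K: "2 \<le> K" "K \<le> real n" "c * real n \<le> K"
        using elim by (auto simp: K_def)
      have \<eta>pos: "0 < 2 * \<eta>" using phase_decay_unit_pos[OF kn(1,3)] by (simp add: \<eta>_def)
      have c1: "0 < cos (1 :: real)" by (intro cos_gt_zero) (use pi_gt3 in auto)
      have A0: "0 \<le> A"
      proof -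
        have "cos 1 \<le> (1 :: real)" by simp
        then have "cos 1 \<le> 8 * real n" using n by linarith
        then have "1 \<le> 8 * real n / cos 1" using c1 by (simp add: le_divide_eq)
        then show ?thesis by (simp add: A_def)
      qed
      have q0: "0 \<le> q" unfolding q_def by (rule phase_drift_nonneg[OF kn(2)])
      have "q \<le> 2 * K * (K - 1) * ((1 / real n)\<^sup>2 / 2)"
        unfolding q_def phase_drift_def K_def using kn by (intro mult_left_mono one_minus_cos_le) auto
      also have "\<dots> \<le> 2 * real n * real n * ((1 / real n)\<^sup>2 / 2)" using K by (intro mult_right_mono mult_mono) auto
      also have "\<dots> = 1" using n by (simp add: power2_eq_square)
      finally have q1: "q \<le> 1" .
      have "K\<^sup>2 / 2 \<le> K * (K - 1)"
      proof -
        have "0 \<le> K * (K - 2)" using K by simp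
        then show ?thesis by (simp add: power2_eq_square algebra_simps)
      qed
      moreover have "(c * real n)\<^sup>2 \<le> K\<^sup>2" using c n K by (intro power_mono) auto
      ultimately have "(c * real n)\<^sup>2 / 2 \<le> K * (K - 1)" by linarith
      then have "2 * ((c * real n)\<^sup>2 / 2) * (1 / (4 * (real n)\<^sup>2)) \<le> 2 * (K * (K - 1)) * (1 - cos (1 / real n))"
        using elim K by (intro mult_mono mult_left_mono) auto
      then have qc: "c\<^sup>2 / 4 \<le> q" using n by (simp add: q_def phase_drift_def K_def power_mult_distrib mult_ac)
      have "2 * real n * \<eta> = q / (1 + q)" using phase_decay_bounds(2)[OF kn(2), of n] kn by (simp add: \<eta>_def q_def)
      also have "q / 2 \<le> q / (1 + q)" using q0 q1 by (intro divide_left_mono) auto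
      then have "c\<^sup>2 / 8 \<le> q / (1 + q)" using qc by linarith
      finally have \<eta>c: "c\<^sup>2 / (8 * real n) \<le> 2 * \<eta>" using n by (simp add: divide_le_eq mult_ac)
      define t where "t = nat \<lceil>A / (2 * \<eta>)\<rceil>"
      have t: "A \<le> 2 * real t * \<eta>" "real t \<le> A / (2 * \<eta>) + 1"
        using nat_ceiling_div[OF \<eta>pos A0] by (simp_all add: t_def mult_ac)
      have "mixing_time n (k n) \<le> t"
        using t(1) by (intro mixing_time_le tv_dist_unit_phase kn) (auto simp: A_def \<eta>_def)
      then have "real (mixing_time n (k n)) \<le> A / (2 * \<eta>) + 1" using t(2) by simp
      also have "A / (2 * \<eta>) \<le> 2 * ln (real n) / (c\<^sup>2 / (8 * real n))"
        using A0 \<eta>c elim c n by (intro frac_le) (auto simp: A_def)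
      also have "\<dots> = 16 / c\<^sup>2 * (real n * ln (real n))" by simp
      finally show ?case using elim n by (simp add: algebra_simps)
    qed
  qed
qed

lemma mixing_time_bigomega:
  fixes k :: "nat \<Rightarrow> nat"
  assumes k: "\<forall>\<^sub>F n in sequentially. 2 \<le> k n \<and> k n \<le> n"
    and O: "(\<lambda>n. real (k n)) \<in> \<Omega>(\<lambda>n. real n)"
  shows "(\<lambda>n. real (mixing_time n (k n))) \<in> \<Omega>(\<lambda>n. real n * ln (real n))"
proof -
  obtain c where c: "0 < c" "\<forall>\<^sub>F n in sequentially. c * norm (real n) \<le> norm (real (k n))"
    using O by (auto elim: landau_omega.bigE)
  have E: "\<forall>\<^sub>F n in sequentially. ln (real n) / 2 \<le> ln (c * real n) - 3" using c(1) by real_asymp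
  show ?thesis
  proof (rule landau_omega.bigI[where c = "c / 2"])
    show "\<forall>\<^sub>F n in sequentially. c / 2 * norm (real n * ln (real n)) \<le> norm (real (mixing_time n (k n)))"
      using k c(2) E eventually_gt_at_top[of 2]
    proof eventually_elim
      case (elim n)
      have n: "2 < real n" using elim by simp
      have "c / 2 * (real n * ln (real n)) = (c * real n) * (ln (real n) / 2)" by simp
      also have "\<dots> \<le> real (k n) * (ln (real (k n)) - 3)"
      proof (rule mult_mono)
        have "ln (c * real n) \<le> ln (real (k n))" using elim c n by (intro ln_mono) auto
        then show "ln (real n) / 2 \<le> ln (real (k n)) - 3" using elim by linarith
      qed (use elim n in auto)
      also have "\<dots> < real (mixing_time n (k n))" using elim by (intro mixing_time_lower_coupon) auto
      finally show ?case using n by simp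
    qed
  qed (use c in simp)
qed

theorem theorem4p7:
  fixes k :: "nat \<Rightarrow> nat"
  assumes "\<forall>\<^sub>F n in sequentially. 2 \<le> k n \<and> k n \<le> n"
  shows "((\<lambda>n. real (k n)) \<in> o(\<lambda>n. real n) \<longrightarrow>
      (\<exists>\<epsilon> \<delta> :: nat \<Rightarrow> real. \<epsilon> \<longlonglongrightarrow> 0 \<and> \<delta> \<longlonglongrightarrow> 0 \<and>
        (\<forall>\<^sub>F n in sequentially.
          (1 + \<epsilon> n) * (real n ^ 3 / (4 * pi ^ 2 * real (k n) * (real (k n) - 1))) * ln (real n)
            < real (mixing_time n (k n)) \<and>
          real (mixing_time n (k n))
            < (1 + \<delta> n) * (real n ^ 3 / (pi ^ 2 * real (k n) * (real (k n) - 1))) * ln (real n)))) \<and>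
    ((\<lambda>n. real (k n)) \<in> \<Theta>(\<lambda>n. real n) \<longrightarrow>
      (\<lambda>n. real (mixing_time n (k n))) \<in> \<Theta>(\<lambda>n. real n * ln (real n)))"
proof (intro conjI impI)
  assume o: "(\<lambda>n. real (k n)) \<in> o(\<lambda>n. real n)"
  let ?\<tau> = "\<lambda>n. real (mixing_time n (k n))"
  let ?f = "\<lambda>n. real n ^ 3 / (4 * pi ^ 2 * real (k n) * (real (k n) - 1)) * ln (real n)"
  let ?g = "\<lambda>n. real n ^ 3 / (pi ^ 2 * real (k n) * (real (k n) - 1)) * ln (real n)"
  have "\<forall>\<^sub>F n in sequentially. 0 < ?f n" "\<forall>\<^sub>F n in sequentially. 0 < ?g n"
    using assms eventually_gt_at_top[of 2]
    by (eventually_elim, auto intro!: mult_pos_pos divide_pos_pos)+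
  then obtain \<epsilon> \<delta> where "\<epsilon> \<longlonglongrightarrow> 0" "\<delta> \<longlonglongrightarrow> 0"
    and lo: "\<forall>\<^sub>F n in sequentially. (1 + \<epsilon> n) * ?f n < ?\<tau> n"
    and up: "\<forall>\<^sub>F n in sequentially. ?\<tau> n < (1 + \<delta> n) * ?g n"
    using little_o_lower_factor[of ?f ?\<tau>, OF _ eventually_mixing_time_lower[OF assms o]]
      little_o_upper_factor[of ?g ?\<tau>, OF _ eventually_mixing_time_upper[OF assms o]] by blast
  moreover have "\<forall>\<^sub>F n in sequentially.
          (1 + \<epsilon> n) * (real n ^ 3 / (4 * pi ^ 2 * real (k n) * (real (k n) - 1))) * ln (real n) < ?\<tau> n \<and>
          ?\<tau> n < (1 + \<delta> n) * (real n ^ 3 / (pi ^ 2 * real (k n) * (real (k n) - 1))) * ln (real n)"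
    using lo up by eventually_elim (simp only: mult.assoc simp_thms)
  ultimately show "\<exists>\<epsilon> \<delta> :: nat \<Rightarrow> real. \<epsilon> \<longlonglongrightarrow> 0 \<and> \<delta> \<longlonglongrightarrow> 0 \<and>
        (\<forall>\<^sub>F n in sequentially.
          (1 + \<epsilon> n) * (real n ^ 3 / (4 * pi ^ 2 * real (k n) * (real (k n) - 1))) * ln (real n) < ?\<tau> n \<and>
          ?\<tau> n < (1 + \<delta> n) * (real n ^ 3 / (pi ^ 2 * real (k n) * (real (k n) - 1))) * ln (real n))"
    by blast
next
  assume "(\<lambda>n. real (k n)) \<in> \<Theta>(\<lambda>n. real n)"
  then have "(\<lambda>n. real (k n)) \<in> \<Omega>(\<lambda>n. real n)" by (rule bigthetaD2)
  then show "(\<lambda>n. real (mixing_time n (k n))) \<in> \<Theta>(\<lambda>n. real n * ln (real n))"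
    using mixing_time_bigo[OF assms] mixing_time_bigomega[OF assms] by (intro bigthetaI)
qed

end
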